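(* Let $k\ge1$ and let $\Lambda$ be a row-finite $k$-graph without sources. Then the following hold. (i) If $\Lambda$ contains a generalized cycle, then there exist $0\ne a\in T_\Lambda$ and $\mathbf{n},\mathbf{m}\in\mathbb{N}^k$ with $\mathbf{n}\neq\mathbf{m}$ such that ${}^{\mathbf{n}}a\le{}^{\mathbf{m}}a$. (ii) If $\mathbb{Z}^k$ acts freely on $T_\Lambda$, then every generalized cycle in $\Lambda$ has an entrance. (iii) If there is a periodic atom in $T_\Lambda$, then there is a generalized cycle in $\Lambda$ which has no entrance. Consequently, in this case the $C^*$-algebra $C^*(\Lambda)$ is not AF.
   Context: $\mathbb{N}=\{0,1,2,\dots\}$; $\mathbb{Z}^k$ has the coordinatewise order, $\vee$ denotes coordinatewise maximum, $\mathbf{e}_i$ is the $i$-th unit vector. A $k$-graph is a countable small category $\Lambda$ with a functor $d:\Lambda\to\mathbb{N}^k$ (degree) such that whenever $d(\lambda)=\mathbf{n}+\mathbf{m}$ with $\mathbf{n},\mathbf{m}\in\mathbb{N}^k$ there are unique $\alpha,\beta\in\Lambda$ with $d(\alpha)=\mathbf{n}$, $d(\beta)=\mathbf{m}$, $\lambda=\alpha\beta$. The codomain and domain of a morphism (path) $\lambda$ are $r(\lambda)$ and $s(\lambda)$; $\lambda\mu$ is defined when $s(\lambda)=r(\mu)$. $\Lambda^{\mathbf{n}}=d^{-1}(\mathbf{n})$; elements of $\Lambda^0$ are identified with objects (vertices). $v\Lambda=\{\lambda: r(\lambda)=v\}$, $v\Lambda^{\mathbf{n}}=v\Lambda\cap\Lambda^{\mathbf{n}}$.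 $\Lambda$ is row-finite without sources if $0<|v\Lambda^{\mathbf{n}}|<\infty$ for all $v,\mathbf{n}$. For $0\le\mathbf{n}\le\mathbf{m}\le d(\lambda)$, $\lambda(\mathbf{n},\mathbf{m})$ is the unique path of degree $\mathbf{m}-\mathbf{n}$ with $\lambda=\alpha\lambda(\mathbf{n},\mathbf{m})\beta$, $d(\alpha)=\mathbf{n}$, $d(\beta)=d(\lambda)-\mathbf{m}$. For paths $\lambda,\mu$, $\mathrm{MCE}(\lambda,\mu)$ is the set of paths $\tau$ with $d(\tau)=d(\lambda)\vee d(\mu)$, $\tau(0,d(\lambda))=\lambda$ and $\tau(0,d(\mu))=\mu$. A generalized cycle is a pair $(\mu,\nu)$ of distinct paths with $s(\mu)=s(\nu)$, $r(\mu)=r(\nu)$ and $\mathrm{MCE}(\mu\tau,\nu)\ne\emptyset$ for every $\tau\in s(\mu)\Lambda$. An entrance to $(\mu,\nu)$ is a path $\tau\in s(\nu)\Lambda$ with $\mathrm{MCE}(\mu,\nu\tau)=\emptyset$. The talented monoid $T_\Lambda$ is the commutative monoid generated by symbols $v(\mathbf{n})$ ($v\in\Lambda^0$, $\mathbf{n}\in\mathbb{Z}^k$) subject to $v(\mathbf{n})=\sum_{\alpha\in v\Lambda^{\mathbf{e}_i}}s(\alpha)(\mathbf{n}+\mathbf{e}_i)$ for all $v,\mathbf{n}$ and $1\le i\le k$. $\mathbb{Z}^k$ acts by ${}^{\mathbf{q}}v(\mathbf{n})=v(\mathbf{n}+\mathbf{q})$. $x\le y$ means $y=x+z$ for some $z$.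 The action is free if ${}^{\mathbf{n}}a\ne a$ for all $0\neq a\in T_\Lambda$ and $0\ne\mathbf{n}\in\mathbb{Z}^k$. An atom is an element $a\neq0$ such that $a=b+c$ implies $b=0$ or $c=0$; $a$ is periodic if ${}^{\mathbf{p}}a=a$ for some $0\neq\mathbf{p}\in\mathbb{Z}^k$. $C^*(\Lambda)$ is the universal $C^*$-algebra generated by partial isometries $\{S_\lambda:\lambda\in\Lambda\}$ such that $\{S_v:v\in\Lambda^0\}$ are mutually orthogonal projections, $S_{\lambda\mu}=S_\lambda S_\mu$ when $s(\lambda)=r(\mu)$, $S_\lambda^*S_\lambda=S_{s(\lambda)}$, and $S_v=\sum_{\lambda\in v\Lambda^{\mathbf{n}}}S_\lambda S_\lambda^*$ for all $v,\mathbf{n}$. A $C^*$-algebra $\mathcal{A}$ is AF if $\mathcal{A}=\overline{\bigcup_{n\in\mathbb{N}}\mathcal{A}_n}$ for an increasing sequence of finite-dimensional $C^*$-subalgebras $\mathcal{A}_n$. *)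

theory Defs
  imports
    Complex_Main
    "HOL-Library.Multiset"
    "HOL-Library.Function_Algebras"
    "HOL-Library.Countable_Set"
    "HOL-Algebra.Module"
begin

section \<open>Higher-rank graphs\<close>

text \<open>
  Degrees are functions on a finite index type \<^typ>\<open>'k\<close>, ordered and added coordinatewise, so that
  \<^typ>\<open>'k \<Rightarrow> nat\<close> and \<^typ>\<open>'k \<Rightarrow> int\<close> play the roles of \<open>\<nat>\<^sup>k\<close> and \<open>\<int>\<^sup>k\<close>; \<^const>\<open>sup\<close> is the
  coordinatewise maximum. As types are nonempty, \<open>k \<ge> 1\<close>.
  The composite \<open>pcomp \<Lambda> \<kappa> \<mu>\<close> is meaningful if \<open>src \<Lambda> \<kappa> = rng \<Lambda> \<mu>\<close>.
\<close>

record ('o, 'm, 'k) kgraph =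
  Obj :: "'o set"
  Mor :: "'m set"
  rng :: "'m \<Rightarrow> 'o"
  src :: "'m \<Rightarrow> 'o"
  ident :: "'o \<Rightarrow> 'm"
  pcomp :: "'m \<Rightarrow> 'm \<Rightarrow> 'm"
  deg :: "'m \<Rightarrow> 'k \<Rightarrow> nat"

locale k_graph =
  fixes \<Lambda> :: "('o, 'm, 'k::finite) kgraph"
  assumes rng_closed: "\<kappa> \<in> Mor \<Lambda> \<Longrightarrow> rng \<Lambda> \<kappa> \<in> Obj \<Lambda>"
    and src_closed: "\<kappa> \<in> Mor \<Lambda> \<Longrightarrow> src \<Lambda> \<kappa> \<in> Obj \<Lambda>"
    and ident_closed: "v \<in> Obj \<Lambda> \<Longrightarrow> ident \<Lambda> v \<in> Mor \<Lambda>"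
    and rng_ident: "v \<in> Obj \<Lambda> \<Longrightarrow> rng \<Lambda> (ident \<Lambda> v) = v"
    and src_ident: "v \<in> Obj \<Lambda> \<Longrightarrow> src \<Lambda> (ident \<Lambda> v) = v"
    and pcomp_closed: "\<lbrakk>\<kappa> \<in> Mor \<Lambda>; \<mu> \<in> Mor \<Lambda>; src \<Lambda> \<kappa> = rng \<Lambda> \<mu>\<rbrakk> \<Longrightarrow> pcomp \<Lambda> \<kappa> \<mu> \<in> Mor \<Lambda>"
    and rng_pcomp: "\<lbrakk>\<kappa> \<in> Mor \<Lambda>; \<mu> \<in> Mor \<Lambda>; src \<Lambda> \<kappa> = rng \<Lambda> \<mu>\<rbrakk> \<Longrightarrow> rng \<Lambda> (pcomp \<Lambda> \<kappa> \<mu>) = rng \<Lambda> \<kappa>"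
    and src_pcomp: "\<lbrakk>\<kappa> \<in> Mor \<Lambda>; \<mu> \<in> Mor \<Lambda>; src \<Lambda> \<kappa> = rng \<Lambda> \<mu>\<rbrakk> \<Longrightarrow> src \<Lambda> (pcomp \<Lambda> \<kappa> \<mu>) = src \<Lambda> \<mu>"
    and pcomp_ident_left: "\<kappa> \<in> Mor \<Lambda> \<Longrightarrow> pcomp \<Lambda> (ident \<Lambda> (rng \<Lambda> \<kappa>)) \<kappa> = \<kappa>"
    and pcomp_ident_right: "\<kappa> \<in> Mor \<Lambda> \<Longrightarrow> pcomp \<Lambda> \<kappa> (ident \<Lambda> (src \<Lambda> \<kappa>)) = \<kappa>"
    and pcomp_assoc:
      "\<lbrakk>\<kappa> \<in> Mor \<Lambda>; \<mu> \<in> Mor \<Lambda>; \<nu> \<in> Mor \<Lambda>; src \<Lambda> \<kappa> = rng \<Lambda> \<mu>; src \<Lambda> \<mu> = rng \<Lambda> \<nu>\<rbrakk> \<Longrightarrow>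
        pcomp \<Lambda> (pcomp \<Lambda> \<kappa> \<mu>) \<nu> = pcomp \<Lambda> \<kappa> (pcomp \<Lambda> \<mu> \<nu>)"
    and countable_Mor: "countable (Mor \<Lambda>)"
    and deg_ident: "v \<in> Obj \<Lambda> \<Longrightarrow> deg \<Lambda> (ident \<Lambda> v) = 0"
    and deg_pcomp: "\<lbrakk>\<kappa> \<in> Mor \<Lambda>; \<mu> \<in> Mor \<Lambda>; src \<Lambda> \<kappa> = rng \<Lambda> \<mu>\<rbrakk> \<Longrightarrow> deg \<Lambda> (pcomp \<Lambda> \<kappa> \<mu>) = deg \<Lambda> \<kappa> + deg \<Lambda> \<mu>"
    and factorization: "\<lbrakk>\<kappa> \<in> Mor \<Lambda>; deg \<Lambda> \<kappa> = n + m\<rbrakk> \<Longrightarrow>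
        \<exists>!p. fst p \<in> Mor \<Lambda> \<and> snd p \<in> Mor \<Lambda> \<and> deg \<Lambda> (fst p) = n \<and> deg \<Lambda> (snd p) = m \<and>
          src \<Lambda> (fst p) = rng \<Lambda> (snd p) \<and> \<kappa> = pcomp \<Lambda> (fst p) (snd p)"

definition paths_from :: "('o, 'm, 'k) kgraph \<Rightarrow> 'o \<Rightarrow> 'm set" where
  "paths_from \<Lambda> v = {\<kappa> \<in> Mor \<Lambda>. rng \<Lambda> \<kappa> = v}"

definition paths_from_deg :: "('o, 'm, 'k) kgraph \<Rightarrow> 'o \<Rightarrow> ('k \<Rightarrow> nat) \<Rightarrow> 'm set" where
  "paths_from_deg \<Lambda> v n = {\<kappa> \<in> paths_from \<Lambda> v. deg \<Lambda> \<kappa> = n}"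

definition row_finite_no_sources :: "('o, 'm, 'k) kgraph \<Rightarrow> bool" where
  "row_finite_no_sources \<Lambda> \<longleftrightarrow>
    (\<forall>v \<in> Obj \<Lambda>. \<forall>n. paths_from_deg \<Lambda> v n \<noteq> {} \<and> finite (paths_from_deg \<Lambda> v n))"

text \<open>\<open>segment \<Lambda> \<kappa> n m\<close> is the path \<open>\<kappa>(n, m)\<close>, meaningful for \<open>n \<le> m \<le> deg \<Lambda> \<kappa>\<close>.\<close>

definition segment :: "('o, 'm, 'k) kgraph \<Rightarrow> 'm \<Rightarrow> ('k \<Rightarrow> nat) \<Rightarrow> ('k \<Rightarrow> nat) \<Rightarrow> 'm" where
  "segment \<Lambda> \<kappa> n m = (THE \<beta>. \<exists>\<alpha> \<gamma>. \<alpha> \<in> Mor \<Lambda> \<and> \<beta> \<in> Mor \<Lambda> \<and> \<gamma> \<in> Mor \<Lambda> \<and>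
     deg \<Lambda> \<alpha> = n \<and> deg \<Lambda> \<beta> = m - n \<and> deg \<Lambda> \<gamma> = deg \<Lambda> \<kappa> - m \<and>
     src \<Lambda> \<alpha> = rng \<Lambda> \<beta> \<and> src \<Lambda> \<beta> = rng \<Lambda> \<gamma> \<and> \<kappa> = pcomp \<Lambda> \<alpha> (pcomp \<Lambda> \<beta> \<gamma>))"

definition MCE :: "('o, 'm, 'k) kgraph \<Rightarrow> 'm \<Rightarrow> 'm \<Rightarrow> 'm set" where
  "MCE \<Lambda> \<kappa> \<mu> = {\<tau> \<in> Mor \<Lambda>. deg \<Lambda> \<tau> = sup (deg \<Lambda> \<kappa>) (deg \<Lambda> \<mu>) \<and>
     segment \<Lambda> \<tau> 0 (deg \<Lambda> \<kappa>) = \<kappa> \<and> segment \<Lambda> \<tau> 0 (deg \<Lambda> \<mu>) = \<mu>}"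

definition generalized_cycle :: "('o, 'm, 'k) kgraph \<Rightarrow> 'm \<Rightarrow> 'm \<Rightarrow> bool" where
  "generalized_cycle \<Lambda> \<mu> \<nu> \<longleftrightarrow>
     \<mu> \<in> Mor \<Lambda> \<and> \<nu> \<in> Mor \<Lambda> \<and> \<mu> \<noteq> \<nu> \<and> src \<Lambda> \<mu> = src \<Lambda> \<nu> \<and> rng \<Lambda> \<mu> = rng \<Lambda> \<nu> \<and>
     (\<forall>\<tau> \<in> paths_from \<Lambda> (src \<Lambda> \<mu>). MCE \<Lambda> (pcomp \<Lambda> \<mu> \<tau>) \<nu> \<noteq> {})"

definition entrance :: "('o, 'm, 'k) kgraph \<Rightarrow> 'm \<Rightarrow> 'm \<Rightarrow> 'm \<Rightarrow> bool" where
  "entrance \<Lambda> \<mu> \<nu> \<tau> \<longleftrightarrow> \<tau> \<in> paths_from \<Lambda> (src \<Lambda> \<nu>) \<and> MCE \<Lambda> \<mu> (pcomp \<Lambda> \<nu> \<tau>) = {}"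


section \<open>The talented monoid\<close>

definition unit_deg :: "'k \<Rightarrow> 'k \<Rightarrow> 'a::zero_neq_one" where
  "unit_deg i = (\<lambda>j. if j = i then 1 else 0)"

text \<open>
  The free commutative monoid on the symbols \<open>v(n)\<close> consists of the multisets of pairs \<open>(v, n)\<close>; the
  talented monoid is its quotient by the least congruence containing the defining relations.
\<close>

definition talented_free :: "('o, 'm, 'k) kgraph \<Rightarrow> ('o \<times> ('k \<Rightarrow> int)) multiset set" where
  "talented_free \<Lambda> = {M. set_mset M \<subseteq> Obj \<Lambda> \<times> UNIV}"

inductive_set talented_cong ::
    "('o, 'm, 'k) kgraph \<Rightarrow> (('o \<times> ('k \<Rightarrow> int)) multiset \<times> ('o \<times> ('k \<Rightarrow> int)) multiset) set"
  for \<Lambda> :: "('o, 'm, 'k) kgraph" where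
  talented_expand: "v \<in> Obj \<Lambda> \<Longrightarrow>
    ({#(v, n)#},
     image_mset (\<lambda>\<alpha>. (src \<Lambda> \<alpha>, n + unit_deg i)) (mset_set (paths_from_deg \<Lambda> v (unit_deg i))))
    \<in> talented_cong \<Lambda>"
| talented_refl: "M \<in> talented_free \<Lambda> \<Longrightarrow> (M, M) \<in> talented_cong \<Lambda>"
| talented_sym: "(M, N) \<in> talented_cong \<Lambda> \<Longrightarrow> (N, M) \<in> talented_cong \<Lambda>"
| talented_trans: "(M, N) \<in> talented_cong \<Lambda> \<Longrightarrow> (N, P) \<in> talented_cong \<Lambda> \<Longrightarrow> (M, P) \<in> talented_cong \<Lambda>"
| talented_add: "(M, N) \<in> talented_cong \<Lambda> \<Longrightarrow> (M', N') \<in> talented_cong \<Lambda> \<Longrightarrow>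
    (M + M', N + N') \<in> talented_cong \<Lambda>"

text \<open>
  The library's monoids are written multiplicatively: \<open>\<otimes>\<close> and \<open>\<one>\<close> are the addition and the zero of
  the talented monoid.
\<close>

definition talented_monoid ::
    "('o, 'm, 'k) kgraph \<Rightarrow> ('o \<times> ('k \<Rightarrow> int)) multiset set monoid" where
  "talented_monoid \<Lambda> =
    \<lparr>carrier = talented_free \<Lambda> // talented_cong \<Lambda>,
     mult = (\<lambda>X Y. \<Union>M\<in>X. \<Union>N\<in>Y. talented_cong \<Lambda> `` {M + N}),
     one = talented_cong \<Lambda> `` {{#}}\<rparr>"

text \<open>The congruence is invariant under shifting, so the image of a class is again a class.\<close>

definition shift ::
    "('k \<Rightarrow> int) \<Rightarrow> ('o \<times> ('k \<Rightarrow> int)) multiset set \<Rightarrow> ('o \<times> ('k \<Rightarrow> int)) multiset set" where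
  "shift q X = image_mset (\<lambda>(v, n). (v, n + q)) ` X"

definition monoid_le :: "('a, 'b) monoid_scheme \<Rightarrow> 'a \<Rightarrow> 'a \<Rightarrow> bool" where
  "monoid_le T x y \<longleftrightarrow> (\<exists>z \<in> carrier T. y = x \<otimes>\<^bsub>T\<^esub> z)"

definition monoid_atom :: "('a, 'b) monoid_scheme \<Rightarrow> 'a \<Rightarrow> bool" where
  "monoid_atom T a \<longleftrightarrow> a \<in> carrier T \<and> a \<noteq> \<one>\<^bsub>T\<^esub> \<and>
     (\<forall>b \<in> carrier T. \<forall>c \<in> carrier T. a = b \<otimes>\<^bsub>T\<^esub> c \<longrightarrow> b = \<one>\<^bsub>T\<^esub> \<or> c = \<one>\<^bsub>T\<^esub>)"

definition periodic :: "('o \<times> ('k \<Rightarrow> int)) multiset set \<Rightarrow> bool" where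
  "periodic a \<longleftrightarrow> (\<exists>p. p \<noteq> 0 \<and> shift p a = a)"

definition free_action :: "('o, 'm, 'k) kgraph \<Rightarrow> bool" where
  "free_action \<Lambda> \<longleftrightarrow>
     (\<forall>a \<in> carrier (talented_monoid \<Lambda>). \<forall>n. a \<noteq> \<one>\<^bsub>talented_monoid \<Lambda>\<^esub> \<longrightarrow> n \<noteq> 0 \<longrightarrow> shift n a \<noteq> a)"


section \<open>C*-algebras\<close>

text \<open>
  Algebras need not be unital: the field \<^const>\<open>one\<close> of the underlying library record is not used.
\<close>

definition complex_ring :: "complex ring" where
  "complex_ring = \<lparr>carrier = UNIV, mult = (*), one = 1, zero = 0, add = (+)\<rparr>"

record 'c star_alg = "(complex, 'c) module" +
  star :: "'c \<Rightarrow> 'c"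

record 'c cstar_alg = "'c star_alg" +
  nrm :: "'c \<Rightarrow> real"

locale star_algebra = module complex_ring A for A :: "('c, 'b) star_alg_scheme" (structure) +
  assumes mult_closed: "\<lbrakk>x \<in> carrier A; y \<in> carrier A\<rbrakk> \<Longrightarrow> x \<otimes> y \<in> carrier A"
    and mult_assoc: "\<lbrakk>x \<in> carrier A; y \<in> carrier A; z \<in> carrier A\<rbrakk> \<Longrightarrow> (x \<otimes> y) \<otimes> z = x \<otimes> (y \<otimes> z)"
    and mult_l_distr: "\<lbrakk>x \<in> carrier A; y \<in> carrier A; z \<in> carrier A\<rbrakk> \<Longrightarrow> (x \<oplus> y) \<otimes> z = x \<otimes> z \<oplus> y \<otimes> z"
    and mult_r_distr: "\<lbrakk>x \<in> carrier A; y \<in> carrier A; z \<in> carrier A\<rbrakk> \<Longrightarrow> z \<otimes> (x \<oplus> y) = z \<otimes> x \<oplus> z \<otimes> y"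
    and mult_smult_left: "\<lbrakk>x \<in> carrier A; y \<in> carrier A\<rbrakk> \<Longrightarrow> (c \<odot> x) \<otimes> y = c \<odot> (x \<otimes> y)"
    and mult_smult_right: "\<lbrakk>x \<in> carrier A; y \<in> carrier A\<rbrakk> \<Longrightarrow> x \<otimes> (c \<odot> y) = c \<odot> (x \<otimes> y)"
    and star_closed: "x \<in> carrier A \<Longrightarrow> star A x \<in> carrier A"
    and star_star: "x \<in> carrier A \<Longrightarrow> star A (star A x) = x"
    and star_add: "\<lbrakk>x \<in> carrier A; y \<in> carrier A\<rbrakk> \<Longrightarrow> star A (x \<oplus> y) = star A x \<oplus> star A y"
    and star_smult: "x \<in> carrier A \<Longrightarrow> star A (c \<odot> x) = cnj c \<odot> star A x"
    and star_mult: "\<lbrakk>x \<in> carrier A; y \<in> carrier A\<rbrakk> \<Longrightarrow> star A (x \<otimes> y) = star A y \<otimes> star A x"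

definition cstar_seminorm :: "('c, 'b) star_alg_scheme \<Rightarrow> ('c \<Rightarrow> real) \<Rightarrow> bool" where
  "cstar_seminorm A \<rho> \<longleftrightarrow>
     (\<forall>x \<in> carrier A. 0 \<le> \<rho> x) \<and>
     (\<forall>x \<in> carrier A. \<forall>y \<in> carrier A. \<rho> (x \<oplus>\<^bsub>A\<^esub> y) \<le> \<rho> x + \<rho> y) \<and>
     (\<forall>c. \<forall>x \<in> carrier A. \<rho> (c \<odot>\<^bsub>A\<^esub> x) = cmod c * \<rho> x) \<and>
     (\<forall>x \<in> carrier A. \<forall>y \<in> carrier A. \<rho> (x \<otimes>\<^bsub>A\<^esub> y) \<le> \<rho> x * \<rho> y) \<and>
     (\<forall>x \<in> carrier A. \<rho> (star A x \<otimes>\<^bsub>A\<^esub> x) = (\<rho> x)\<^sup>2)"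

definition seminorm_Cauchy :: "('c, 'b) star_alg_scheme \<Rightarrow> ('c \<Rightarrow> real) \<Rightarrow> (nat \<Rightarrow> 'c) \<Rightarrow> bool" where
  "seminorm_Cauchy A \<rho> X \<longleftrightarrow> (\<forall>n. X n \<in> carrier A) \<and>
     (\<forall>e>0. \<exists>N. \<forall>m\<ge>N. \<forall>n\<ge>N. \<rho> (X m \<ominus>\<^bsub>A\<^esub> X n) < e)"

locale cstar_algebra = star_algebra A for A :: "'c cstar_alg" (structure) +
  assumes cstar_norm: "cstar_seminorm A (nrm A)"
    and nrm_definite: "x \<in> carrier A \<Longrightarrow> nrm A x = 0 \<Longrightarrow> x = \<zero>"
    and complete: "seminorm_Cauchy A (nrm A) X \<Longrightarrow>
      \<exists>x \<in> carrier A. (\<lambda>n. nrm A (X n \<ominus> x)) \<longlonglongrightarrow> 0"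

text \<open>The Hausdorff completion of a *-algebra with respect to a C*-seminorm.\<close>

definition null_rel :: "('c, 'b) star_alg_scheme \<Rightarrow> ('c \<Rightarrow> real) \<Rightarrow> ((nat \<Rightarrow> 'c) \<times> (nat \<Rightarrow> 'c)) set" where
  "null_rel A \<rho> = {(X, Y). seminorm_Cauchy A \<rho> X \<and> seminorm_Cauchy A \<rho> Y \<and>
     (\<lambda>n. \<rho> (X n \<ominus>\<^bsub>A\<^esub> Y n)) \<longlonglongrightarrow> 0}"

definition completion :: "('c, 'b) star_alg_scheme \<Rightarrow> ('c \<Rightarrow> real) \<Rightarrow> (nat \<Rightarrow> 'c) set cstar_alg" where
  "completion A \<rho> =
    \<lparr>carrier = Collect (seminorm_Cauchy A \<rho>) // null_rel A \<rho>,
     mult = (\<lambda>P Q. \<Union>X\<in>P. \<Union>Y\<in>Q. null_rel A \<rho> `` {\<lambda>n. X n \<otimes>\<^bsub>A\<^esub> Y n}),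
     one = undefined,
     zero = null_rel A \<rho> `` {\<lambda>n. \<zero>\<^bsub>A\<^esub>},
     add = (\<lambda>P Q. \<Union>X\<in>P. \<Union>Y\<in>Q. null_rel A \<rho> `` {\<lambda>n. X n \<oplus>\<^bsub>A\<^esub> Y n}),
     smult = (\<lambda>c P. \<Union>X\<in>P. null_rel A \<rho> `` {\<lambda>n. c \<odot>\<^bsub>A\<^esub> X n}),
     star = (\<lambda>P. \<Union>X\<in>P. null_rel A \<rho> `` {\<lambda>n. star A (X n)}),
     nrm = (\<lambda>P. THE l. \<forall>X\<in>P. (\<lambda>n. \<rho> (X n)) \<longlonglongrightarrow> l)\<rparr>"

definition star_hom :: "('c, 'b) star_alg_scheme \<Rightarrow> ('d, 'e) star_alg_scheme \<Rightarrow> ('c \<Rightarrow> 'd) \<Rightarrow> bool" where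
  "star_hom A B \<phi> \<longleftrightarrow>
     (\<forall>x \<in> carrier A. \<phi> x \<in> carrier B) \<and>
     (\<forall>x \<in> carrier A. \<forall>y \<in> carrier A. \<phi> (x \<oplus>\<^bsub>A\<^esub> y) = \<phi> x \<oplus>\<^bsub>B\<^esub> \<phi> y) \<and>
     (\<forall>c. \<forall>x \<in> carrier A. \<phi> (c \<odot>\<^bsub>A\<^esub> x) = c \<odot>\<^bsub>B\<^esub> \<phi> x) \<and>
     (\<forall>x \<in> carrier A. \<forall>y \<in> carrier A. \<phi> (x \<otimes>\<^bsub>A\<^esub> y) = \<phi> x \<otimes>\<^bsub>B\<^esub> \<phi> y) \<and>
     (\<forall>x \<in> carrier A. \<phi> (star A x) = star B (\<phi> x))"

definition cstar_subalgebra :: "'c cstar_alg \<Rightarrow> 'c set \<Rightarrow> bool" where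
  "cstar_subalgebra A V \<longleftrightarrow> V \<subseteq> carrier A \<and> \<zero>\<^bsub>A\<^esub> \<in> V \<and>
     (\<forall>x \<in> V. \<forall>y \<in> V. x \<oplus>\<^bsub>A\<^esub> y \<in> V) \<and>
     (\<forall>c. \<forall>x \<in> V. c \<odot>\<^bsub>A\<^esub> x \<in> V) \<and>
     (\<forall>x \<in> V. \<forall>y \<in> V. x \<otimes>\<^bsub>A\<^esub> y \<in> V) \<and>
     (\<forall>x \<in> V. star A x \<in> V) \<and>
     (\<forall>X. \<forall>x \<in> carrier A. (\<forall>n. X n \<in> V) \<longrightarrow> (\<lambda>n. nrm A (X n \<ominus>\<^bsub>A\<^esub> x)) \<longlonglongrightarrow> 0 \<longrightarrow> x \<in> V)"

definition finite_dimensional :: "('c, 'b) star_alg_scheme \<Rightarrow> 'c set \<Rightarrow> bool" where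
  "finite_dimensional A V \<longleftrightarrow>
     (\<exists>B. finite B \<and> B \<subseteq> V \<and> (\<forall>x \<in> V. \<exists>c. x = (\<Oplus>\<^bsub>A\<^esub>b\<in>B. c b \<odot>\<^bsub>A\<^esub> b)))"

definition AF_algebra :: "'c cstar_alg \<Rightarrow> bool" where
  "AF_algebra A \<longleftrightarrow> (\<exists>F :: nat \<Rightarrow> 'c set.
     (\<forall>n. cstar_subalgebra A (F n) \<and> finite_dimensional A (F n)) \<and>
     (\<forall>n. F n \<subseteq> F (Suc n)) \<and>
     (\<forall>x \<in> carrier A. \<forall>e>0. \<exists>n. \<exists>y \<in> F n. nrm A (x \<ominus>\<^bsub>A\<^esub> y) < e))"


section \<open>The C*-algebra of a higher-rank graph\<close>

text \<open>
  The defining relations for a family \<open>S\<close> of elements of a *-algebra \<open>A\<close>, as a set of pairs of elements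
  that have to be equal. A vertex \<open>v\<close> is viewed as the path \<open>ident \<Lambda> v\<close>.
\<close>

inductive_set ck_relations :: "('o, 'm, 'k) kgraph \<Rightarrow> ('c, 'b) star_alg_scheme \<Rightarrow> ('m \<Rightarrow> 'c) \<Rightarrow> ('c \<times> 'c) set"
  for \<Lambda> :: "('o, 'm, 'k) kgraph" and A :: "('c, 'b) star_alg_scheme" (structure) and S :: "'m \<Rightarrow> 'c" where
  ck_idempotent: "v \<in> Obj \<Lambda> \<Longrightarrow>
    (S (ident \<Lambda> v) \<otimes> S (ident \<Lambda> v), S (ident \<Lambda> v)) \<in> ck_relations \<Lambda> A S"
| ck_selfadjoint: "v \<in> Obj \<Lambda> \<Longrightarrow>
    (star A (S (ident \<Lambda> v)), S (ident \<Lambda> v)) \<in> ck_relations \<Lambda> A S"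
| ck_orthogonal: "\<lbrakk>v \<in> Obj \<Lambda>; w \<in> Obj \<Lambda>; v \<noteq> w\<rbrakk> \<Longrightarrow>
    (S (ident \<Lambda> v) \<otimes> S (ident \<Lambda> w), \<zero>) \<in> ck_relations \<Lambda> A S"
| ck_partial_isometry: "\<kappa> \<in> Mor \<Lambda> \<Longrightarrow>
    (S \<kappa> \<otimes> star A (S \<kappa>) \<otimes> S \<kappa>, S \<kappa>) \<in> ck_relations \<Lambda> A S"
| ck_composition: "\<lbrakk>\<kappa> \<in> Mor \<Lambda>; \<mu> \<in> Mor \<Lambda>; src \<Lambda> \<kappa> = rng \<Lambda> \<mu>\<rbrakk> \<Longrightarrow>
    (S (pcomp \<Lambda> \<kappa> \<mu>), S \<kappa> \<otimes> S \<mu>) \<in> ck_relations \<Lambda> A S"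
| ck_source_projection: "\<kappa> \<in> Mor \<Lambda> \<Longrightarrow>
    (star A (S \<kappa>) \<otimes> S \<kappa>, S (ident \<Lambda> (src \<Lambda> \<kappa>))) \<in> ck_relations \<Lambda> A S"
| ck_range_projections: "v \<in> Obj \<Lambda> \<Longrightarrow>
    (S (ident \<Lambda> v), \<Oplus>\<kappa>\<in>paths_from_deg \<Lambda> v n. S \<kappa> \<otimes> star A (S \<kappa>)) \<in> ck_relations \<Lambda> A S"

definition ck_family :: "('o, 'm, 'k) kgraph \<Rightarrow> ('c, 'b) star_alg_scheme \<Rightarrow> ('m \<Rightarrow> 'c) \<Rightarrow> bool" where
  "ck_family \<Lambda> A S \<longleftrightarrow> (\<forall>\<kappa> \<in> Mor \<Lambda>. S \<kappa> \<in> carrier A) \<and> (\<forall>(x, y) \<in> ck_relations \<Lambda> A S. x = y)"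

text \<open>
  The free *-algebra on a set \<open>G\<close> has as basis the nonempty words in letters \<open>(g, b)\<close>, \<open>g \<in> G\<close>, where
  \<open>(g, False)\<close> stands for \<open>g\<close> and \<open>(g, True)\<close> for its adjoint. An element is the function of its
  coefficients, and multiplication is convolution.
\<close>

definition free_star_alg :: "'m set \<Rightarrow> (('m \<times> bool) list \<Rightarrow> complex) star_alg" where
  "free_star_alg G =
    \<lparr>carrier = {f. finite {w. f w \<noteq> 0} \<and> (\<forall>w. f w \<noteq> 0 \<longrightarrow> w \<noteq> [] \<and> fst ` set w \<subseteq> G)},
     mult = (\<lambda>f g w. \<Sum>i\<le>length w. f (take i w) * g (drop i w)),
     one = undefined,
     zero = (\<lambda>w. 0),
     add = (\<lambda>f g w. f w + g w),
     smult = (\<lambda>c f w. c * f w),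
     star = (\<lambda>f w. cnj (f (rev (map (\<lambda>(g, b). (g, \<not> b)) w))))\<rparr>"

definition free_gen :: "'m \<Rightarrow> ('m \<times> bool) list \<Rightarrow> complex" where
  "free_gen g = (\<lambda>w. if w = [(g, False)] then 1 else 0)"

text \<open>
  The universal C*-algebra for these generators and relations is the completion of the free *-algebra
  in the largest C*-seminorm that respects the relations. The lemmas \<open>kgraph_cstar_algebra\<close>,
  \<open>kgraph_cstar_family\<close>, \<open>kgraph_cstar_generated\<close> and \<open>kgraph_cstar_universal\<close> below confirm that it is a
  C*-algebra, generated by \<open>kgraph_gen\<close>, with the universal property.
\<close>

definition ck_seminorm :: "('o, 'm, 'k) kgraph \<Rightarrow> ((('m \<times> bool) list \<Rightarrow> complex) \<Rightarrow> real) \<Rightarrow> bool" where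
  "ck_seminorm \<Lambda> \<rho> \<longleftrightarrow> cstar_seminorm (free_star_alg (Mor \<Lambda>)) \<rho> \<and>
     (\<forall>(x, y) \<in> ck_relations \<Lambda> (free_star_alg (Mor \<Lambda>)) free_gen.
        \<rho> (x \<ominus>\<^bsub>free_star_alg (Mor \<Lambda>)\<^esub> y) = 0)"

definition universal_seminorm :: "('o, 'm, 'k) kgraph \<Rightarrow> (('m \<times> bool) list \<Rightarrow> complex) \<Rightarrow> real" where
  "universal_seminorm \<Lambda> x = (SUP \<rho> \<in> {\<rho>. ck_seminorm \<Lambda> \<rho>}. \<rho> x)"

definition kgraph_cstar :: "('o, 'm, 'k) kgraph \<Rightarrow> (nat \<Rightarrow> ('m \<times> bool) list \<Rightarrow> complex) set cstar_alg" where
  "kgraph_cstar \<Lambda> = completion (free_star_alg (Mor \<Lambda>)) (universal_seminorm \<Lambda>)"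

definition kgraph_gen :: "('o, 'm, 'k) kgraph \<Rightarrow> 'm \<Rightarrow> (nat \<Rightarrow> ('m \<times> bool) list \<Rightarrow> complex) set" where
  "kgraph_gen \<Lambda> \<kappa> = null_rel (free_star_alg (Mor \<Lambda>)) (universal_seminorm \<Lambda>) `` {\<lambda>n. free_gen \<kappa>}"


section \<open>The talented monoid is a commutative monoid with an action by shifts\<close>

lemma (in k_graph) talented_cong_free:
  "(M, N) \<in> talented_cong \<Lambda> \<Longrightarrow> M \<in> talented_free \<Lambda> \<and> N \<in> talented_free \<Lambda>"
proof (induction rule: talented_cong.induct)
  case (talented_expand v n i)
  have "src \<Lambda> \<alpha> \<in> Obj \<Lambda>" if "\<alpha> \<in># mset_set (paths_from_deg \<Lambda> v (unit_deg i))" for \<alpha>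
    using that src_closed by (cases "finite (paths_from_deg \<Lambda> v (unit_deg i))") (auto simp: paths_from_deg_def paths_from_def)
  then show ?case using talented_expand by (auto simp: talented_free_def)
qed (auto simp: talented_free_def)

lemma (in k_graph) equiv_talented: "equiv (talented_free \<Lambda>) (talented_cong \<Lambda>)"
proof (rule equivI)
  show "refl_on (talented_free \<Lambda>) (talented_cong \<Lambda>)"
    by (auto simp: refl_on_def intro: talented_refl)
  show "sym (talented_cong \<Lambda>)" by (rule symI) (rule talented_sym)
  show "trans (talented_cong \<Lambda>)" by (rule transI) (rule talented_trans)
qed (use talented_cong_free in auto)

lemma (in k_graph) talented_mult:
  assumes "M \<in> talented_free \<Lambda>" "N \<in> talented_free \<Lambda>"
  shows "(talented_cong \<Lambda> `` {M}) \<otimes>\<^bsub>talented_monoid \<Lambda>\<^esub> (talented_cong \<Lambda> `` {N}) = talented_cong \<Lambda> `` {M + N}"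
proof -
  have "congruent2 (talented_cong \<Lambda>) (talented_cong \<Lambda>) (\<lambda>M N. talented_cong \<Lambda> `` {M + N})"
    by (rule congruent2I'[OF _]) (rule equiv_class_eq[OF equiv_talented talented_add])
  from UN_equiv_class2[OF equiv_talented equiv_talented this assms] show ?thesis
    by (simp add: talented_monoid_def)
qed

lemma (in k_graph) comm_monoid_talented: "comm_monoid (talented_monoid \<Lambda>)"
proof -
  have c: "\<exists>M \<in> talented_free \<Lambda>. X = talented_cong \<Lambda> `` {M}" if "X \<in> carrier (talented_monoid \<Lambda>)" for X
    using that by (auto simp: talented_monoid_def elim: quotientE)
  have i: "talented_cong \<Lambda> `` {M} \<in> carrier (talented_monoid \<Lambda>)" if "M \<in> talented_free \<Lambda>" for M
    using that by (simp add: talented_monoid_def quotientI)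
  have p: "M + N \<in> talented_free \<Lambda>" if "M \<in> talented_free \<Lambda>" "N \<in> talented_free \<Lambda>" for M N
    using that by (auto simp: talented_free_def)
  have z: "{#} \<in> talented_free \<Lambda>" "\<one>\<^bsub>talented_monoid \<Lambda>\<^esub> = talented_cong \<Lambda> `` {{#}}"
    by (simp_all add: talented_free_def talented_monoid_def)
  show ?thesis
  proof (rule comm_monoidI)
    fix X Y assume "X \<in> carrier (talented_monoid \<Lambda>)" "Y \<in> carrier (talented_monoid \<Lambda>)"
    then obtain M N where M: "M \<in> talented_free \<Lambda>" "X = talented_cong \<Lambda> `` {M}"
      and N: "N \<in> talented_free \<Lambda>" "Y = talented_cong \<Lambda> `` {N}" using c by meson
    show "X \<otimes>\<^bsub>talented_monoid \<Lambda>\<^esub> Y \<in> carrier (talented_monoid \<Lambda>)"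
      and "X \<otimes>\<^bsub>talented_monoid \<Lambda>\<^esub> Y = Y \<otimes>\<^bsub>talented_monoid \<Lambda>\<^esub> X"
      and "\<one>\<^bsub>talented_monoid \<Lambda>\<^esub> \<otimes>\<^bsub>talented_monoid \<Lambda>\<^esub> X = X"
      using M N z by (simp_all add: talented_mult i p add.commute)
    fix Z assume "Z \<in> carrier (talented_monoid \<Lambda>)"
    then obtain P where P: "P \<in> talented_free \<Lambda>" "Z = talented_cong \<Lambda> `` {P}" using c by meson
    show "X \<otimes>\<^bsub>talented_monoid \<Lambda>\<^esub> Y \<otimes>\<^bsub>talented_monoid \<Lambda>\<^esub> Z
        = X \<otimes>\<^bsub>talented_monoid \<Lambda>\<^esub> (Y \<otimes>\<^bsub>talented_monoid \<Lambda>\<^esub> Z)"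
      using M N P by (simp add: talented_mult p add.assoc)
  qed (use i z in simp)
qed

lemma (in k_graph) talented_cong_shift:
  "(M, N) \<in> talented_cong \<Lambda> \<Longrightarrow>
    (image_mset (\<lambda>(v, n). (v, n + q)) M, image_mset (\<lambda>(v, n). (v, n + q)) N) \<in> talented_cong \<Lambda>"
proof (induction rule: talented_cong.induct)
  case (talented_expand v n i)
  then show ?case using talented_cong.talented_expand[of v \<Lambda> "n + q" i]
    by (simp add: multiset.map_comp comp_def plus_fun_def ac_simps)
next
  case (talented_refl M)
  then show ?case by (intro talented_cong.talented_refl) (auto simp: talented_free_def)
qed (auto intro: talented_sym talented_trans talented_add)

lemma (in k_graph) shift_class:
  "shift q (talented_cong \<Lambda> `` {M}) = talented_cong \<Lambda> `` {image_mset (\<lambda>(v, n). (v, n + q)) M}"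
proof (intro equalityI subsetI)
  fix P assume "P \<in> shift q (talented_cong \<Lambda> `` {M})"
  then show "P \<in> talented_cong \<Lambda> `` {image_mset (\<lambda>(v, n). (v, n + q)) M}"
    using talented_cong_shift by (auto simp: shift_def)
next
  fix P assume "P \<in> talented_cong \<Lambda> `` {image_mset (\<lambda>(v, n). (v, n + q)) M}"
  then have "(image_mset (\<lambda>(v, n). (v, n + q)) M, P) \<in> talented_cong \<Lambda>" by simp
  from talented_cong_shift[OF this, of "- q"]
  have "(M, image_mset (\<lambda>(v, n). (v, n - q)) P) \<in> talented_cong \<Lambda>"
    by (simp add: multiset.map_comp comp_def case_prod_beta)
  moreover have "P = image_mset (\<lambda>(v, n). (v, n + q)) (image_mset (\<lambda>(v, n). (v, n - q)) P)"
    by (simp add: multiset.map_comp comp_def case_prod_beta)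
  ultimately show "P \<in> shift q (talented_cong \<Lambda> `` {M})" unfolding shift_def by blast
qed


section \<open>The free *-algebra\<close>

lemma cring_complex_ring: "cring complex_ring"
proof (rule cringI)
  show "abelian_group complex_ring"
    by (rule abelian_groupI) (auto simp: complex_ring_def intro: exI[of _ "- _"] left_minus)
  show "comm_monoid complex_ring"
    by (rule comm_monoidI) (auto simp: complex_ring_def)
qed (auto simp: complex_ring_def algebra_simps)

lemma complex_ring_simps [simp]:
  "carrier complex_ring = UNIV" "a \<oplus>\<^bsub>complex_ring\<^esub> b = a + b" "a \<otimes>\<^bsub>complex_ring\<^esub> b = a * b"
  "\<one>\<^bsub>complex_ring\<^esub> = 1" "\<zero>\<^bsub>complex_ring\<^esub> = 0"
  by (simp_all add: complex_ring_def)

lemma free_simps: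
  "\<zero>\<^bsub>free_star_alg G\<^esub> = (\<lambda>w. 0)" 
  "f \<oplus>\<^bsub>free_star_alg G\<^esub> g = (\<lambda>w. f w + g w)"
  "f \<otimes>\<^bsub>free_star_alg G\<^esub> g = (\<lambda>w. \<Sum>i\<le>length w. f (take i w) * g (drop i w))"
  "c \<odot>\<^bsub>free_star_alg G\<^esub> f = (\<lambda>w. c * f w)"
  "star (free_star_alg G) f = (\<lambda>w. cnj (f (rev (map (\<lambda>(g, b). (g, \<not> b)) w))))"
  by (simp_all add: free_star_alg_def)

lemma free_carrier:
  "f \<in> carrier (free_star_alg G) \<longleftrightarrow> finite {w. f w \<noteq> 0} \<and> (\<forall>w. f w \<noteq> 0 \<longrightarrow> w \<noteq> [] \<and> fst ` set w \<subseteq> G)"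
  by (simp add: free_star_alg_def)

lemma conv_assoc_aux:
  fixes F :: "nat \<Rightarrow> nat \<Rightarrow> nat \<Rightarrow> 'a::comm_monoid_add"
  shows "(\<Sum>j\<le>k. \<Sum>i\<le>j. F i (j - i) (n - j)) = (\<Sum>j\<le>k. \<Sum>i\<le>k - j. F j i (n - j - i))"
  by (induction k) (simp_all add: Suc_diff_le sum.distrib add.assoc)

lemma free_mult_closed:
  assumes f: "f \<in> carrier (free_star_alg G)" and g: "g \<in> carrier (free_star_alg G)"
  shows "f \<otimes>\<^bsub>free_star_alg G\<^esub> g \<in> carrier (free_star_alg G)"
proof -
  let ?h = "f \<otimes>\<^bsub>free_star_alg G\<^esub> g"
  have split: "\<exists>u v. w = u @ v \<and> f u \<noteq> 0 \<and> g v \<noteq> 0" if "?h w \<noteq> 0" for w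
  proof -
    from that have "\<exists>i\<le>length w. f (take i w) * g (drop i w) \<noteq> 0"
      by (auto simp: free_simps intro!: sum.neutral intro: ccontr)
    then obtain i where "f (take i w) \<noteq> 0" "g (drop i w) \<noteq> 0" by auto
    then show ?thesis by (metis append_take_drop_id)
  qed
  have "{w. ?h w \<noteq> 0} \<subseteq> (\<lambda>(u,v). u @ v) ` ({w. f w \<noteq> 0} \<times> {w. g w \<noteq> 0})"
    using split by force
  moreover have "finite ((\<lambda>(u,v). u @ v) ` ({w. f w \<noteq> 0} \<times> {w. g w \<noteq> 0}))"
    using f g by (auto simp: free_carrier)
  ultimately have "finite {w. ?h w \<noteq> 0}" by (rule finite_subset)
  moreover have "w \<noteq> [] \<and> fst ` set w \<subseteq> G" if "?h w \<noteq> 0" for w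
    using split[OF that] f g by (fastforce simp: free_carrier)
  ultimately show ?thesis by (auto simp: free_carrier)
qed

abbreviation "wstar \<equiv> \<lambda>w. rev (map (\<lambda>(g, b). (g, \<not> b)) w)"

lemma wstar_wstar [simp]: "wstar (wstar w) = w"
  by (simp add: rev_map comp_def case_prod_beta)

lemma wstar_take: "i \<le> length w \<Longrightarrow> wstar (take i w) = drop (length w - i) (wstar w)"
  by (simp add: rev_take take_map drop_map rev_map)

lemma wstar_drop: "i \<le> length w \<Longrightarrow> wstar (drop i w) = take (length w - i) (wstar w)"
  by (simp add: rev_drop take_map drop_map rev_map)

lemma free_star_closed:
  assumes f: "f \<in> carrier (free_star_alg G)"
  shows "star (free_star_alg G) f \<in> carrier (free_star_alg G)"
proof -
  have "{w. star (free_star_alg G) f w \<noteq> 0} \<subseteq> wstar ` {w. f w \<noteq> 0}"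
    by (auto simp: free_simps image_iff) (metis wstar_wstar)
  then have "finite {w. star (free_star_alg G) f w \<noteq> 0}"
    using f finite_subset by (fastforce simp: free_carrier)
  moreover have "w \<noteq> [] \<and> fst ` set w \<subseteq> G" if "star (free_star_alg G) f w \<noteq> 0" for w
  proof -
    have "wstar w \<noteq> [] \<and> fst ` set (wstar w) \<subseteq> G"
      using f that by (simp only: free_carrier free_simps) (metis complex_cnj_zero)
    then show ?thesis by (auto simp: image_image case_prod_beta)
  qed
  ultimately show ?thesis by (auto simp: free_carrier)
qed

lemma free_add_closed:
  assumes f: "f \<in> carrier (free_star_alg G)" and g: "g \<in> carrier (free_star_alg G)"
  shows "f \<oplus>\<^bsub>free_star_alg G\<^esub> g \<in> carrier (free_star_alg G)"
proof -
  have "{w. f w + g w \<noteq> 0} \<subseteq> {w. f w \<noteq> 0} \<union> {w. g w \<noteq> 0}" by auto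
  then have "finite {w. f w + g w \<noteq> 0}" using f g by (auto simp: free_carrier intro: finite_subset)
  moreover have "f w \<noteq> 0 \<or> g w \<noteq> 0" if "f w + g w \<noteq> 0" for w using that by auto
  ultimately show ?thesis using f g unfolding free_carrier free_simps by blast
qed

lemma free_smult_closed:
  assumes f: "f \<in> carrier (free_star_alg G)"
  shows "c \<odot>\<^bsub>free_star_alg G\<^esub> f \<in> carrier (free_star_alg G)"
proof -
  have "{w. c * f w \<noteq> 0} \<subseteq> {w. f w \<noteq> 0}" by auto
  then have "finite {w. c * f w \<noteq> 0}" using f by (auto simp: free_carrier intro: finite_subset)
  then show ?thesis using f by (auto simp: free_carrier free_simps)
qed

lemma free_mult_assoc:
  "(f \<otimes>\<^bsub>free_star_alg G\<^esub> g) \<otimes>\<^bsub>free_star_alg G\<^esub> h = f \<otimes>\<^bsub>free_star_alg G\<^esub> (g \<otimes>\<^bsub>free_star_alg G\<^esub> h)"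
proof
  fix w :: "('a \<times> bool) list"
  define F where "F i j l = f (take i w) * g (take j (drop i w)) * h (drop (i + j) w)" for i j l :: nat
  have "((f \<otimes>\<^bsub>free_star_alg G\<^esub> g) \<otimes>\<^bsub>free_star_alg G\<^esub> h) w
    = (\<Sum>j\<le>length w. \<Sum>i\<le>j. F i (j - i) (length w - j))"
    by (auto simp: free_simps F_def sum_distrib_right min_def drop_take intro!: sum.cong)
  also have "\<dots> = (\<Sum>j\<le>length w. \<Sum>i\<le>length w - j. F j i (length w - j - i))"
    by (rule conv_assoc_aux)
  also have "\<dots> = (f \<otimes>\<^bsub>free_star_alg G\<^esub> (g \<otimes>\<^bsub>free_star_alg G\<^esub> h)) w"
    by (auto simp: free_simps F_def sum_distrib_left add.commute mult.assoc intro!: sum.cong)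
  finally show "((f \<otimes>\<^bsub>free_star_alg G\<^esub> g) \<otimes>\<^bsub>free_star_alg G\<^esub> h) w = (f \<otimes>\<^bsub>free_star_alg G\<^esub> (g \<otimes>\<^bsub>free_star_alg G\<^esub> h)) w" .
qed

lemma free_star_mult:
  "star (free_star_alg G) (f \<otimes>\<^bsub>free_star_alg G\<^esub> g) = star (free_star_alg G) g \<otimes>\<^bsub>free_star_alg G\<^esub> star (free_star_alg G) f"
proof
  fix w :: "('a \<times> bool) list"
  have "star (free_star_alg G) (f \<otimes>\<^bsub>free_star_alg G\<^esub> g) w
     = (\<Sum>i\<le>length w. cnj (g (drop i (wstar w))) * cnj (f (take i (wstar w))))"
    by (simp add: free_simps mult.commute)
  also have "\<dots> = (\<Sum>i\<le>length w. cnj (g (drop (length w - i) (wstar w))) * cnj (f (take (length w - i) (wstar w))))"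
    by (rule sum.reindex_bij_witness[of _ "\<lambda>i. length w - i" "\<lambda>i. length w - i"]) auto
  also have "\<dots> = (star (free_star_alg G) g \<otimes>\<^bsub>free_star_alg G\<^esub> star (free_star_alg G) f) w"
    unfolding free_simps
  proof (intro sum.cong refl)
    fix i assume "i \<in> {..length w}"
    then have i: "i \<le> length w" by simp
    show "cnj (g (drop (length w - i) (wstar w))) * cnj (f (take (length w - i) (wstar w)))
      = cnj (g (wstar (take i w))) * cnj (f (wstar (drop i w)))"
      unfolding wstar_take[OF i] wstar_drop[OF i] by (rule refl)
  qed
  finally show "star (free_star_alg G) (f \<otimes>\<^bsub>free_star_alg G\<^esub> g) w
     = (star (free_star_alg G) g \<otimes>\<^bsub>free_star_alg G\<^esub> star (free_star_alg G) f) w" .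
qed

lemma free_abelian_group: "abelian_group (free_star_alg G)"
proof (rule abelian_groupI)
  fix x assume x: "x \<in> carrier (free_star_alg G)"
  have "(\<lambda>w. - x w) \<in> carrier (free_star_alg G)"
    using free_smult_closed[OF x, of "-1"] by (simp add: free_simps)
  then show "\<exists>y\<in>carrier (free_star_alg G). y \<oplus>\<^bsub>free_star_alg G\<^esub> x = \<zero>\<^bsub>free_star_alg G\<^esub>"
    by (intro bexI[of _ "\<lambda>w. - x w"]) (auto simp: free_simps)
qed (auto simp: free_add_closed, auto simp: free_simps free_carrier algebra_simps)

lemma star_algebra_free: "star_algebra (free_star_alg G)"
proof (intro star_algebra.intro star_algebra_axioms.intro moduleI)
qed (auto simp: cring_complex_ring free_abelian_group free_smult_closed free_mult_closed free_mult_assoc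
      free_star_closed free_star_mult,
     auto simp: free_simps algebra_simps sum.distrib sum_distrib_left case_prod_beta comp_def rev_map)


section \<open>The completion is a C*-algebra\<close>

locale cstar_seminormed = star_algebra A for A :: "('c, 'b) star_alg_scheme" (structure) +
  fixes \<rho> :: "'c \<Rightarrow> real"
  assumes sn: "cstar_seminorm A \<rho>"
begin

lemma sm_closed [simp]: "x \<in> carrier A \<Longrightarrow> c \<odot> x \<in> carrier A"
  using smult_closed[of c x] by simp

lemmas star_closed [simp] mult_closed [simp]

lemma sn_nonneg: "x \<in> carrier A \<Longrightarrow> 0 \<le> \<rho> x"
  and sn_tri: "x \<in> carrier A \<Longrightarrow> y \<in> carrier A \<Longrightarrow> \<rho> (x \<oplus> y) \<le> \<rho> x + \<rho> y"
  and sn_scale: "x \<in> carrier A \<Longrightarrow> \<rho> (c \<odot> x) = cmod c * \<rho> x"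
  and sn_mult: "x \<in> carrier A \<Longrightarrow> y \<in> carrier A \<Longrightarrow> \<rho> (x \<otimes> y) \<le> \<rho> x * \<rho> y"
  and sn_cstar: "x \<in> carrier A \<Longrightarrow> \<rho> (star A x \<otimes> x) = (\<rho> x)\<^sup>2"
  using sn by (auto simp: cstar_seminorm_def)

lemma sn_star_le: "x \<in> carrier A \<Longrightarrow> \<rho> x \<le> \<rho> (star A x)"
  using sn_cstar[of x] sn_mult[of "star A x" x] sn_nonneg[of x] sn_nonneg[of "star A x"]
  by (cases "\<rho> x = 0") (auto simp: power2_eq_square)

lemma sn_star: "x \<in> carrier A \<Longrightarrow> \<rho> (star A x) = \<rho> x"
  using sn_star_le[of x] sn_star_le[of "star A x"] by (simp add: star_star)

lemma neg_eq: "x \<in> carrier A \<Longrightarrow> \<ominus> x = (-1) \<odot> x"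
proof -
  assume x: "x \<in> carrier A"
  have "(-1) \<odot> x \<oplus> x = (-1 + 1) \<odot> x"
    using smult_l_distr[of "-1" 1 x] smult_one[OF x] x by simp
  also have "\<dots> = \<zero>" using smult_l_null[OF x] by simp
  finally show ?thesis using x M.minus_equality by simp
qed

lemma minus_eq2: "x \<in> carrier A \<Longrightarrow> y \<in> carrier A \<Longrightarrow> x \<ominus> y = x \<oplus> (-1) \<odot> y"
  by (simp add: a_minus_def neg_eq)

lemma sn_zero: "\<rho> \<zero> = 0"
  using sn_scale[of \<zero> 0] smult_r_null[of 0] by simp

lemma sn_minus_self: "x \<in> carrier A \<Longrightarrow> \<rho> (x \<ominus> x) = 0"
  by (simp add: M.r_neg a_minus_def sn_zero)

lemma sn_neg: "x \<in> carrier A \<Longrightarrow> \<rho> (\<ominus> x) = \<rho> x"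
  by (simp add: neg_eq sn_scale)

lemma sn_minus_comm: "x \<in> carrier A \<Longrightarrow> y \<in> carrier A \<Longrightarrow> \<rho> (x \<ominus> y) = \<rho> (y \<ominus> x)"
  using sn_neg[of "x \<ominus> y"] by (simp add: a_minus_def M.minus_add M.minus_minus M.add.m_comm)

lemma minus_telescope: "\<lbrakk>x \<in> carrier A; y \<in> carrier A; z \<in> carrier A\<rbrakk> \<Longrightarrow> (x \<ominus> y) \<oplus> (y \<ominus> z) = x \<ominus> z"
  by (simp add: a_minus_def M.a_assoc M.r_neg1 M.r_neg2)

lemma sn_dist_tri: "\<lbrakk>x \<in> carrier A; y \<in> carrier A; z \<in> carrier A\<rbrakk> \<Longrightarrow> \<rho> (x \<ominus> z) \<le> \<rho> (x \<ominus> y) + \<rho> (y \<ominus> z)"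
  using sn_tri[of "x \<ominus> y" "y \<ominus> z"] by (simp add: minus_telescope)

lemma sn_abs_diff: "\<lbrakk>x \<in> carrier A; y \<in> carrier A\<rbrakk> \<Longrightarrow> \<bar>\<rho> x - \<rho> y\<bar> \<le> \<rho> (x \<ominus> y)"
proof -
  have *: "\<rho> x \<le> \<rho> (x \<ominus> y) + \<rho> y" if "x \<in> carrier A" "y \<in> carrier A" for x y
    using sn_tri[of "x \<ominus> y" y] that by (simp add: a_minus_def M.a_assoc M.l_neg)
  assume "x \<in> carrier A" "y \<in> carrier A"
  then show ?thesis using *[of x y] *[of y x] sn_minus_comm[of x y] by auto
qed

lemma add_minus_add: "\<lbrakk>x \<in> carrier A; y \<in> carrier A; x' \<in> carrier A; y' \<in> carrier A\<rbrakk> \<Longrightarrow>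
    (x \<oplus> y) \<ominus> (x' \<oplus> y') = (x \<ominus> x') \<oplus> (y \<ominus> y')"
  by (simp add: a_minus_def M.minus_add M.a_ac)

lemma smult_minus: "\<lbrakk>x \<in> carrier A; y \<in> carrier A\<rbrakk> \<Longrightarrow> c \<odot> x \<ominus> c \<odot> y = c \<odot> (x \<ominus> y)"
  using smult_r_distr[of c x "(-1) \<odot> y"] smult_assoc1[of c "-1" y] smult_assoc1[of "-1" c y]
  by (simp add: minus_eq2)

lemma star_minus: "\<lbrakk>x \<in> carrier A; y \<in> carrier A\<rbrakk> \<Longrightarrow> star A x \<ominus> star A y = star A (x \<ominus> y)"
  by (simp add: minus_eq2 star_add star_smult)

lemma mult_minus: "\<lbrakk>x \<in> carrier A; y \<in> carrier A; x' \<in> carrier A; y' \<in> carrier A\<rbrakk> \<Longrightarrow>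
    x \<otimes> y \<ominus> x' \<otimes> y' = (x \<ominus> x') \<otimes> y \<oplus> x' \<otimes> (y \<ominus> y')"
proof -
  assume a: "x \<in> carrier A" "y \<in> carrier A" "x' \<in> carrier A" "y' \<in> carrier A"
  have "(x \<ominus> x') \<otimes> y = x \<otimes> y \<ominus> x' \<otimes> y" "x' \<otimes> (y \<ominus> y') = x' \<otimes> y \<ominus> x' \<otimes> y'"
    using a by (simp_all add: minus_eq2 mult_l_distr mult_r_distr mult_smult_left mult_smult_right)
  then show ?thesis using a by (simp add: minus_telescope)
qed

lemma sn_mult_minus: "\<lbrakk>x \<in> carrier A; y \<in> carrier A; x' \<in> carrier A; y' \<in> carrier A\<rbrakk> \<Longrightarrow>
    \<rho> (x \<otimes> y \<ominus> x' \<otimes> y') \<le> \<rho> (x \<ominus> x') * \<rho> y + \<rho> x' * \<rho> (y \<ominus> y')"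
  using sn_tri[of "(x \<ominus> x') \<otimes> y" "x' \<otimes> (y \<ominus> y')"] sn_mult[of "x \<ominus> x'" y] sn_mult[of x' "y \<ominus> y'"]
  by (simp add: mult_minus)

definition "CS = Collect (seminorm_Cauchy A \<rho>)"
definition "cls X = null_rel A \<rho> `` {X}"

lemma CS_carrier: "X \<in> CS \<Longrightarrow> X n \<in> carrier A"
  by (simp add: CS_def seminorm_Cauchy_def)

lemma CS_D: "X \<in> CS \<Longrightarrow> e > 0 \<Longrightarrow> \<exists>N. \<forall>m\<ge>N. \<forall>n\<ge>N. \<rho> (X m \<ominus> X n) < e"
  by (simp add: CS_def seminorm_Cauchy_def)

lemma CS_I: "(\<And>n. X n \<in> carrier A) \<Longrightarrow> (\<And>e. e > 0 \<Longrightarrow> \<exists>N. \<forall>m\<ge>N. \<forall>n\<ge>N. \<rho> (X m \<ominus> X n) < e) \<Longrightarrow> X \<in> CS"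
  by (simp add: CS_def seminorm_Cauchy_def)

lemma CS_norm_Cauchy: "X \<in> CS \<Longrightarrow> convergent (\<lambda>n. \<rho> (X n))"
proof (rule Cauchy_convergent)
  assume X: "X \<in> CS"
  show "Cauchy (\<lambda>n. \<rho> (X n))"
  proof (rule CauchyI)
    fix e :: real assume "e > 0"
    from CS_D[OF X this] obtain N where N: "\<forall>m\<ge>N. \<forall>n\<ge>N. \<rho> (X m \<ominus> X n) < e" by auto
    have "norm (\<rho> (X m) - \<rho> (X n)) < e" if "m \<ge> N" "n \<ge> N" for m n
      using sn_abs_diff[OF CS_carrier[OF X] CS_carrier[OF X], of m n] N that by (force intro: le_less_trans)
    then show "\<exists>M. \<forall>m\<ge>M. \<forall>n\<ge>M. norm (\<rho> (X m) - \<rho> (X n)) < e" by blast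
  qed
qed

lemma CS_bounded: "X \<in> CS \<Longrightarrow> \<exists>K>0. \<forall>n. \<rho> (X n) \<le> K"
proof -
  assume X: "X \<in> CS"
  from convergent_imp_Bseq[OF CS_norm_Cauchy[OF X]] obtain K where "K > 0" "\<And>n. norm (\<rho> (X n)) \<le> K"
    by (auto elim: BseqE)
  then show ?thesis by (intro exI[of _ K]) (auto simp: abs_le_iff)
qed

lemma CS_const: "x \<in> carrier A \<Longrightarrow> (\<lambda>n. x) \<in> CS"
  by (rule CS_I) (auto simp: sn_minus_self)

lemma CS_add: "X \<in> CS \<Longrightarrow> Y \<in> CS \<Longrightarrow> (\<lambda>n. X n \<oplus> Y n) \<in> CS"
proof (rule CS_I)
  fix e :: real assume X: "X \<in> CS" and Y: "Y \<in> CS" and e: "e > 0"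
  note c = CS_carrier[OF X] CS_carrier[OF Y]
  from CS_D[OF X, of "e/2"] CS_D[OF Y, of "e/2"] e obtain N M where
    "\<forall>m\<ge>N. \<forall>n\<ge>N. \<rho> (X m \<ominus> X n) < e/2" "\<forall>m\<ge>M. \<forall>n\<ge>M. \<rho> (Y m \<ominus> Y n) < e/2" by auto
  moreover have "\<rho> ((X m \<oplus> Y m) \<ominus> (X n \<oplus> Y n)) \<le> \<rho> (X m \<ominus> X n) + \<rho> (Y m \<ominus> Y n)" for m n
    using sn_tri[of "X m \<ominus> X n" "Y m \<ominus> Y n"] c by (simp add: add_minus_add)
  ultimately have "\<rho> ((X m \<oplus> Y m) \<ominus> (X n \<oplus> Y n)) < e" if "m \<ge> max N M" "n \<ge> max N M" for m n
    using that by (smt (verit) field_sum_of_halves max.bounded_iff)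
  then show "\<exists>N. \<forall>m\<ge>N. \<forall>n\<ge>N. \<rho> ((X m \<oplus> Y m) \<ominus> (X n \<oplus> Y n)) < e" by blast
qed (auto simp: CS_carrier)

lemma CS_smult: "X \<in> CS \<Longrightarrow> (\<lambda>n. c \<odot> X n) \<in> CS"
proof (rule CS_I)
  fix e :: real assume X: "X \<in> CS" and e: "e > 0"
  have "e / (cmod c + 1) > 0" using e by (intro divide_pos_pos) (auto simp: add_nonneg_pos)
  from CS_D[OF X this] obtain N where N: "\<forall>m\<ge>N. \<forall>n\<ge>N. \<rho> (X m \<ominus> X n) < e / (cmod c + 1)" by auto
  have "\<rho> (c \<odot> X m \<ominus> c \<odot> X n) < e" if "m \<ge> N" "n \<ge> N" for m n
  proof -
    have "\<rho> (c \<odot> X m \<ominus> c \<odot> X n) = cmod c * \<rho> (X m \<ominus> X n)"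
      using CS_carrier[OF X] by (simp add: smult_minus sn_scale)
    also have "\<dots> \<le> (cmod c + 1) * \<rho> (X m \<ominus> X n)"
      using sn_nonneg[of "X m \<ominus> X n"] CS_carrier[OF X] by (intro mult_right_mono) auto
    also have "\<dots> < e" using N that by (auto simp: pos_less_divide_eq add_nonneg_pos mult.commute)
    finally show ?thesis .
  qed
  then show "\<exists>N. \<forall>m\<ge>N. \<forall>n\<ge>N. \<rho> (c \<odot> X m \<ominus> c \<odot> X n) < e" by blast
qed (auto simp: CS_carrier)

lemma CS_star: "X \<in> CS \<Longrightarrow> (\<lambda>n. star A (X n)) \<in> CS"
  using CS_carrier[of X] CS_D[of X] by (intro CS_I) (auto simp: star_minus sn_star)

lemma CS_mult: "X \<in> CS \<Longrightarrow> Y \<in> CS \<Longrightarrow> (\<lambda>n. X n \<otimes> Y n) \<in> CS"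
proof (rule CS_I)
  fix e :: real assume X: "X \<in> CS" and Y: "Y \<in> CS" and e: "e > 0"
  note c = CS_carrier[OF X] CS_carrier[OF Y]
  obtain K L where K: "K > 0" "\<And>n. \<rho> (X n) \<le> K" and L: "L > 0" "\<And>n. \<rho> (Y n) \<le> L"
    using CS_bounded[OF X] CS_bounded[OF Y] by auto
  have "e / (2 * L) > 0" "e / (2 * K) > 0" using e K L by auto
  from CS_D[OF X this(1)] CS_D[OF Y this(2)] obtain N M where
    NM: "\<forall>m\<ge>N. \<forall>n\<ge>N. \<rho> (X m \<ominus> X n) < e / (2 * L)" "\<forall>m\<ge>M. \<forall>n\<ge>M. \<rho> (Y m \<ominus> Y n) < e / (2 * K)" by auto
  have "\<rho> (X m \<otimes> Y m \<ominus> X n \<otimes> Y n) < e" if "m \<ge> max N M" "n \<ge> max N M" for m n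
  proof -
    have "\<rho> (X m \<otimes> Y m \<ominus> X n \<otimes> Y n) \<le> \<rho> (X m \<ominus> X n) * \<rho> (Y m) + \<rho> (X n) * \<rho> (Y m \<ominus> Y n)"
      using sn_mult_minus c by simp
    also have "\<dots> \<le> \<rho> (X m \<ominus> X n) * L + K * \<rho> (Y m \<ominus> Y n)"
      using K L sn_nonneg c by (intro add_mono mult_left_mono mult_right_mono) auto
    also have "\<dots> < e / (2 * L) * L + K * (e / (2 * K))"
      using NM that K L by (intro add_strict_mono mult_strict_left_mono mult_strict_right_mono) auto
    also have "\<dots> = e" using K L by simp
    finally show ?thesis .
  qed
  then show "\<exists>N. \<forall>m\<ge>N. \<forall>n\<ge>N. \<rho> (X m \<otimes> Y m \<ominus> X n \<otimes> Y n) < e" by blast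
qed (auto simp: CS_carrier)

lemma null_rel_iff: "(X, Y) \<in> null_rel A \<rho> \<longleftrightarrow> X \<in> CS \<and> Y \<in> CS \<and> (\<lambda>n. \<rho> (X n \<ominus> Y n)) \<longlonglongrightarrow> 0"
  by (simp add: null_rel_def CS_def)

lemma tendsto0_le:
  fixes f g :: "nat \<Rightarrow> real"
  assumes "g \<longlonglongrightarrow> 0" "\<And>n. 0 \<le> f n" "\<And>n. f n \<le> g n" shows "f \<longlonglongrightarrow> 0"
  using tendsto_sandwich[of "\<lambda>_. 0" f sequentially g 0] assms by simp

lemma equiv_null: "equiv CS (null_rel A \<rho>)"
proof (rule equivI)
  show "null_rel A \<rho> \<subseteq> CS \<times> CS" by (auto simp: null_rel_iff)
  show "refl_on CS (null_rel A \<rho>)"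
    by (auto simp: refl_on_def null_rel_iff sn_minus_self CS_carrier)
  show "sym (null_rel A \<rho>)"
  proof (rule symI)
    fix X Y assume a: "(X, Y) \<in> null_rel A \<rho>"
    then have "\<rho> (Y n \<ominus> X n) = \<rho> (X n \<ominus> Y n)" for n
      by (auto simp: null_rel_iff intro: sn_minus_comm CS_carrier)
    then show "(Y, X) \<in> null_rel A \<rho>" using a by (simp add: null_rel_iff)
  qed
  show "trans (null_rel A \<rho>)"
  proof (rule transI)
    fix X Y Z assume a: "(X, Y) \<in> null_rel A \<rho>" "(Y, Z) \<in> null_rel A \<rho>"
    then have c: "\<And>n. X n \<in> carrier A" "\<And>n. Y n \<in> carrier A" "\<And>n. Z n \<in> carrier A"
      by (auto simp: null_rel_iff CS_carrier)
    have "(\<lambda>n. \<rho> (X n \<ominus> Z n)) \<longlonglongrightarrow> 0"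
      by (rule tendsto0_le[where g = "\<lambda>n. \<rho> (X n \<ominus> Y n) + \<rho> (Y n \<ominus> Z n)"])
         (use a c sn_dist_tri sn_nonneg in \<open>auto simp: null_rel_iff intro: tendsto_add_zero\<close>)
    then show "(X, Z) \<in> null_rel A \<rho>" using a by (simp add: null_rel_iff)
  qed
qed

abbreviation "C \<equiv> completion A \<rho>"

lemma C_carrier: "carrier C = CS // null_rel A \<rho>" by (simp add: completion_def CS_def)

lemma cls_in [simp]: "X \<in> CS \<Longrightarrow> cls X \<in> carrier C"
  by (simp add: C_carrier cls_def quotientI)

lemma C_cases: "P \<in> carrier C \<Longrightarrow> \<exists>X \<in> CS. P = cls X"
  by (auto simp: C_carrier cls_def elim: quotientE)

lemma cls_eq: "X \<in> CS \<Longrightarrow> Y \<in> CS \<Longrightarrow> cls X = cls Y \<longleftrightarrow> (\<lambda>n. \<rho> (X n \<ominus> Y n)) \<longlonglongrightarrow> 0"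
  using eq_equiv_class_iff[OF equiv_null, of X Y] by (simp add: null_rel_iff cls_def)

lemma C_add: assumes "X \<in> CS" "Y \<in> CS" shows "cls X \<oplus>\<^bsub>C\<^esub> cls Y = cls (\<lambda>n. X n \<oplus> Y n)"
proof -
  have "congruent2 (null_rel A \<rho>) (null_rel A \<rho>) (\<lambda>X Y. cls (\<lambda>n. X n \<oplus> Y n))"
  proof (rule congruent2I'[OF _])
    fix X X' Y Y' assume "(X, X') \<in> null_rel A \<rho>" "(Y, Y') \<in> null_rel A \<rho>"
    then have a: "X \<in> CS" "X' \<in> CS" "Y \<in> CS" "Y' \<in> CS"
      and l: "(\<lambda>n. \<rho> (X n \<ominus> X' n)) \<longlonglongrightarrow> 0" "(\<lambda>n. \<rho> (Y n \<ominus> Y' n)) \<longlonglongrightarrow> 0" by (auto simp: null_rel_iff)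
    have "(\<lambda>n. \<rho> ((X n \<oplus> Y n) \<ominus> (X' n \<oplus> Y' n))) \<longlonglongrightarrow> 0"
      by (rule tendsto0_le[OF tendsto_add_zero[OF l]])
         (use a[THEN CS_carrier] in \<open>auto simp: add_minus_add intro!: sn_tri sn_nonneg\<close>)
    then show "cls (\<lambda>n. X n \<oplus> Y n) = cls (\<lambda>n. X' n \<oplus> Y' n)" by (simp only: cls_eq CS_add a)
  qed
  from UN_equiv_class2[OF equiv_null equiv_null this assms] show ?thesis
    by (simp add: completion_def cls_def)
qed

lemma C_mult: assumes "X \<in> CS" "Y \<in> CS" shows "cls X \<otimes>\<^bsub>C\<^esub> cls Y = cls (\<lambda>n. X n \<otimes> Y n)"
proof -
  have "congruent2 (null_rel A \<rho>) (null_rel A \<rho>) (\<lambda>X Y. cls (\<lambda>n. X n \<otimes> Y n))"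
  proof (rule congruent2I'[OF _])
    fix X X' Y Y' assume "(X, X') \<in> null_rel A \<rho>" "(Y, Y') \<in> null_rel A \<rho>"
    then have a: "X \<in> CS" "X' \<in> CS" "Y \<in> CS" "Y' \<in> CS"
      and l: "(\<lambda>n. \<rho> (X n \<ominus> X' n)) \<longlonglongrightarrow> 0" "(\<lambda>n. \<rho> (Y n \<ominus> Y' n)) \<longlonglongrightarrow> 0" by (auto simp: null_rel_iff)
    note c = a[THEN CS_carrier]
    obtain K where K: "\<And>n. \<rho> (Y n) \<le> K" using CS_bounded[OF a(3)] by auto
    obtain L where L: "\<And>n. \<rho> (X' n) \<le> L" using CS_bounded[OF a(2)] by auto
    have g: "(\<lambda>n. \<rho> (X n \<ominus> X' n) * K + L * \<rho> (Y n \<ominus> Y' n)) \<longlonglongrightarrow> 0"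
      using tendsto_add_zero[OF tendsto_mult_left_zero[OF l(1)] tendsto_mult_right_zero[OF l(2)]] .
    have "(\<lambda>n. \<rho> ((X n \<otimes> Y n) \<ominus> (X' n \<otimes> Y' n))) \<longlonglongrightarrow> 0"
    proof (rule tendsto0_le[OF g])
      fix n
      have "\<rho> ((X n \<otimes> Y n) \<ominus> (X' n \<otimes> Y' n)) \<le> \<rho> (X n \<ominus> X' n) * \<rho> (Y n) + \<rho> (X' n) * \<rho> (Y n \<ominus> Y' n)"
        using sn_mult_minus c by simp
      also have "\<dots> \<le> \<rho> (X n \<ominus> X' n) * K + L * \<rho> (Y n \<ominus> Y' n)"
        using K L sn_nonneg c by (intro add_mono mult_left_mono mult_right_mono) auto
      finally show "\<rho> ((X n \<otimes> Y n) \<ominus> (X' n \<otimes> Y' n)) \<le> \<rho> (X n \<ominus> X' n) * K + L * \<rho> (Y n \<ominus> Y' n)" .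
    qed (use c sn_nonneg in simp)
    then show "cls (\<lambda>n. X n \<otimes> Y n) = cls (\<lambda>n. X' n \<otimes> Y' n)" by (simp only: cls_eq CS_mult a)
  qed
  from UN_equiv_class2[OF equiv_null equiv_null this assms] show ?thesis
    by (simp add: completion_def cls_def)
qed

lemma C_smult: assumes "X \<in> CS" shows "c \<odot>\<^bsub>C\<^esub> cls X = cls (\<lambda>n. c \<odot> X n)"
proof -
  have "congruent (null_rel A \<rho>) (\<lambda>X. cls (\<lambda>n. c \<odot> X n))"
  proof (rule congruentI)
    fix X Y assume "(X, Y) \<in> null_rel A \<rho>"
    then have a: "X \<in> CS" "Y \<in> CS" and l: "(\<lambda>n. \<rho> (X n \<ominus> Y n)) \<longlonglongrightarrow> 0" by (auto simp: null_rel_iff)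
    have "(\<lambda>n. \<rho> (c \<odot> X n \<ominus> c \<odot> Y n)) \<longlonglongrightarrow> 0"
      using tendsto_mult_right_zero[OF l, of "cmod c"] a[THEN CS_carrier] by (simp add: smult_minus sn_scale)
    then show "cls (\<lambda>n. c \<odot> X n) = cls (\<lambda>n. c \<odot> Y n)" by (simp only: cls_eq CS_smult a)
  qed
  from UN_equiv_class[OF equiv_null this assms] show ?thesis by (simp add: completion_def cls_def)
qed

lemma C_star: assumes "X \<in> CS" shows "star C (cls X) = cls (\<lambda>n. star A (X n))"
proof -
  have "congruent (null_rel A \<rho>) (\<lambda>X. cls (\<lambda>n. star A (X n)))"
  proof (rule congruentI)
    fix X Y assume "(X, Y) \<in> null_rel A \<rho>"
    then have a: "X \<in> CS" "Y \<in> CS" and l: "(\<lambda>n. \<rho> (X n \<ominus> Y n)) \<longlonglongrightarrow> 0" by (auto simp: null_rel_iff)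
    have "(\<lambda>n. \<rho> (star A (X n) \<ominus> star A (Y n))) \<longlonglongrightarrow> 0"
      using l a[THEN CS_carrier] by (simp add: star_minus sn_star)
    then show "cls (\<lambda>n. star A (X n)) = cls (\<lambda>n. star A (Y n))" by (simp only: cls_eq CS_star a)
  qed
  from UN_equiv_class[OF equiv_null this assms] show ?thesis by (simp add: completion_def cls_def)
qed

lemma C_zero: "\<zero>\<^bsub>C\<^esub> = cls (\<lambda>n. \<zero>)" by (simp add: completion_def cls_def)

lemma C_nrm: assumes X: "X \<in> CS" shows "(\<lambda>n. \<rho> (X n)) \<longlonglongrightarrow> nrm C (cls X)"
proof -
  obtain l where l: "(\<lambda>n. \<rho> (X n)) \<longlonglongrightarrow> l" using CS_norm_Cauchy[OF X] by (auto simp: convergent_def)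
  have all: "(\<lambda>n. \<rho> (Y n)) \<longlonglongrightarrow> l" if "Y \<in> cls X" for Y
  proof -
    from that have Y: "Y \<in> CS" and d: "(\<lambda>n. \<rho> (X n \<ominus> Y n)) \<longlonglongrightarrow> 0" by (auto simp: null_rel_iff cls_def)
    have "(\<lambda>n. \<bar>\<rho> (X n) - \<rho> (Y n)\<bar>) \<longlonglongrightarrow> 0"
      by (rule tendsto0_le[OF d]) (use X Y in \<open>auto intro: sn_abs_diff CS_carrier\<close>)
    then have "(\<lambda>n. \<rho> (X n) - \<rho> (Y n)) \<longlonglongrightarrow> 0" by (simp add: tendsto_rabs_zero_iff)
    from tendsto_diff[OF l this] show ?thesis by simp
  qed
  have "nrm C (cls X) = (THE l. \<forall>Y\<in>cls X. (\<lambda>n. \<rho> (Y n)) \<longlonglongrightarrow> l)" by (simp add: completion_def cls_def)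
  also have "\<dots> = l"
  proof (rule the_equality)
    fix l' assume "\<forall>Y\<in>cls X. (\<lambda>n. \<rho> (Y n)) \<longlonglongrightarrow> l'"
    then have "(\<lambda>n. \<rho> (X n)) \<longlonglongrightarrow> l'" using equiv_class_self[OF equiv_null X] by (auto simp: cls_def)
    then show "l' = l" using l LIMSEQ_unique by blast
  qed (use all in blast)
  finally show ?thesis using l by simp
qed

lemma C_abelian: "abelian_group C"
proof (rule abelian_groupI)
  fix P assume "P \<in> carrier C"
  then obtain X where X: "X \<in> CS" "P = cls X" using C_cases by blast
  have "(-1) \<odot> X n \<oplus> X n = \<zero>" for n
    using M.l_neg[OF CS_carrier[OF X(1)]] unfolding neg_eq[OF CS_carrier[OF X(1)]] .
  then have "cls (\<lambda>n. (-1) \<odot> X n) \<oplus>\<^bsub>C\<^esub> P = \<zero>\<^bsub>C\<^esub>"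
    using X by (simp add: C_add CS_smult C_zero)
  then show "\<exists>Q\<in>carrier C. Q \<oplus>\<^bsub>C\<^esub> P = \<zero>\<^bsub>C\<^esub>" by (rule bexI) (simp add: CS_smult X)
next
  fix P Q assume "P \<in> carrier C" "Q \<in> carrier C"
  then obtain X Y where X: "X \<in> CS" "P = cls X" and Y: "Y \<in> CS" "Q = cls Y" using C_cases by blast
  note c = CS_carrier[OF X(1)] CS_carrier[OF Y(1)]
  show "P \<oplus>\<^bsub>C\<^esub> Q \<in> carrier C" "P \<oplus>\<^bsub>C\<^esub> Q = Q \<oplus>\<^bsub>C\<^esub> P" "\<zero>\<^bsub>C\<^esub> \<oplus>\<^bsub>C\<^esub> P = P"
    using X Y c by (simp_all add: C_add CS_add C_zero CS_const M.a_comm)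
  fix R assume "R \<in> carrier C"
  then obtain Z where Z: "Z \<in> CS" "R = cls Z" using C_cases by blast
  show "P \<oplus>\<^bsub>C\<^esub> Q \<oplus>\<^bsub>C\<^esub> R = P \<oplus>\<^bsub>C\<^esub> (Q \<oplus>\<^bsub>C\<^esub> R)"
    using X Y Z c CS_carrier[OF Z(1)] by (simp add: C_add CS_add M.a_assoc)
qed (simp add: C_zero CS_const)

lemma star_algebra_C: "star_algebra C"
proof (intro star_algebra.intro star_algebra_axioms.intro moduleI)
  fix a b x assume "x \<in> carrier C"
  then show "(a \<oplus>\<^bsub>complex_ring\<^esub> b) \<odot>\<^bsub>C\<^esub> x = a \<odot>\<^bsub>C\<^esub> x \<oplus>\<^bsub>C\<^esub> b \<odot>\<^bsub>C\<^esub> x"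
    using smult_l_distr[of a b] by (auto dest!: C_cases simp: C_add C_smult CS_smult CS_carrier)
next
  fix a x y assume "x \<in> carrier C" "y \<in> carrier C"
  then show "a \<odot>\<^bsub>C\<^esub> (x \<oplus>\<^bsub>C\<^esub> y) = a \<odot>\<^bsub>C\<^esub> x \<oplus>\<^bsub>C\<^esub> a \<odot>\<^bsub>C\<^esub> y"
    using smult_r_distr[of a] by (auto dest!: C_cases simp: C_add CS_add C_smult CS_smult CS_carrier)
next
  fix a b x assume "x \<in> carrier C"
  then show "(a \<otimes>\<^bsub>complex_ring\<^esub> b) \<odot>\<^bsub>C\<^esub> x = a \<odot>\<^bsub>C\<^esub> (b \<odot>\<^bsub>C\<^esub> x)"
    using smult_assoc1[of a b] by (auto dest!: C_cases simp: C_smult CS_smult CS_carrier)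
next
  fix x assume "x \<in> carrier C"
  then show "\<one>\<^bsub>complex_ring\<^esub> \<odot>\<^bsub>C\<^esub> x = x"
    using smult_one by (auto dest!: C_cases simp: C_smult CS_carrier)
qed (auto dest!: C_cases simp: cring_complex_ring C_abelian C_add CS_add C_smult CS_smult C_mult CS_mult C_star CS_star
      CS_carrier mult_assoc mult_l_distr mult_r_distr mult_smult_left mult_smult_right star_star star_add star_smult star_mult)

lemma cstar_seminorm_C: "cstar_seminorm C (nrm C)"
  unfolding cstar_seminorm_def
proof (intro conjI ballI allI)
  fix P assume "P \<in> carrier C"
  then obtain X where X: "X \<in> CS" "P = cls X" using C_cases by blast
  note c = CS_carrier[OF X(1)]
  show "0 \<le> nrm C P"
    using LIMSEQ_le_const[OF C_nrm[OF X(1)]] c sn_nonneg X(2) by auto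
  show "nrm C (a \<odot>\<^bsub>C\<^esub> P) = cmod a * nrm C P" for a
    using LIMSEQ_unique[OF C_nrm[OF CS_smult[OF X(1), of a]]] tendsto_mult_left[OF C_nrm[OF X(1)], of "cmod a"] c
    by (simp add: X C_smult sn_scale)
  show "nrm C (star C P \<otimes>\<^bsub>C\<^esub> P) = (nrm C P)\<^sup>2"
    using LIMSEQ_unique[OF C_nrm[OF CS_mult[OF CS_star[OF X(1)] X(1)]]] tendsto_power[OF C_nrm[OF X(1)], of 2] c X(1)
    by (simp add: X(2) C_star C_mult CS_star sn_cstar)
  fix Q assume "Q \<in> carrier C"
  then obtain Y where Y: "Y \<in> CS" "Q = cls Y" using C_cases by blast
  note d = CS_carrier[OF Y(1)]
  show "nrm C (P \<oplus>\<^bsub>C\<^esub> Q) \<le> nrm C P + nrm C Q"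
    using LIMSEQ_le[OF C_nrm[OF CS_add[OF X(1) Y(1)]] tendsto_add[OF C_nrm[OF X(1)] C_nrm[OF Y(1)]]] sn_tri c d X Y
    by (simp add: C_add)
  show "nrm C (P \<otimes>\<^bsub>C\<^esub> Q) \<le> nrm C P * nrm C Q"
    using LIMSEQ_le[OF C_nrm[OF CS_mult[OF X(1) Y(1)]] tendsto_mult[OF C_nrm[OF X(1)] C_nrm[OF Y(1)]]] sn_mult c d X Y
    by (simp add: C_mult)
qed

lemma C_minus: assumes X: "X \<in> CS" and Y: "Y \<in> CS" shows "cls X \<ominus>\<^bsub>C\<^esub> cls Y = cls (\<lambda>n. X n \<ominus> Y n)"
proof -
  interpret CC: cstar_seminormed C "nrm C"
    using star_algebra_C cstar_seminorm_C by (simp add: cstar_seminormed_def cstar_seminormed_axioms_def)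
  show ?thesis using X Y CC.minus_eq2[of "cls X" "cls Y"]
    by (simp add: minus_eq2 CS_carrier C_smult C_add CS_smult)
qed

lemma CS_minus: assumes X: "X \<in> CS" and Y: "Y \<in> CS" shows "(\<lambda>n. X n \<ominus> Y n) \<in> CS"
  using CS_add[OF X CS_smult[OF Y, of "-1"]] X Y by (simp add: minus_eq2 CS_carrier)

lemma minus_zero2: "x \<in> carrier A \<Longrightarrow> x \<ominus> \<zero> = x"
  using smult_r_null[of "-1"] by (simp add: minus_eq2)

lemma cls_zero_iff: "X \<in> CS \<Longrightarrow> cls X = \<zero>\<^bsub>C\<^esub> \<longleftrightarrow> (\<lambda>n. \<rho> (X n)) \<longlonglongrightarrow> 0"
  unfolding C_zero by (subst cls_eq) (auto simp: CS_const minus_zero2 CS_carrier)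

lemma C_definite: "P \<in> carrier C \<Longrightarrow> nrm C P = 0 \<Longrightarrow> P = \<zero>\<^bsub>C\<^esub>"
  using C_cases[of P] C_nrm cls_zero_iff by force

lemma C_complete:
  assumes P: "seminorm_Cauchy C (nrm C) P"
  shows "\<exists>x \<in> carrier C. (\<lambda>n. nrm C (P n \<ominus>\<^bsub>C\<^esub> x)) \<longlonglongrightarrow> 0"
proof -
  have Pc: "P n \<in> carrier C" for n using P by (simp add: seminorm_Cauchy_def)
  have "\<forall>n. \<exists>X. X \<in> CS \<and> P n = cls X" using C_cases[OF Pc] by blast
  then obtain X where X: "\<And>n. X n \<in> CS" "\<And>n. P n = cls (X n)" by metis
  have "\<forall>n. \<exists>K. \<forall>i\<ge>K. \<forall>j\<ge>K. \<rho> (X n i \<ominus> X n j) < inverse (real (Suc n))"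
    using CS_D[OF X(1)] by simp
  then obtain K where K: "\<And>n i j. i \<ge> K n \<Longrightarrow> j \<ge> K n \<Longrightarrow> \<rho> (X n i \<ominus> X n j) < inverse (real (Suc n))" by metis
  define Y where "Y n = X n (K n)" for n
  have c: "X n i \<in> carrier A" for n i using CS_carrier[OF X(1)] .
  have Yc: "Y n \<in> carrier A" for n by (simp add: Y_def c)
  have lim: "(\<lambda>i. \<rho> (X n i \<ominus> X m i)) \<longlonglongrightarrow> nrm C (P n \<ominus>\<^bsub>C\<^esub> P m)" for n m
    using C_nrm[OF CS_minus[OF X(1) X(1)], of n m] by (simp add: X(2) C_minus X(1))
  have YCS: "Y \<in> CS"
  proof (rule CS_I)
    fix e :: real assume e: "e > 0"
    obtain N where N: "\<And>m n. m \<ge> N \<Longrightarrow> n \<ge> N \<Longrightarrow> nrm C (P m \<ominus>\<^bsub>C\<^esub> P n) < e/3"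
      using P[unfolded seminorm_Cauchy_def, THEN conjunct2, rule_format, of "e/3"] e by fastforce
    obtain M where M: "inverse (real (Suc M)) < e/3" using e reals_Archimedean[of "e/3"] by auto
    have small: "inverse (real (Suc n)) < e/3" if "n \<ge> M" for n
    proof -
      have "inverse (real (Suc n)) \<le> inverse (real (Suc M))" using that by (intro le_imp_inverse_le) auto
      from le_less_trans[OF this M] show ?thesis .
    qed
    have "\<rho> (Y m \<ominus> Y n) < e" if mn: "m \<ge> max N M" "n \<ge> max N M" for m n
    proof -
      have "nrm C (P m \<ominus>\<^bsub>C\<^esub> P n) < e/3" using N mn by auto
      with lim[of m n] have "\<forall>\<^sub>F i in sequentially. \<rho> (X m i \<ominus> X n i) < e/3" by (rule order_tendstoD)
      then obtain I where I: "\<And>i. i \<ge> I \<Longrightarrow> \<rho> (X m i \<ominus> X n i) < e/3" by (auto simp: eventually_sequentially)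
      define i where "i = max I (max (K m) (K n))"
      have iK: "i \<ge> K m" "i \<ge> K n" by (simp_all add: i_def)
      have "\<rho> (Y m \<ominus> Y n) \<le> \<rho> (Y m \<ominus> X m i) + \<rho> (X m i \<ominus> Y n)" using sn_dist_tri c Yc by blast
      moreover have "\<rho> (X m i \<ominus> Y n) \<le> \<rho> (X m i \<ominus> X n i) + \<rho> (X n i \<ominus> Y n)" using sn_dist_tri c Yc by blast
      moreover have "\<rho> (Y m \<ominus> X m i) < e/3" using less_trans[OF K[of m "K m" i] small[of m]] mn iK by (simp add: Y_def)
      moreover have "\<rho> (X n i \<ominus> Y n) < e/3" using less_trans[OF K[of n i "K n"] small[of n]] mn iK by (simp add: Y_def)
      moreover have "\<rho> (X m i \<ominus> X n i) < e/3" using I by (simp add: i_def)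
      ultimately show ?thesis by linarith
    qed
    then show "\<exists>N. \<forall>m\<ge>N. \<forall>n\<ge>N. \<rho> (Y m \<ominus> Y n) < e" by blast
  qed (rule Yc)
  have "(\<lambda>n. nrm C (P n \<ominus>\<^bsub>C\<^esub> cls Y)) \<longlonglongrightarrow> 0"
  proof (rule LIMSEQ_I)
    fix e :: real assume e: "e > 0"
    obtain N where N: "\<And>m n. m \<ge> N \<Longrightarrow> n \<ge> N \<Longrightarrow> \<rho> (Y m \<ominus> Y n) < e/4"
      using CS_D[OF YCS, of "e/4"] e by auto
    obtain M where M: "inverse (real (Suc M)) < e/4" using e reals_Archimedean[of "e/4"] by auto
    have "norm (nrm C (P n \<ominus>\<^bsub>C\<^esub> cls Y) - 0) < e" if n: "n \<ge> max N M" for n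
    proof -
      have small: "inverse (real (Suc n)) < e/4"
      proof -
        have "inverse (real (Suc n)) \<le> inverse (real (Suc M))" using n by (intro le_imp_inverse_le) auto
        from le_less_trans[OF this M] show ?thesis .
      qed
      have l: "(\<lambda>i. \<rho> (X n i \<ominus> Y i)) \<longlonglongrightarrow> nrm C (P n \<ominus>\<^bsub>C\<^esub> cls Y)"
        using C_nrm[OF CS_minus[OF X(1) YCS], of n] by (simp add: X(2) C_minus X(1) YCS)
      have "\<rho> (X n i \<ominus> Y i) \<le> e/2" if "i \<ge> max (K n) N" for i
      proof -
        have "\<rho> (X n i \<ominus> Y i) \<le> \<rho> (X n i \<ominus> Y n) + \<rho> (Y n \<ominus> Y i)" using sn_dist_tri c Yc by blast
        moreover have "\<rho> (X n i \<ominus> Y n) < e/4" using less_trans[OF K[of n i "K n"] small] that by (simp add: Y_def)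
        moreover have "\<rho> (Y n \<ominus> Y i) < e/4" using N n that by simp
        ultimately show ?thesis by linarith
      qed
      then have "nrm C (P n \<ominus>\<^bsub>C\<^esub> cls Y) \<le> e/2" by (intro LIMSEQ_le_const2[OF l]) blast
      moreover have "0 \<le> nrm C (P n \<ominus>\<^bsub>C\<^esub> cls Y)"
        using LIMSEQ_le_const[OF l] sn_nonneg c Yc by auto
      ultimately show ?thesis using e by simp
    qed
    then show "\<exists>no. \<forall>n\<ge>no. norm (nrm C (P n \<ominus>\<^bsub>C\<^esub> cls Y) - 0) < e" by blast
  qed
  then show ?thesis using YCS by auto
qed

lemma cstar_algebra_C: "cstar_algebra C"
  using star_algebra_C cstar_seminorm_C C_definite C_complete
  by (auto simp: cstar_algebra_def cstar_algebra_axioms_def)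

end


section \<open>The universal property\<close>

definition wdelta :: "'w \<Rightarrow> 'w \<Rightarrow> complex" where
  "wdelta w = (\<lambda>u. if u = w then 1 else 0)"

lemma wdelta_gen: "wdelta [(g, False)] = free_gen g"
  by (simp add: wdelta_def free_gen_def)

lemma wstar_eq_iff: "wstar u = w \<longleftrightarrow> u = wstar w"
  by (metis wstar_wstar)

lemma wdelta_star: "star (free_star_alg G) (wdelta w) = wdelta (wstar w)"
  unfolding free_simps wdelta_def by (rule ext) (simp add: wstar_eq_iff del: rev_map)

lemma wdelta_mult: "wdelta u \<otimes>\<^bsub>free_star_alg G\<^esub> wdelta v = wdelta (u @ v)"
proof
  fix w
  have "(wdelta u \<otimes>\<^bsub>free_star_alg G\<^esub> wdelta v) w
    = (\<Sum>i\<le>length w. if i = length u then wdelta (u @ v) w else 0)"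
    unfolding free_simps
  proof (rule sum.cong[OF HOL.refl])
    fix i assume "i \<in> {..length w}"
    then have i: "i \<le> length w" by simp
    have "take i w = u \<and> drop i w = v \<longleftrightarrow> i = length u \<and> w = u @ v"
    proof
      assume a: "take i w = u \<and> drop i w = v"
      then have "u @ v = w" by (metis append_take_drop_id)
      moreover have "length u = i" using a i length_take[of i w] by (simp only: min.absorb2)
      ultimately show "i = length u \<and> w = u @ v" by simp
    qed auto
    moreover have "wdelta u (take i w) * wdelta v (drop i w) = (if take i w = u \<and> drop i w = v then 1 else 0)"
      unfolding wdelta_def by (cases "take i w = u"; cases "drop i w = v") simp_all
    ultimately show "wdelta u (take i w) * wdelta v (drop i w) = (if i = length u then wdelta (u @ v) w else 0)"
      by (simp only:) (simp add: wdelta_def)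
  qed
  also have "\<dots> = wdelta (u @ v) w" by (auto simp: wdelta_def)
  finally show "(wdelta u \<otimes>\<^bsub>free_star_alg G\<^esub> wdelta v) w = wdelta (u @ v) w" .
qed

lemma wdelta_carrier: "w \<noteq> [] \<Longrightarrow> fst ` set w \<subseteq> G \<Longrightarrow> wdelta w \<in> carrier (free_star_alg G)"
  by (auto simp: free_carrier wdelta_def)

lemma free_gen_carrier: "g \<in> G \<Longrightarrow> free_gen g \<in> carrier (free_star_alg G)"
  by (simp add: wdelta_carrier flip: wdelta_gen)

lemma free_lin_induct [consumes 1]:
  assumes f: "f \<in> carrier (free_star_alg G)"
    and zero: "P (\<lambda>w. 0)"
    and delta: "\<And>w. w \<noteq> [] \<Longrightarrow> fst ` set w \<subseteq> G \<Longrightarrow> P (wdelta w)"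
    and add: "\<And>f g. f \<in> carrier (free_star_alg G) \<Longrightarrow> g \<in> carrier (free_star_alg G) \<Longrightarrow> P f \<Longrightarrow> P g \<Longrightarrow>
      P (f \<oplus>\<^bsub>free_star_alg G\<^esub> g)"
    and smult: "\<And>c f. f \<in> carrier (free_star_alg G) \<Longrightarrow> P f \<Longrightarrow> P (c \<odot>\<^bsub>free_star_alg G\<^esub> f)"
  shows "P f"
proof -
  define W where "W = {w. f w \<noteq> 0}"
  have "finite W" using f by (simp add: W_def free_carrier)
  then show ?thesis using f W_def
  proof (induction W arbitrary: f rule: finite_induct)
    case empty
    then have "f = (\<lambda>w. 0)" by auto
    then show ?case using zero by simp
  next
    case (insert w W)
    let ?g = "f(w := 0)"
    have w: "w \<noteq> []" "fst ` set w \<subseteq> G" using insert.prems by (auto simp: free_carrier)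
    have gW: "W = {w. ?g w \<noteq> 0}" using insert by auto
    have g: "?g \<in> carrier (free_star_alg G)"
      using insert.prems insert.hyps gW by (auto simp: free_carrier)
    have "f = (f w \<odot>\<^bsub>free_star_alg G\<^esub> wdelta w) \<oplus>\<^bsub>free_star_alg G\<^esub> ?g"
      by (auto simp: free_simps wdelta_def)
    moreover have "P ((f w \<odot>\<^bsub>free_star_alg G\<^esub> wdelta w) \<oplus>\<^bsub>free_star_alg G\<^esub> ?g)"
      by (intro add smult delta w g insert.IH gW free_smult_closed wdelta_carrier)
    ultimately show ?case by simp
  qed
qed

lemma free_induct [consumes 1]:
  assumes f: "f \<in> carrier (free_star_alg G)"
    and zero: "P (\<zero>\<^bsub>free_star_alg G\<^esub>)"
    and gen: "\<And>g. g \<in> G \<Longrightarrow> P (free_gen g)"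
    and add: "\<And>f g. f \<in> carrier (free_star_alg G) \<Longrightarrow> g \<in> carrier (free_star_alg G) \<Longrightarrow> P f \<Longrightarrow> P g \<Longrightarrow>
      P (f \<oplus>\<^bsub>free_star_alg G\<^esub> g)"
    and smult: "\<And>c f. f \<in> carrier (free_star_alg G) \<Longrightarrow> P f \<Longrightarrow> P (c \<odot>\<^bsub>free_star_alg G\<^esub> f)"
    and mult: "\<And>f g. f \<in> carrier (free_star_alg G) \<Longrightarrow> g \<in> carrier (free_star_alg G) \<Longrightarrow> P f \<Longrightarrow> P g \<Longrightarrow>
      P (f \<otimes>\<^bsub>free_star_alg G\<^esub> g)"
    and star: "\<And>f. f \<in> carrier (free_star_alg G) \<Longrightarrow> P f \<Longrightarrow> P (star (free_star_alg G) f)"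
  shows "P f"
proof (rule free_lin_induct[OF f _ _ add smult])
  have letter: "P (wdelta [x])" if "fst x \<in> G" for x
  proof (cases "snd x")
    case True
    then have "wdelta [x] = star (free_star_alg G) (free_gen (fst x))"
      unfolding wdelta_gen[symmetric] wdelta_star by (cases x) simp
    then show ?thesis using star[OF free_gen_carrier gen] that by simp
  next
    case False
    then have "wdelta [x] = free_gen (fst x)" unfolding wdelta_gen[symmetric] by (cases x) simp
    then show ?thesis using gen that by simp
  qed
  fix w :: "('a \<times> bool) list"
  assume "w \<noteq> []" "fst ` set w \<subseteq> G"
  then show "P (wdelta w)"
  proof (induction w rule: list_nonempty_induct)
    case (single x) then show ?case using letter by simp
  next
    case (cons x xs)
    have "wdelta (x # xs) = wdelta [x] \<otimes>\<^bsub>free_star_alg G\<^esub> wdelta xs" by (simp add: wdelta_mult)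
    then show ?case using mult[of "wdelta [x]" "wdelta xs"] cons letter by (simp add: wdelta_carrier)
  qed
qed (use zero in \<open>simp_all add: free_simps\<close>)

lemma star_homD:
  assumes "star_hom A B \<phi>" "x \<in> carrier A"
  shows "\<phi> x \<in> carrier B" "y \<in> carrier A \<Longrightarrow> \<phi> (x \<oplus>\<^bsub>A\<^esub> y) = \<phi> x \<oplus>\<^bsub>B\<^esub> \<phi> y"
    "\<phi> (c \<odot>\<^bsub>A\<^esub> x) = c \<odot>\<^bsub>B\<^esub> \<phi> x" "y \<in> carrier A \<Longrightarrow> \<phi> (x \<otimes>\<^bsub>A\<^esub> y) = \<phi> x \<otimes>\<^bsub>B\<^esub> \<phi> y"
    "\<phi> (star A x) = star B (\<phi> x)"
  using assms by (auto simp: star_hom_def)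

locale star_hom_pair = A: star_algebra A + B: star_algebra B
  for A :: "('c, 'a) star_alg_scheme" and B :: "('d, 'b) star_alg_scheme" +
  fixes \<phi> :: "'c \<Rightarrow> 'd"
  assumes hom: "star_hom A B \<phi>"
begin

lemma hom_zero: "\<phi> \<zero>\<^bsub>A\<^esub> = \<zero>\<^bsub>B\<^esub>"
proof -
  have "\<phi> (0 \<odot>\<^bsub>A\<^esub> \<zero>\<^bsub>A\<^esub>) = 0 \<odot>\<^bsub>B\<^esub> \<phi> \<zero>\<^bsub>A\<^esub>" by (rule star_homD(3)[OF hom]) simp
  then show ?thesis
    using A.smult_r_null[of 0] B.smult_l_null[of "\<phi> \<zero>\<^bsub>A\<^esub>"] star_homD(1)[OF hom, of "\<zero>\<^bsub>A\<^esub>"] by simp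
qed

lemma hom_finsum:
  assumes f: "\<And>x. x \<in> X \<Longrightarrow> f x \<in> carrier A"
  shows "\<phi> (\<Oplus>\<^bsub>A\<^esub>x\<in>X. f x) = (\<Oplus>\<^bsub>B\<^esub>x\<in>X. \<phi> (f x))"
proof (cases "finite X")
  case True
  then show ?thesis using f
  proof (induction X rule: finite_induct)
    case (insert x X)
    have "f \<in> X \<rightarrow> carrier A" "(\<lambda>x. \<phi> (f x)) \<in> X \<rightarrow> carrier B"
      using insert.prems star_homD(1)[OF hom] by auto
    with insert show ?case
      by (simp add: A.M.finsum_insert B.M.finsum_insert A.M.finsum_closed star_homD[OF hom])
  qed (simp add: hom_zero)
qed (simp add: A.M.finsum_infinite B.M.finsum_infinite hom_zero)

lemma hom_minus: "x \<in> carrier A \<Longrightarrow> y \<in> carrier A \<Longrightarrow> \<phi> (x \<ominus>\<^bsub>A\<^esub> y) = \<phi> x \<ominus>\<^bsub>B\<^esub> \<phi> y"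
proof -
  assume xy: "x \<in> carrier A" "y \<in> carrier A"
  have 1: "\<ominus>\<^bsub>A\<^esub> y \<in> carrier A" using xy by simp
  have "\<phi> (\<ominus>\<^bsub>A\<^esub> y) \<oplus>\<^bsub>B\<^esub> \<phi> y = \<zero>\<^bsub>B\<^esub>"
    using star_homD(2)[OF hom 1 xy(2)] xy by (simp add: A.M.l_neg hom_zero)
  then have "\<ominus>\<^bsub>B\<^esub> \<phi> y = \<phi> (\<ominus>\<^bsub>A\<^esub> y)"
    by (intro B.M.minus_equality) (use xy 1 star_homD(1)[OF hom] in auto)
  then show ?thesis using star_homD(2)[OF hom xy(1) 1] by (simp add: a_minus_def)
qed

lemma ck_rel_closed:
  assumes k: "k_graph \<Lambda>" and S: "\<And>\<kappa>. \<kappa> \<in> Mor \<Lambda> \<Longrightarrow> S \<kappa> \<in> carrier A" and r: "(x, y) \<in> ck_relations \<Lambda> A S"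
  shows "x \<in> carrier A \<and> y \<in> carrier A"
  using r
proof cases
  case (ck_range_projections v n)
  have "(\<lambda>\<kappa>. S \<kappa> \<otimes>\<^bsub>A\<^esub> star A (S \<kappa>)) \<in> paths_from_deg \<Lambda> v n \<rightarrow> carrier A"
    using S by (auto simp: paths_from_deg_def paths_from_def A.mult_closed A.star_closed)
  then show ?thesis using ck_range_projections S k_graph.ident_closed[OF k] by (simp add: A.M.finsum_closed)
qed (use S k_graph.ident_closed[OF k] k_graph.pcomp_closed[OF k] k_graph.src_closed[OF k] in
      \<open>auto simp: A.mult_closed A.star_closed\<close>)

lemma hom_range_sum:
  assumes S: "\<And>\<kappa>. \<kappa> \<in> Mor \<Lambda> \<Longrightarrow> S \<kappa> \<in> carrier A" and T: "\<And>\<kappa>. \<kappa> \<in> Mor \<Lambda> \<Longrightarrow> \<phi> (S \<kappa>) = T \<kappa>"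
  shows "\<phi> (\<Oplus>\<^bsub>A\<^esub>\<kappa>\<in>paths_from_deg \<Lambda> v n. S \<kappa> \<otimes>\<^bsub>A\<^esub> star A (S \<kappa>))
     = (\<Oplus>\<^bsub>B\<^esub>\<kappa>\<in>paths_from_deg \<Lambda> v n. T \<kappa> \<otimes>\<^bsub>B\<^esub> star B (T \<kappa>))"
proof -
  have M: "\<kappa> \<in> Mor \<Lambda>" if "\<kappa> \<in> paths_from_deg \<Lambda> v n" for \<kappa>
    using that by (simp add: paths_from_deg_def paths_from_def)
  have Tc: "T \<kappa> \<in> carrier B" if "\<kappa> \<in> Mor \<Lambda>" for \<kappa>
    using T[OF that] star_homD(1)[OF hom S[OF that]] by simp
  have "\<phi> (\<Oplus>\<^bsub>A\<^esub>\<kappa>\<in>paths_from_deg \<Lambda> v n. S \<kappa> \<otimes>\<^bsub>A\<^esub> star A (S \<kappa>))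
     = (\<Oplus>\<^bsub>B\<^esub>\<kappa>\<in>paths_from_deg \<Lambda> v n. \<phi> (S \<kappa> \<otimes>\<^bsub>A\<^esub> star A (S \<kappa>)))"
    by (rule hom_finsum) (simp add: M S A.mult_closed A.star_closed)
  also have "\<dots> = (\<Oplus>\<^bsub>B\<^esub>\<kappa>\<in>paths_from_deg \<Lambda> v n. T \<kappa> \<otimes>\<^bsub>B\<^esub> star B (T \<kappa>))"
    by (rule B.M.finsum_cong')
       (simp_all add: M S T Tc A.mult_closed A.star_closed B.mult_closed B.star_closed star_homD[OF hom])
  finally show ?thesis .
qed

lemma ck_rel_image:
  assumes k: "k_graph \<Lambda>" and S: "\<And>\<kappa>. \<kappa> \<in> Mor \<Lambda> \<Longrightarrow> S \<kappa> \<in> carrier A"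
    and T: "\<And>\<kappa>. \<kappa> \<in> Mor \<Lambda> \<Longrightarrow> \<phi> (S \<kappa>) = T \<kappa>" and r: "(x, y) \<in> ck_relations \<Lambda> A S"
  shows "(\<phi> x, \<phi> y) \<in> ck_relations \<Lambda> B T"
  using r
proof cases
  case (ck_range_projections v n)
  have "\<phi> y = (\<Oplus>\<^bsub>B\<^esub>\<kappa>\<in>paths_from_deg \<Lambda> v n. T \<kappa> \<otimes>\<^bsub>B\<^esub> star B (T \<kappa>))"
    unfolding ck_range_projections by (rule hom_range_sum[OF S T])
  then show ?thesis using ck_relations.ck_range_projections[where \<Lambda> = \<Lambda> and A = B and S = T, of v n] ck_range_projections T k_graph.ident_closed[OF k] by simp
next
  case (ck_idempotent v)
  then show ?thesis using ck_relations.ck_idempotent[where \<Lambda> = \<Lambda> and A = B and S = T, of v] S T k_graph.ident_closed[OF k]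
    by (simp add: star_homD[OF hom])
next
  case (ck_selfadjoint v)
  then show ?thesis using ck_relations.ck_selfadjoint[where \<Lambda> = \<Lambda> and A = B and S = T, of v] S T k_graph.ident_closed[OF k]
    by (simp add: star_homD[OF hom])
next
  case (ck_orthogonal v w)
  then show ?thesis using ck_relations.ck_orthogonal[where \<Lambda> = \<Lambda> and A = B and S = T, of v w] S T k_graph.ident_closed[OF k]
    by (simp add: star_homD[OF hom] hom_zero)
next
  case (ck_partial_isometry \<kappa>)
  then show ?thesis using ck_relations.ck_partial_isometry[where \<Lambda> = \<Lambda> and A = B and S = T, of \<kappa>] S T
    by (simp add: star_homD[OF hom] A.mult_closed A.star_closed)
next
  case (ck_composition \<kappa> \<mu>)
  then show ?thesis using ck_relations.ck_composition[where \<Lambda> = \<Lambda> and A = B and S = T, of \<kappa> \<mu>] S T k_graph.pcomp_closed[OF k]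
    by (simp add: star_homD[OF hom])
next
  case (ck_source_projection \<kappa>)
  then show ?thesis using ck_relations.ck_source_projection[where \<Lambda> = \<Lambda> and A = B and S = T, of \<kappa>] S T
      k_graph.ident_closed[OF k] k_graph.src_closed[OF k]
    by (simp add: star_homD[OF hom] A.star_closed)
qed

lemma ck_rel_preimage:
  assumes k: "k_graph \<Lambda>" and S: "\<And>\<kappa>. \<kappa> \<in> Mor \<Lambda> \<Longrightarrow> S \<kappa> \<in> carrier A"
    and T: "\<And>\<kappa>. \<kappa> \<in> Mor \<Lambda> \<Longrightarrow> \<phi> (S \<kappa>) = T \<kappa>" and r: "(a, b) \<in> ck_relations \<Lambda> B T"
  shows "\<exists>x y. (x, y) \<in> ck_relations \<Lambda> A S \<and> a = \<phi> x \<and> b = \<phi> y"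
  using r
proof cases
  case (ck_range_projections v n)
  show ?thesis
    by (rule exI, rule exI, rule conjI, rule ck_relations.ck_range_projections[where \<Lambda> = \<Lambda> and A = A and S = S, of v n])
       (use ck_range_projections k_graph.ident_closed[OF k] in \<open>simp_all add: hom_range_sum[of \<Lambda> S T, OF S T] T\<close>)
next
  case (ck_idempotent v)
  show ?thesis
    by (rule exI, rule exI, rule conjI, rule ck_relations.ck_idempotent[where \<Lambda> = \<Lambda> and A = A and S = S, of v])
       (use ck_idempotent S T k_graph.ident_closed[OF k] in \<open>simp_all add: star_homD[OF hom]\<close>)
next
  case (ck_selfadjoint v)
  show ?thesis
    by (rule exI, rule exI, rule conjI, rule ck_relations.ck_selfadjoint[where \<Lambda> = \<Lambda> and A = A and S = S, of v])
       (use ck_selfadjoint S T k_graph.ident_closed[OF k] in \<open>simp_all add: star_homD[OF hom]\<close>)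
next
  case (ck_orthogonal v w)
  show ?thesis
    by (rule exI, rule exI, rule conjI, rule ck_relations.ck_orthogonal[where \<Lambda> = \<Lambda> and A = A and S = S, of v w])
       (use ck_orthogonal S T k_graph.ident_closed[OF k] in \<open>simp_all add: star_homD[OF hom] hom_zero\<close>)
next
  case (ck_partial_isometry \<kappa>)
  show ?thesis
    by (rule exI, rule exI, rule conjI, rule ck_relations.ck_partial_isometry[where \<Lambda> = \<Lambda> and A = A and S = S, of \<kappa>])
       (use ck_partial_isometry S T in \<open>simp_all add: star_homD[OF hom] A.mult_closed A.star_closed\<close>)
next
  case (ck_composition \<kappa> \<mu>)
  show ?thesis
    by (rule exI, rule exI, rule conjI, rule ck_relations.ck_composition[where \<Lambda> = \<Lambda> and A = A and S = S, of \<kappa> \<mu>])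
       (use ck_composition S T k_graph.pcomp_closed[OF k] in \<open>simp_all add: star_homD[OF hom]\<close>)
next
  case (ck_source_projection \<kappa>)
  show ?thesis
    by (rule exI, rule exI, rule conjI, rule ck_relations.ck_source_projection[where \<Lambda> = \<Lambda> and A = A and S = S, of \<kappa>])
       (use ck_source_projection S T k_graph.ident_closed[OF k] k_graph.src_closed[OF k] in
         \<open>simp_all add: star_homD[OF hom] A.star_closed\<close>)
qed

end

abbreviation "path_alg \<Lambda> \<equiv> free_star_alg (Mor \<Lambda>)"

lemma ck_seminorm_zero: "ck_seminorm \<Lambda> (\<lambda>x. 0)"
  by (simp add: ck_seminorm_def cstar_seminorm_def)

lemma ck_seminormed: "ck_seminorm \<Lambda> \<rho> \<Longrightarrow> cstar_seminormed (path_alg \<Lambda>) \<rho>"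
  using star_algebra_free by (auto simp: cstar_seminormed_def cstar_seminormed_axioms_def ck_seminorm_def)

lemma ck_rel_closed_free:
  assumes "k_graph \<Lambda>" "(x, y) \<in> ck_relations \<Lambda> (path_alg \<Lambda>) free_gen"
  shows "x \<in> carrier (path_alg \<Lambda>)" "y \<in> carrier (path_alg \<Lambda>)"
proof -
  interpret star_hom_pair "path_alg \<Lambda>" "path_alg \<Lambda>" id
    using star_algebra_free by (auto simp: star_hom_pair_def star_hom_pair_axioms_def star_hom_def)
  show "x \<in> carrier (path_alg \<Lambda>)" "y \<in> carrier (path_alg \<Lambda>)"
    using ck_rel_closed[OF assms(1) free_gen_carrier assms(2)] by auto
qed

lemma ck_gen_bound:
  assumes k: "k_graph \<Lambda>" and \<rho>: "ck_seminorm \<Lambda> \<rho>" and g: "\<kappa> \<in> Mor \<Lambda>"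
  shows "\<rho> (free_gen \<kappa>) \<le> 1"
proof -
  interpret cstar_seminormed "path_alg \<Lambda>" \<rho> by (rule ck_seminormed[OF \<rho>])
  have eq: "\<rho> x = \<rho> y" if "(x, y) \<in> ck_relations \<Lambda> (path_alg \<Lambda>) free_gen" for x y
    using sn_abs_diff[OF ck_rel_closed_free[OF k that]] \<rho> that by (auto simp: ck_seminorm_def)
  let ?v = "src \<Lambda> \<kappa>" and ?p = "free_gen (ident \<Lambda> (src \<Lambda> \<kappa>)) :: ('b \<times> bool) list \<Rightarrow> complex"
  have v: "?v \<in> Obj \<Lambda>" using k_graph.src_closed[OF k g] .
  have p: "?p \<in> carrier (path_alg \<Lambda>)" using free_gen_carrier k_graph.ident_closed[OF k v] .
  note gc = free_gen_carrier[OF g]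
  have "(\<rho> ?p)\<^sup>2 = \<rho> (star (path_alg \<Lambda>) ?p \<otimes>\<^bsub>path_alg \<Lambda>\<^esub> ?p)" using sn_cstar[OF p] by simp
  also have "\<dots> = \<rho> ?p"
    using eq[OF ck_relations.ck_source_projection[OF k_graph.ident_closed[OF k v]]] k_graph.src_ident[OF k v] by simp
  finally have p1: "\<rho> ?p = 0 \<or> \<rho> ?p = 1" by (simp add: power2_eq_square)
  have "(\<rho> (free_gen \<kappa>))\<^sup>2 = \<rho> ?p"
    using sn_cstar[OF gc] eq[OF ck_relations.ck_source_projection[OF g]] by simp
  then have "(\<rho> (free_gen \<kappa>))\<^sup>2 \<le> 1" using p1 by auto
  then show ?thesis using power2_le_imp_le[of "\<rho> (free_gen \<kappa>)" 1] by simp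
qed

lemma ck_bound:
  assumes k: "k_graph \<Lambda>" and x: "x \<in> carrier (path_alg \<Lambda>)"
  shows "\<exists>K\<ge>0. \<forall>\<rho>. ck_seminorm \<Lambda> \<rho> \<longrightarrow> \<rho> x \<le> K"
  using x
proof (induction rule: free_induct)
  case 1
  have "\<rho> \<zero>\<^bsub>path_alg \<Lambda>\<^esub> \<le> 0" if "ck_seminorm \<Lambda> \<rho>" for \<rho>
    using cstar_seminormed.sn_zero[OF ck_seminormed[OF that]] by (rule eq_refl)
  then show ?case by (intro exI[of _ 0] conjI allI impI) simp_all
next
  case (2 g)
  then show ?case using ck_gen_bound[OF k] by (intro exI[of _ 1]) auto
next
  case (3 f g)
  then obtain K L where "0 \<le> K" "0 \<le> L" "\<And>\<rho>. ck_seminorm \<Lambda> \<rho> \<Longrightarrow> \<rho> f \<le> K" "\<And>\<rho>. ck_seminorm \<Lambda> \<rho> \<Longrightarrow> \<rho> g \<le> L" by auto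
  then show ?case using cstar_seminormed.sn_tri[OF ck_seminormed 3(1,2)]
    by (intro exI[of _ "K + L"]) (fastforce intro: order_trans add_mono)
next
  case (4 c f)
  then obtain K where "0 \<le> K" "\<And>\<rho>. ck_seminorm \<Lambda> \<rho> \<Longrightarrow> \<rho> f \<le> K" by auto
  note K = this
  have "\<rho> (c \<odot>\<^bsub>path_alg \<Lambda>\<^esub> f) \<le> cmod c * K" if \<rho>: "ck_seminorm \<Lambda> \<rho>" for \<rho>
    unfolding cstar_seminormed.sn_scale[OF ck_seminormed[OF \<rho>] 4(1)] by (intro mult_left_mono K \<rho>) simp
  moreover have "0 \<le> cmod c * K" using K(1) by (simp only: mult_nonneg_nonneg norm_ge_zero)
  ultimately show ?case by blast
next
  case (5 f g)
  then obtain K L where KL: "0 \<le> K" "0 \<le> L" "\<And>\<rho>. ck_seminorm \<Lambda> \<rho> \<Longrightarrow> \<rho> f \<le> K" "\<And>\<rho>. ck_seminorm \<Lambda> \<rho> \<Longrightarrow> \<rho> g \<le> L" by auto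
  have "\<rho> (f \<otimes>\<^bsub>path_alg \<Lambda>\<^esub> g) \<le> K * L" if \<rho>: "ck_seminorm \<Lambda> \<rho>" for \<rho>
  proof -
    have "\<rho> (f \<otimes>\<^bsub>path_alg \<Lambda>\<^esub> g) \<le> \<rho> f * \<rho> g" by (rule cstar_seminormed.sn_mult[OF ck_seminormed[OF \<rho>] 5(1,2)])
    also have "\<dots> \<le> K * L"
      by (intro mult_mono KL \<rho> cstar_seminormed.sn_nonneg[OF ck_seminormed[OF \<rho>]] 5)
    finally show ?thesis .
  qed
  then show ?case using KL by (intro exI[of _ "K * L"]) auto
next
  case (6 f)
  then obtain K where "0 \<le> K" "\<And>\<rho>. ck_seminorm \<Lambda> \<rho> \<Longrightarrow> \<rho> f \<le> K" by auto
  note K = this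
  have "\<rho> (star (path_alg \<Lambda>) f) \<le> K" if \<rho>: "ck_seminorm \<Lambda> \<rho>" for \<rho>
    unfolding cstar_seminormed.sn_star[OF ck_seminormed[OF \<rho>] 6(1)] by (rule K(2)[OF \<rho>])
  with K(1) show ?case by blast
qed

lemma universal_upper:
  assumes k: "k_graph \<Lambda>" and x: "x \<in> carrier (path_alg \<Lambda>)" and \<rho>: "ck_seminorm \<Lambda> \<rho>"
  shows "\<rho> x \<le> universal_seminorm \<Lambda> x"
  unfolding universal_seminorm_def
proof (rule cSUP_upper)
  show "bdd_above ((\<lambda>\<rho>. \<rho> x) ` {\<rho>. ck_seminorm \<Lambda> \<rho>})" using ck_bound[OF k x] by (auto simp: bdd_above_def)
qed (use \<rho> in simp)

lemma universal_least:
  assumes "\<And>\<rho>. ck_seminorm \<Lambda> \<rho> \<Longrightarrow> \<rho> x \<le> M"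
  shows "universal_seminorm \<Lambda> x \<le> M"
  unfolding universal_seminorm_def
  by (rule cSUP_least) (use assms ck_seminorm_zero[of \<Lambda>] in auto)

lemma ck_seminorm_universal:
  assumes k: "k_graph \<Lambda>"
  shows "ck_seminorm \<Lambda> (universal_seminorm \<Lambda>)"
proof -
  let ?u = "universal_seminorm \<Lambda>"
  note sd = ck_seminormed
  have nn: "0 \<le> ?u x" if "x \<in> carrier (path_alg \<Lambda>)" for x
    using universal_upper[OF k that ck_seminorm_zero] .
  have sc_le: "?u (c \<odot>\<^bsub>path_alg \<Lambda>\<^esub> x) \<le> cmod c * ?u x" if x: "x \<in> carrier (path_alg \<Lambda>)" for c x
    by (rule universal_least)
       (simp add: cstar_seminormed.sn_scale[OF sd x] mult_left_mono universal_upper[OF k x])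
  have sc: "?u (c \<odot>\<^bsub>path_alg \<Lambda>\<^esub> x) = cmod c * ?u x" if x: "x \<in> carrier (path_alg \<Lambda>)" for c x
  proof (cases "c = 0")
    case True
    then show ?thesis using sc_le[OF x, of 0] nn[OF free_smult_closed[OF x, of 0]] by simp
  next
    case False
    then have "x = inverse c \<odot>\<^bsub>path_alg \<Lambda>\<^esub> (c \<odot>\<^bsub>path_alg \<Lambda>\<^esub> x)" by (simp add: free_simps field_simps)
    then have "?u x \<le> inverse (cmod c) * ?u (c \<odot>\<^bsub>path_alg \<Lambda>\<^esub> x)"
      using sc_le[OF free_smult_closed[OF x, of c], of "inverse c"] by (simp add: norm_inverse)
    then have "cmod c * ?u x \<le> ?u (c \<odot>\<^bsub>path_alg \<Lambda>\<^esub> x)" using False by (simp add: field_simps)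
    then show ?thesis using sc_le[OF x, of c] by simp
  qed
  have tri: "?u (x \<oplus>\<^bsub>path_alg \<Lambda>\<^esub> y) \<le> ?u x + ?u y" if "x \<in> carrier (path_alg \<Lambda>)" "y \<in> carrier (path_alg \<Lambda>)" for x y
    by (rule universal_least)
       (meson add_mono cstar_seminormed.sn_tri[OF sd] universal_upper[OF k] that order_trans)
  have mu: "?u (x \<otimes>\<^bsub>path_alg \<Lambda>\<^esub> y) \<le> ?u x * ?u y" if "x \<in> carrier (path_alg \<Lambda>)" "y \<in> carrier (path_alg \<Lambda>)" for x y
  proof (rule universal_least)
    fix \<rho> assume \<rho>: "ck_seminorm \<Lambda> \<rho>"
    have "\<rho> (x \<otimes>\<^bsub>path_alg \<Lambda>\<^esub> y) \<le> \<rho> x * \<rho> y" using cstar_seminormed.sn_mult[OF sd[OF \<rho>] that] .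
    also have "\<dots> \<le> ?u x * ?u y"
      by (intro mult_mono universal_upper[OF k] that \<rho> nn cstar_seminormed.sn_nonneg[OF sd[OF \<rho>]])
    finally show "\<rho> (x \<otimes>\<^bsub>path_alg \<Lambda>\<^esub> y) \<le> ?u x * ?u y" .
  qed
  have cs: "?u (star (path_alg \<Lambda>) x \<otimes>\<^bsub>path_alg \<Lambda>\<^esub> x) = (?u x)\<^sup>2" if x: "x \<in> carrier (path_alg \<Lambda>)" for x
  proof (rule antisym)
    show "?u (star (path_alg \<Lambda>) x \<otimes>\<^bsub>path_alg \<Lambda>\<^esub> x) \<le> (?u x)\<^sup>2"
      by (rule universal_least)
         (simp add: cstar_seminormed.sn_cstar[OF sd x] power_mono universal_upper[OF k x] cstar_seminormed.sn_nonneg[OF sd x])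
    have sx: "star (path_alg \<Lambda>) x \<otimes>\<^bsub>path_alg \<Lambda>\<^esub> x \<in> carrier (path_alg \<Lambda>)" using x free_mult_closed free_star_closed by blast
    have "?u x \<le> sqrt (?u (star (path_alg \<Lambda>) x \<otimes>\<^bsub>path_alg \<Lambda>\<^esub> x))"
    proof (rule universal_least)
      fix \<rho> assume \<rho>: "ck_seminorm \<Lambda> \<rho>"
      show "\<rho> x \<le> sqrt (?u (star (path_alg \<Lambda>) x \<otimes>\<^bsub>path_alg \<Lambda>\<^esub> x))"
        using universal_upper[OF k sx \<rho>] cstar_seminormed.sn_cstar[OF sd[OF \<rho>] x] by (simp add: real_le_rsqrt)
    qed
    then show "(?u x)\<^sup>2 \<le> ?u (star (path_alg \<Lambda>) x \<otimes>\<^bsub>path_alg \<Lambda>\<^esub> x)"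
      using nn[OF x] nn[OF sx] sqrt_ge_absD by fastforce
  qed
  have "?u (x \<ominus>\<^bsub>path_alg \<Lambda>\<^esub> y) = 0" if r: "(x, y) \<in> ck_relations \<Lambda> (path_alg \<Lambda>) free_gen" for x y
  proof (rule antisym)
    show "?u (x \<ominus>\<^bsub>path_alg \<Lambda>\<^esub> y) \<le> 0"
      by (rule universal_least) (use r in \<open>auto simp: ck_seminorm_def\<close>)
    show "0 \<le> ?u (x \<ominus>\<^bsub>path_alg \<Lambda>\<^esub> y)"
      using ck_rel_closed_free[OF k r] free_abelian_group[of "Mor \<Lambda>"] by (intro nn abelian_group.minus_closed)
  qed
  then show ?thesis using nn sc tri mu cs by (auto simp: ck_seminorm_def cstar_seminorm_def)
qed

lemma universal_seminormed: "k_graph \<Lambda> \<Longrightarrow> cstar_seminormed (path_alg \<Lambda>) (universal_seminorm \<Lambda>)"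
  by (simp add: ck_seminormed ck_seminorm_universal)

lemma kgraph_cstar_algebra: "k_graph \<Lambda> \<Longrightarrow> cstar_algebra (kgraph_cstar \<Lambda>)"
  unfolding kgraph_cstar_def by (rule cstar_seminormed.cstar_algebra_C[OF universal_seminormed])

context cstar_seminormed
begin

definition emb :: "'c \<Rightarrow> (nat \<Rightarrow> 'c) set" where "emb x = cls (\<lambda>n. x)"

lemma emb_hom: "star_hom A C emb"
  by (simp add: star_hom_def emb_def CS_const C_add C_smult C_mult C_star)

lemma emb_pair: "star_hom_pair A C emb"
  by (intro star_hom_pair.intro star_hom_pair_axioms.intro star_algebra_axioms star_algebra_C emb_hom)

lemma emb_eq: "x \<in> carrier A \<Longrightarrow> y \<in> carrier A \<Longrightarrow> emb x = emb y \<longleftrightarrow> \<rho> (x \<ominus> y) = 0"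
  by (simp add: emb_def cls_eq CS_const LIMSEQ_const_iff)

lemma emb_nrm: "x \<in> carrier A \<Longrightarrow> nrm C (emb x) = \<rho> x"
  using C_nrm[OF CS_const, of x] by (simp add: emb_def LIMSEQ_const_iff)

lemma emb_dense:
  assumes X: "X \<in> CS" shows "(\<lambda>n. nrm C (emb (X n) \<ominus>\<^bsub>C\<^esub> cls X)) \<longlonglongrightarrow> 0"
proof (rule LIMSEQ_I)
  fix e :: real assume e: "e > 0"
  obtain N where N: "\<And>m n. m \<ge> N \<Longrightarrow> n \<ge> N \<Longrightarrow> \<rho> (X m \<ominus> X n) < e/2"
    using CS_D[OF X, of "e/2"] e by auto
  have "norm (nrm C (emb (X n) \<ominus>\<^bsub>C\<^esub> cls X) - 0) < e" if n: "n \<ge> N" for n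
  proof -
    have l: "(\<lambda>i. \<rho> (X n \<ominus> X i)) \<longlonglongrightarrow> nrm C (emb (X n) \<ominus>\<^bsub>C\<^esub> cls X)"
      using C_nrm[OF CS_minus[OF CS_const[OF CS_carrier[OF X]] X], of n]
      by (simp add: emb_def C_minus CS_const CS_carrier X)
    have "nrm C (emb (X n) \<ominus>\<^bsub>C\<^esub> cls X) \<le> e/2"
      using N[OF n] by (intro LIMSEQ_le_const2[OF l] exI[of _ N]) (auto intro: less_imp_le)
    moreover have "0 \<le> nrm C (emb (X n) \<ominus>\<^bsub>C\<^esub> cls X)"
      using LIMSEQ_le_const[OF l] sn_nonneg CS_carrier[OF X] by auto
    ultimately show ?thesis using e by simp
  qed
  then show "\<exists>no. \<forall>n\<ge>no. norm (nrm C (emb (X n) \<ominus>\<^bsub>C\<^esub> cls X) - 0) < e" by blast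
qed

end

lemma kgraph_gen_emb: "k_graph \<Lambda> \<Longrightarrow> kgraph_gen \<Lambda> \<kappa> = cstar_seminormed.emb (path_alg \<Lambda>) (universal_seminorm \<Lambda>) (free_gen \<kappa>)"
  by (simp add: kgraph_gen_def cstar_seminormed.emb_def cstar_seminormed.cls_def universal_seminormed)

lemma kgraph_cstar_family:
  assumes k: "k_graph \<Lambda>"
  shows "ck_family \<Lambda> (kgraph_cstar \<Lambda>) (kgraph_gen \<Lambda>)"
proof -
  interpret U: cstar_seminormed "path_alg \<Lambda>" "universal_seminorm \<Lambda>" by (rule universal_seminormed[OF k])
  interpret star_hom_pair "path_alg \<Lambda>" U.C U.emb by (rule U.emb_pair)
  have "a = b" if r: "(a, b) \<in> ck_relations \<Lambda> U.C (kgraph_gen \<Lambda>)" for a b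
  proof -
    obtain x y where xy: "(x, y) \<in> ck_relations \<Lambda> (path_alg \<Lambda>) free_gen" "a = U.emb x" "b = U.emb y"
      using ck_rel_preimage[OF k free_gen_carrier kgraph_gen_emb[OF k, symmetric] r] by blast
    have "universal_seminorm \<Lambda> (x \<ominus>\<^bsub>path_alg \<Lambda>\<^esub> y) = 0"
      using ck_seminorm_universal[OF k] xy(1) by (auto simp: ck_seminorm_def)
    then show ?thesis using xy U.emb_eq ck_rel_closed_free[OF k xy(1)] by simp
  qed
  moreover have "kgraph_gen \<Lambda> \<kappa> \<in> carrier U.C" if "\<kappa> \<in> Mor \<Lambda>" for \<kappa>
    using star_homD(1)[OF U.emb_hom free_gen_carrier[OF that]] by (simp add: kgraph_gen_emb[OF k])
  ultimately show ?thesis by (auto simp: ck_family_def kgraph_cstar_def)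
qed

lemma kgraph_cstar_generated:
  assumes k: "k_graph \<Lambda>" and V: "cstar_subalgebra (kgraph_cstar \<Lambda>) V" and g: "kgraph_gen \<Lambda> ` Mor \<Lambda> \<subseteq> V"
  shows "V = carrier (kgraph_cstar \<Lambda>)"
proof -
  interpret U: cstar_seminormed "path_alg \<Lambda>" "universal_seminorm \<Lambda>" by (rule universal_seminormed[OF k])
  interpret star_hom_pair "path_alg \<Lambda>" U.C U.emb by (rule U.emb_pair)
  have V': "cstar_subalgebra U.C V" using V by (simp add: kgraph_cstar_def)
  have e: "U.emb x \<in> V" if "x \<in> carrier (path_alg \<Lambda>)" for x
    using that
  proof (induction rule: free_induct)
    case 1 show ?case using V' by (simp add: hom_zero cstar_subalgebra_def)
  next
    case (2 h) then show ?case using g by (auto simp: kgraph_gen_emb[OF k])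
  qed (use V' in \<open>simp_all add: star_homD[OF U.emb_hom] cstar_subalgebra_def\<close>)
  have "P \<in> V" if P: "P \<in> carrier U.C" for P
  proof -
    obtain X where X: "X \<in> U.CS" "P = U.cls X" using U.C_cases[OF P] by auto
    have "\<forall>n. U.emb (X n) \<in> V" using e U.CS_carrier[OF X(1)] by blast
    moreover have "(\<lambda>n. nrm U.C (U.emb (X n) \<ominus>\<^bsub>U.C\<^esub> P)) \<longlonglongrightarrow> 0" using U.emb_dense[OF X(1)] X(2) by simp
    moreover have "x \<in> V" if "x \<in> carrier U.C" "\<forall>n. X n \<in> V" "(\<lambda>n. nrm U.C (X n \<ominus>\<^bsub>U.C\<^esub> x)) \<longlonglongrightarrow> 0" for X x
      using V' that unfolding cstar_subalgebra_def by blast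
    ultimately show ?thesis using P by simp
  qed
  then show ?thesis using V' by (auto simp: cstar_subalgebra_def kgraph_cstar_def)
qed

locale free_eval = star_algebra B for B :: "('c, 'b) star_alg_scheme" (structure) +
  fixes G :: "'m set" and T :: "'m \<Rightarrow> 'c"
  assumes T: "g \<in> G \<Longrightarrow> T g \<in> carrier B"
begin

fun wv :: "('m \<times> bool) list \<Rightarrow> 'c" where
  "wv [] = \<zero>"
| "wv [(g, b)] = (if b then star B (T g) else T g)"
| "wv (x # y # ys) = wv [x] \<otimes> wv (y # ys)"

definition words :: "('m \<times> bool) list set" where "words = {w. w \<noteq> [] \<and> fst ` set w \<subseteq> G}"

definition ev :: "(('m \<times> bool) list \<Rightarrow> complex) \<Rightarrow> 'c" where
  "ev f = (\<Oplus>w\<in>{w. f w \<noteq> 0}. f w \<odot> wv w)"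

lemma sm_closed: "x \<in> carrier B \<Longrightarrow> c \<odot> x \<in> carrier B"
  using smult_closed[of c x] by simp

lemma wv_closed: "w \<in> words \<Longrightarrow> wv w \<in> carrier B"
  by (induction w rule: wv.induct) (auto simp: words_def T star_closed mult_closed)

lemma wv_append: "u \<in> words \<Longrightarrow> v \<in> words \<Longrightarrow> wv (u @ v) = wv u \<otimes> wv v"
proof (induction u rule: wv.induct)
  case (2 g b)
  then obtain y ys where "v = y # ys" by (auto simp: words_def neq_Nil_conv)
  then show ?case by simp
next
  case (3 x y ys)
  have w: "[x] \<in> words" "y # ys \<in> words" using 3 by (auto simp: words_def)
  have "wv ((x # y # ys) @ v) = wv [x] \<otimes> wv ((y # ys) @ v)" by simp
  also have "\<dots> = wv [x] \<otimes> (wv (y # ys) \<otimes> wv v)" using 3 w by simp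
  also have "\<dots> = (wv [x] \<otimes> wv (y # ys)) \<otimes> wv v" using wv_closed w 3 by (simp only: mult_assoc)
  finally show ?case by simp
qed (simp add: words_def)

lemma wstar_words: "w \<in> words \<Longrightarrow> wstar w \<in> words"
  by (auto simp: words_def image_image case_prod_beta)

lemma wv_star: "w \<in> words \<Longrightarrow> wv (wstar w) = star B (wv w)"
proof (induction w rule: wv.induct)
  case (2 g b)
  then show ?case by (auto simp: words_def T star_star)
next
  case (3 x y ys)
  have w: "[x] \<in> words" "y # ys \<in> words" using 3 by (auto simp: words_def)
  have "wv (wstar (x # y # ys)) = wv (wstar (y # ys) @ wstar [x])" by simp
  also have "\<dots> = wv (wstar (y # ys)) \<otimes> wv (wstar [x])" by (rule wv_append) (rule wstar_words, rule w)+
  also have "\<dots> = star B (wv (y # ys)) \<otimes> star B (wv [x])" using 3 w by simp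
  also have "\<dots> = star B (wv (x # y # ys))" using wv_closed w by (simp add: star_mult)
  finally show ?case .
qed (simp add: words_def)

lemma ev_superset:
  assumes "f \<in> carrier (free_star_alg G)" "finite W" "{w. f w \<noteq> 0} \<subseteq> W" "W \<subseteq> words"
  shows "ev f = (\<Oplus>w\<in>W. f w \<odot> wv w)"
  unfolding ev_def
proof (rule M.add.finprod_mono_neutral_cong_left)
  show "f i \<odot> wv i = \<zero>" if "i \<in> W - {w. f w \<noteq> 0}" for i
    using that smult_l_null[of "wv i"] wv_closed assms by auto
qed (use assms wv_closed sm_closed in auto)

lemma free_supp: "f \<in> carrier (free_star_alg G) \<Longrightarrow> finite {w. f w \<noteq> 0} \<and> {w. f w \<noteq> 0} \<subseteq> words"
  by (auto simp: free_carrier words_def)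

lemma ev_closed: "f \<in> carrier (free_star_alg G) \<Longrightarrow> ev f \<in> carrier B"
  unfolding ev_def using free_supp[of f] by (intro M.finsum_closed) (auto intro: sm_closed wv_closed)

lemma ev_add: assumes f: "f \<in> carrier (free_star_alg G)" and g: "g \<in> carrier (free_star_alg G)"
  shows "ev (f \<oplus>\<^bsub>free_star_alg G\<^esub> g) = ev f \<oplus> ev g"
proof -
  let ?W = "{w. f w \<noteq> 0} \<union> {w. g w \<noteq> 0}"
  have W: "finite ?W" "?W \<subseteq> words" using free_supp f g by auto
  then have c: "wv w \<in> carrier B" if "w \<in> ?W" for w using wv_closed that by blast
  have "ev (f \<oplus>\<^bsub>free_star_alg G\<^esub> g) = (\<Oplus>w\<in>?W. (f \<oplus>\<^bsub>free_star_alg G\<^esub> g) w \<odot> wv w)"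
    by (rule ev_superset[OF free_add_closed[OF f g] W(1) _ W(2)]) (auto simp: free_simps)
  also have "\<dots> = (\<Oplus>w\<in>?W. f w \<odot> wv w \<oplus> g w \<odot> wv w)"
    using c smult_l_distr by (intro M.finsum_cong') (auto simp: free_simps sm_closed)
  also have "\<dots> = (\<Oplus>w\<in>?W. f w \<odot> wv w) \<oplus> (\<Oplus>w\<in>?W. g w \<odot> wv w)"
    using c by (intro M.finsum_addf) (auto simp: sm_closed)
  also have "\<dots> = ev f \<oplus> ev g"
    using ev_superset[OF f W(1) _ W(2)] ev_superset[OF g W(1) _ W(2)] by simp
  finally show ?thesis .
qed

lemma ev_smult: assumes f: "f \<in> carrier (free_star_alg G)"
  shows "ev (c \<odot>\<^bsub>free_star_alg G\<^esub> f) = c \<odot> ev f"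
proof -
  let ?W = "{w. f w \<noteq> 0}"
  have W: "finite ?W" "?W \<subseteq> words" using free_supp f by auto
  then have cl: "wv w \<in> carrier B" if "w \<in> ?W" for w using wv_closed that by blast
  have "ev (c \<odot>\<^bsub>free_star_alg G\<^esub> f) = (\<Oplus>w\<in>?W. (c \<odot>\<^bsub>free_star_alg G\<^esub> f) w \<odot> wv w)"
    by (rule ev_superset[OF free_smult_closed[OF f] W(1) _ W(2)]) (auto simp: free_simps)
  also have "\<dots> = (\<Oplus>w\<in>?W. c \<odot> (f w \<odot> wv w))"
    using cl smult_assoc1[of c] by (intro M.finsum_cong') (auto simp: free_simps sm_closed)
  also have "\<dots> = c \<odot> ev f"
    unfolding ev_def using cl W by (subst finsum_smult_ldistr) (auto simp: sm_closed)
  finally show ?thesis .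
qed

lemma ev_delta: assumes w: "w \<in> words" shows "ev (wdelta w) = wv w"
proof -
  have "{u. wdelta w u \<noteq> 0} = {w}" by (auto simp: wdelta_def)
  then have "ev (wdelta w) = (\<Oplus>u\<in>{w}. wdelta w u \<odot> wv u)" by (simp add: ev_def)
  also have "\<dots> = wv w"
    using smult_one[OF wv_closed[OF w]] wv_closed[OF w] by (simp add: M.finsum_insert wdelta_def)
  finally show ?thesis .
qed

lemma ev_gen: "g \<in> G \<Longrightarrow> ev (free_gen g) = T g"
  using ev_delta[of "[(g, False)]"] by (simp add: wdelta_gen words_def)

lemma ev_zero: "ev (\<lambda>w. 0) = \<zero>"
  by (simp add: ev_def)

lemma zero_mult: "x \<in> carrier B \<Longrightarrow> \<zero> \<otimes> x = \<zero>" "x \<in> carrier B \<Longrightarrow> x \<otimes> \<zero> = \<zero>"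
  using mult_smult_left[of \<zero> x 0] mult_smult_right[of x \<zero> 0] smult_l_null smult_r_null[of 0] mult_closed[of \<zero> x] mult_closed[of x \<zero>] by auto

lemma ev_star: assumes f: "f \<in> carrier (free_star_alg G)"
  shows "ev (star (free_star_alg G) f) = star B (ev f)"
  using f
proof (induction rule: free_lin_induct)
  case 1
  have "star B \<zero> = \<zero>" using star_smult[of \<zero> 0] smult_r_null[of 0] smult_l_null[OF star_closed[of \<zero>]] by simp
  then show ?case by (simp add: free_simps ev_zero)
next
  case (2 w)
  then have w: "w \<in> words" by (simp add: words_def)
  show ?case unfolding wdelta_star using ev_delta[OF w] ev_delta[OF wstar_words[OF w]] wv_star[OF w] by simp
next
  case (3 f g)
  then show ?case
    by (simp add: star_algebra.star_add[OF star_algebra_free] ev_add ev_closed star_add free_star_closed)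
next
  case (4 c f)
  then show ?case
    by (simp add: star_algebra.star_smult[OF star_algebra_free] ev_smult ev_closed star_smult free_star_closed)
qed

lemma ev_mult_delta:
  assumes w: "w \<in> words" and g: "g \<in> carrier (free_star_alg G)"
  shows "ev (wdelta w \<otimes>\<^bsub>free_star_alg G\<^esub> g) = wv w \<otimes> ev g"
proof -
  have dw: "wdelta w \<in> carrier (free_star_alg G)" using w by (simp add: words_def wdelta_carrier)
  note wc = wv_closed[OF w]
  show ?thesis using g
  proof (induction rule: free_lin_induct)
    case 1
    then show ?case using wc by (simp add: free_simps ev_zero zero_mult)
  next
    case (2 v)
    then have v: "v \<in> words" by (simp add: words_def)
    then have "w @ v \<in> words" using w by (auto simp: words_def)
    then show ?case using ev_delta v w wv_append by (simp add: wdelta_mult)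
  next
    case (3 f g)
    then show ?case using dw wc
      by (simp add: star_algebra.mult_r_distr[OF star_algebra_free] ev_add ev_closed free_mult_closed mult_r_distr)
  next
    case (4 c f)
    then show ?case using dw wc
      by (simp add: star_algebra.mult_smult_right[OF star_algebra_free] ev_smult ev_closed free_mult_closed mult_smult_right)
  qed
qed

lemma ev_mult:
  assumes f: "f \<in> carrier (free_star_alg G)" and g: "g \<in> carrier (free_star_alg G)"
  shows "ev (f \<otimes>\<^bsub>free_star_alg G\<^esub> g) = ev f \<otimes> ev g"
  using f
proof (induction rule: free_lin_induct)
  case 1
  then show ?case using ev_closed[OF g] by (simp add: free_simps ev_zero zero_mult)
next
  case (2 w)
  then have w: "w \<in> words" by (simp add: words_def)
  show ?case using ev_mult_delta[OF w g] ev_delta[OF w] by simp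
next
  case (3 f f')
  then show ?case using g
    by (simp add: star_algebra.mult_l_distr[OF star_algebra_free] ev_add ev_closed free_mult_closed mult_l_distr)
next
  case (4 c f)
  then show ?case using g
    by (simp add: star_algebra.mult_smult_left[OF star_algebra_free] ev_smult ev_closed free_mult_closed mult_smult_left)
qed

lemma ev_hom: "star_hom (free_star_alg G) B ev"
  by (simp add: star_hom_def ev_closed ev_add ev_smult ev_mult ev_star)

end

lemma kgraph_cstar_universal:
  assumes k: "k_graph \<Lambda>" and B: "cstar_algebra B" and T: "ck_family \<Lambda> B T"
  shows "\<exists>\<phi>. star_hom (kgraph_cstar \<Lambda>) B \<phi> \<and> (\<forall>\<kappa> \<in> Mor \<Lambda>. \<phi> (kgraph_gen \<Lambda> \<kappa>) = T \<kappa>)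
    \<and> (\<forall>x \<in> carrier (kgraph_cstar \<Lambda>). nrm B (\<phi> x) \<le> nrm (kgraph_cstar \<Lambda>) x)"
proof -
  interpret U: cstar_seminormed "path_alg \<Lambda>" "universal_seminorm \<Lambda>" by (rule universal_seminormed[OF k])
  interpret B: cstar_algebra B by (rule B)
  interpret BN: cstar_seminormed B "nrm B"
    by (intro cstar_seminormed.intro cstar_seminormed_axioms.intro B.star_algebra_axioms B.cstar_norm)
  interpret E: free_eval B "Mor \<Lambda>" T
    by (intro free_eval.intro free_eval_axioms.intro B.star_algebra_axioms) (use T in \<open>auto simp: ck_family_def\<close>)
  interpret EP: star_hom_pair "path_alg \<Lambda>" B E.ev
    by (intro star_hom_pair.intro star_hom_pair_axioms.intro U.star_algebra_axioms B.star_algebra_axioms E.ev_hom)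
  note evc = E.ev_closed
  have "ck_seminorm \<Lambda> (\<lambda>x. nrm B (E.ev x))"
    unfolding ck_seminorm_def
  proof
    show "cstar_seminorm (path_alg \<Lambda>) (\<lambda>x. nrm B (E.ev x))"
      by (simp add: cstar_seminorm_def evc E.ev_add E.ev_smult E.ev_mult E.ev_star
           BN.sn_nonneg BN.sn_tri BN.sn_scale BN.sn_mult BN.sn_cstar)
    have "nrm B (E.ev (x \<ominus>\<^bsub>path_alg \<Lambda>\<^esub> y)) = 0" if r: "(x, y) \<in> ck_relations \<Lambda> (path_alg \<Lambda>) free_gen" for x y
    proof -
      have "(E.ev x, E.ev y) \<in> ck_relations \<Lambda> B T"
        by (rule EP.ck_rel_image[OF k free_gen_carrier E.ev_gen r])
      then have "E.ev x = E.ev y" using T by (auto simp: ck_family_def)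
      then show ?thesis using ck_rel_closed_free[OF k r] EP.hom_minus BN.sn_minus_self evc by simp
    qed
    then show "\<forall>(x, y)\<in>ck_relations \<Lambda> (path_alg \<Lambda>) free_gen. nrm B (E.ev (x \<ominus>\<^bsub>path_alg \<Lambda>\<^esub> y)) = 0" by auto
  qed
  then have le: "nrm B (E.ev x) \<le> universal_seminorm \<Lambda> x" if "x \<in> carrier (path_alg \<Lambda>)" for x
    using universal_upper[OF k that] by blast
  define Lm where "Lm X b \<longleftrightarrow> b \<in> carrier B \<and> (\<lambda>n. nrm B (E.ev (X n) \<ominus>\<^bsub>B\<^esub> b)) \<longlonglongrightarrow> 0" for X b
  have Lmc: "b \<in> carrier B" if "Lm X b" for X b using that by (simp add: Lm_def)
  have Lml: "(\<lambda>n. nrm B (E.ev (X n) \<ominus>\<^bsub>B\<^esub> b)) \<longlonglongrightarrow> 0" if "Lm X b" for X b using that by (simp add: Lm_def)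
  have ex: "\<exists>b. Lm X b" if X: "X \<in> U.CS" for X
  proof -
    have "seminorm_Cauchy B (nrm B) (\<lambda>n. E.ev (X n))"
      unfolding seminorm_Cauchy_def
    proof (intro conjI allI impI)
      fix e :: real assume "e > 0"
      from U.CS_D[OF X this] obtain N where N: "\<And>m n. m \<ge> N \<Longrightarrow> n \<ge> N \<Longrightarrow> universal_seminorm \<Lambda> (X m \<ominus>\<^bsub>path_alg \<Lambda>\<^esub> X n) < e" by auto
      have "nrm B (E.ev (X m) \<ominus>\<^bsub>B\<^esub> E.ev (X n)) < e" if "m \<ge> N" "n \<ge> N" for m n
        using le_less_trans[OF le N[OF that]] U.CS_carrier[OF X] by (simp add: EP.hom_minus)
      then show "\<exists>N. \<forall>m\<ge>N. \<forall>n\<ge>N. nrm B (E.ev (X m) \<ominus>\<^bsub>B\<^esub> E.ev (X n)) < e" by blast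
    qed (use U.CS_carrier[OF X] evc in auto)
    from B.complete[OF this] show ?thesis by (auto simp: Lm_def)
  qed
  have uniq: "b = b'" if X: "X \<in> U.CS" "X' \<in> U.CS" "U.cls X = U.cls X'" "Lm X b" "Lm X' b'" for X X' b b'
  proof -
    note c = U.CS_carrier[OF X(1)] U.CS_carrier[OF X(2)] Lmc[OF X(4)] Lmc[OF X(5)]
    have d: "(\<lambda>n. universal_seminorm \<Lambda> (X n \<ominus>\<^bsub>path_alg \<Lambda>\<^esub> X' n)) \<longlonglongrightarrow> 0" using X U.cls_eq by blast
    have "(\<lambda>n. nrm B (b \<ominus>\<^bsub>B\<^esub> b')) \<longlonglongrightarrow> 0"
    proof (rule U.tendsto0_le[OF tendsto_add_zero[OF tendsto_add_zero[OF Lml[OF X(4)] d] Lml[OF X(5)]]])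
      fix n
      have "nrm B (b \<ominus>\<^bsub>B\<^esub> b') \<le> nrm B (b \<ominus>\<^bsub>B\<^esub> E.ev (X n)) + nrm B (E.ev (X n) \<ominus>\<^bsub>B\<^esub> b')"
        using BN.sn_dist_tri c evc by blast
      moreover have "nrm B (E.ev (X n) \<ominus>\<^bsub>B\<^esub> b') \<le> nrm B (E.ev (X n) \<ominus>\<^bsub>B\<^esub> E.ev (X' n)) + nrm B (E.ev (X' n) \<ominus>\<^bsub>B\<^esub> b')"
        using BN.sn_dist_tri c evc by blast
      moreover have "nrm B (E.ev (X n) \<ominus>\<^bsub>B\<^esub> E.ev (X' n)) \<le> universal_seminorm \<Lambda> (X n \<ominus>\<^bsub>path_alg \<Lambda>\<^esub> X' n)"
        using le[of "X n \<ominus>\<^bsub>path_alg \<Lambda>\<^esub> X' n"] c EP.hom_minus by simp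
      moreover have "nrm B (b \<ominus>\<^bsub>B\<^esub> E.ev (X n)) = nrm B (E.ev (X n) \<ominus>\<^bsub>B\<^esub> b)"
        using BN.sn_minus_comm c evc by blast
      ultimately show "nrm B (b \<ominus>\<^bsub>B\<^esub> b') \<le> nrm B (E.ev (X n) \<ominus>\<^bsub>B\<^esub> b) + universal_seminorm \<Lambda> (X n \<ominus>\<^bsub>path_alg \<Lambda>\<^esub> X' n) + nrm B (E.ev (X' n) \<ominus>\<^bsub>B\<^esub> b')"
        by linarith
    qed (use c BN.sn_nonneg in simp)
    then have 0: "nrm B (b \<ominus>\<^bsub>B\<^esub> b') = 0" by (simp add: LIMSEQ_const_iff)
    have "b \<ominus>\<^bsub>B\<^esub> b' = \<zero>\<^bsub>B\<^esub>" by (rule B.nrm_definite[OF _ 0]) (use c in simp)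
    then have 1: "b \<oplus>\<^bsub>B\<^esub> \<ominus>\<^bsub>B\<^esub> b' = \<zero>\<^bsub>B\<^esub>" by (simp only: a_minus_def)
    have "\<ominus>\<^bsub>B\<^esub> (\<ominus>\<^bsub>B\<^esub> b') = b"
      by (rule B.M.minus_equality[OF 1 B.M.a_inv_closed[OF c(4)] c(3)])
    then show ?thesis unfolding B.M.minus_minus[OF c(4)] by (rule HOL.sym)
  qed
  define \<phi> where "\<phi> P = (SOME b. \<exists>X \<in> U.CS. P = U.cls X \<and> Lm X b)" for P
  have \<phi>: "\<phi> (U.cls X) = b" if X: "X \<in> U.CS" "Lm X b" for X b
  proof -
    have "\<exists>b. \<exists>X'\<in>U.CS. U.cls X = U.cls X' \<and> Lm X' b" using X by blast
    from someI_ex[OF this] obtain X' where "X' \<in> U.CS" "U.cls X = U.cls X'" "Lm X' (\<phi> (U.cls X))"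
      unfolding \<phi>_def by blast
    then show ?thesis using uniq X by blast
  qed
  have Lm_add: "Lm (\<lambda>n. X n \<oplus>\<^bsub>path_alg \<Lambda>\<^esub> Y n) (b \<oplus>\<^bsub>B\<^esub> c)" if X: "X \<in> U.CS" "Lm X b" and Y: "Y \<in> U.CS" "Lm Y c" for X Y b c
  proof -
    note cc = U.CS_carrier[OF X(1)] U.CS_carrier[OF Y(1)] Lmc[OF X(2)] Lmc[OF Y(2)]
    have "(\<lambda>n. nrm B (E.ev (X n \<oplus>\<^bsub>path_alg \<Lambda>\<^esub> Y n) \<ominus>\<^bsub>B\<^esub> (b \<oplus>\<^bsub>B\<^esub> c))) \<longlonglongrightarrow> 0"
      by (rule U.tendsto0_le[OF tendsto_add_zero[OF Lml[OF X(2)] Lml[OF Y(2)]]])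
         (use cc evc in \<open>auto simp: E.ev_add BN.add_minus_add intro!: BN.sn_tri BN.sn_nonneg\<close>)
    then show ?thesis using cc by (simp add: Lm_def)
  qed
  have Lm_smult: "Lm (\<lambda>n. a \<odot>\<^bsub>path_alg \<Lambda>\<^esub> X n) (a \<odot>\<^bsub>B\<^esub> b)" if X: "X \<in> U.CS" "Lm X b" for X b a
    using U.CS_carrier[OF X(1)] Lmc[OF X(2)] evc tendsto_mult_right_zero[OF Lml[OF X(2)], of "cmod a"]
    by (simp add: Lm_def E.ev_smult BN.smult_minus BN.sn_scale)
  have Lm_star: "Lm (\<lambda>n. star (path_alg \<Lambda>) (X n)) (star B b)" if X: "X \<in> U.CS" "Lm X b" for X b
    using U.CS_carrier[OF X(1)] Lmc[OF X(2)] evc Lml[OF X(2)]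
    by (simp add: Lm_def E.ev_star BN.star_minus BN.sn_star)
  have Lm_mult: "Lm (\<lambda>n. X n \<otimes>\<^bsub>path_alg \<Lambda>\<^esub> Y n) (b \<otimes>\<^bsub>B\<^esub> c)" if X: "X \<in> U.CS" "Lm X b" and Y: "Y \<in> U.CS" "Lm Y c" for X Y b c
  proof -
    note cc = U.CS_carrier[OF X(1)] U.CS_carrier[OF Y(1)] Lmc[OF X(2)] Lmc[OF Y(2)]
    obtain K where K: "\<And>n. universal_seminorm \<Lambda> (Y n) \<le> K" using U.CS_bounded[OF Y(1)] by auto
    have K': "nrm B (E.ev (Y n)) \<le> K" for n by (rule order_trans[OF le[OF cc(2)] K])
    have "(\<lambda>n. nrm B (E.ev (X n \<otimes>\<^bsub>path_alg \<Lambda>\<^esub> Y n) \<ominus>\<^bsub>B\<^esub> b \<otimes>\<^bsub>B\<^esub> c)) \<longlonglongrightarrow> 0"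
    proof (rule U.tendsto0_le[OF tendsto_add_zero[OF tendsto_mult_left_zero[OF Lml[OF X(2)], of K]
          tendsto_mult_right_zero[OF Lml[OF Y(2)], of "nrm B b"]]])
      fix n
      have "nrm B (E.ev (X n) \<otimes>\<^bsub>B\<^esub> E.ev (Y n) \<ominus>\<^bsub>B\<^esub> b \<otimes>\<^bsub>B\<^esub> c)
        \<le> nrm B (E.ev (X n) \<ominus>\<^bsub>B\<^esub> b) * nrm B (E.ev (Y n)) + nrm B b * nrm B (E.ev (Y n) \<ominus>\<^bsub>B\<^esub> c)"
        by (rule BN.sn_mult_minus[OF evc[OF cc(1)] evc[OF cc(2)] cc(3,4)])
      also have "\<dots> \<le> nrm B (E.ev (X n) \<ominus>\<^bsub>B\<^esub> b) * K + nrm B b * nrm B (E.ev (Y n) \<ominus>\<^bsub>B\<^esub> c)"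
        by (intro add_right_mono mult_left_mono K' BN.sn_nonneg B.M.minus_closed evc cc)
      finally show "nrm B (E.ev (X n \<otimes>\<^bsub>path_alg \<Lambda>\<^esub> Y n) \<ominus>\<^bsub>B\<^esub> b \<otimes>\<^bsub>B\<^esub> c)
        \<le> nrm B (E.ev (X n) \<ominus>\<^bsub>B\<^esub> b) * K + nrm B b * nrm B (E.ev (Y n) \<ominus>\<^bsub>B\<^esub> c)"
        unfolding E.ev_mult[OF cc(1,2)] .
      show "0 \<le> nrm B (E.ev (X n \<otimes>\<^bsub>path_alg \<Lambda>\<^esub> Y n) \<ominus>\<^bsub>B\<^esub> b \<otimes>\<^bsub>B\<^esub> c)"
        by (intro BN.sn_nonneg B.M.minus_closed evc cc B.mult_closed U.mult_closed)
    qed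
    then show ?thesis using cc by (simp add: Lm_def)
  qed
  have cases: "\<exists>X b. X \<in> U.CS \<and> P = U.cls X \<and> Lm X b" if "P \<in> carrier U.C" for P
    using U.C_cases[OF that] ex by blast
  have "star_hom U.C B \<phi>"
    unfolding star_hom_def
  proof (intro conjI ballI allI)
    fix P assume "P \<in> carrier U.C"
    then obtain X b where X: "X \<in> U.CS" "P = U.cls X" "Lm X b" using cases by blast
    show "\<phi> P \<in> carrier B" using \<phi>[OF X(1,3)] X(2) Lmc[OF X(3)] by simp
    show "\<phi> (a \<odot>\<^bsub>U.C\<^esub> P) = a \<odot>\<^bsub>B\<^esub> \<phi> P" for a
      using \<phi>[OF U.CS_smult[OF X(1)] Lm_smult[OF X(1,3)]] \<phi>[OF X(1,3)] X by (simp add: U.C_smult)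
    show "\<phi> (star U.C P) = star B (\<phi> P)"
      using \<phi>[OF U.CS_star[OF X(1)] Lm_star[OF X(1,3)]] \<phi>[OF X(1,3)] X by (simp add: U.C_star)
    fix Q assume "Q \<in> carrier U.C"
    then obtain Y c where Y: "Y \<in> U.CS" "Q = U.cls Y" "Lm Y c" using cases by blast
    show "\<phi> (P \<oplus>\<^bsub>U.C\<^esub> Q) = \<phi> P \<oplus>\<^bsub>B\<^esub> \<phi> Q"
      using \<phi>[OF U.CS_add[OF X(1) Y(1)] Lm_add[OF X(1,3) Y(1,3)]] \<phi>[OF X(1,3)] \<phi>[OF Y(1,3)] X Y by (simp add: U.C_add)
    show "\<phi> (P \<otimes>\<^bsub>U.C\<^esub> Q) = \<phi> P \<otimes>\<^bsub>B\<^esub> \<phi> Q"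
      using \<phi>[OF U.CS_mult[OF X(1) Y(1)] Lm_mult[OF X(1,3) Y(1,3)]] \<phi>[OF X(1,3)] \<phi>[OF Y(1,3)] X Y by (simp add: U.C_mult)
  qed
  moreover have "\<phi> (kgraph_gen \<Lambda> \<kappa>) = T \<kappa>" if \<kappa>: "\<kappa> \<in> Mor \<Lambda>" for \<kappa>
  proof -
    note g = free_gen_carrier[OF \<kappa>]
    have "Lm (\<lambda>n. free_gen \<kappa>) (T \<kappa>)"
      using E.ev_gen[OF \<kappa>] evc[OF g] BN.sn_minus_self by (simp add: Lm_def)
    from \<phi>[OF U.CS_const[OF g] this] show ?thesis by (simp add: kgraph_gen_emb[OF k] U.emb_def)
  qed
  moreover have "nrm B (\<phi> P) \<le> nrm U.C P" if P: "P \<in> carrier U.C" for P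
  proof -
    obtain X b where X: "X \<in> U.CS" "P = U.cls X" "Lm X b" using cases[OF P] by blast
    note cc = U.CS_carrier[OF X(1)] Lmc[OF X(3)]
    have "(\<lambda>n. universal_seminorm \<Lambda> (X n) + nrm B (E.ev (X n) \<ominus>\<^bsub>B\<^esub> b)) \<longlonglongrightarrow> nrm U.C P + 0"
      using tendsto_add[OF U.C_nrm[OF X(1)] Lml[OF X(3)]] X(2) by simp
    moreover have "nrm B b \<le> universal_seminorm \<Lambda> (X n) + nrm B (E.ev (X n) \<ominus>\<^bsub>B\<^esub> b)" for n
      using BN.sn_abs_diff[OF evc[OF cc(1)] cc(2), of n] le[OF cc(1), of n] by linarith
    ultimately have "nrm B b \<le> nrm U.C P + 0" by (intro LIMSEQ_le_const) auto
    then show ?thesis using \<phi>[OF X(1,3)] X(2) by simp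
  qed
  ultimately show ?thesis unfolding kgraph_cstar_def by blast
qed

end

theory Submission
  imports Defs "HOL-Analysis.L2_Norm" "HOL-Analysis.Uniform_Limit" "HOL-Analysis.Elementary_Normed_Spaces"
begin

text \<open>
  Let \<open>(\<mu>, \<nu>)\<close> be a generalized cycle with source \<open>v\<close> and \<open>l = d(\<mu>) \<or> d(\<nu>)\<close>. Expanding \<open>v(d(\<mu>))\<close> and
  \<open>v(d(\<nu>))\<close> to level \<open>l\<close>, the map \<open>\<tau> \<mapsto> \<sigma>\<close> with \<open>\<mu>\<tau> = \<nu>\<sigma>\<close> embeds the first expansion into the second, whence
  \<open>v(d(\<mu>)) \<le> v(d(\<nu>))\<close>; without an entrance the two are equal. Conversely, an atom is of the form \<open>v(n)\<close>
  with exactly one path of each degree from \<open>v\<close>, and periodicity yields two such paths \<open>\<alpha>\<close>, \<open>\<beta>\<close> with the same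
  source and different degrees.

  In that case there is exactly one infinite path \<open>x\<close> from \<open>v\<close>. In the representation on the infinite path
  space twisted by the gauge action at \<open>z\<close>, the element \<open>S\<^sub>\<alpha> S\<^sub>\<beta>\<^sup>*\<close> acts as a nontrivial power of \<open>z\<close> times the
  projection onto the line of \<open>x\<close>. An element close to \<open>S\<^sub>\<alpha> S\<^sub>\<beta>\<^sup>*\<close> therefore has, in each of these
  representations, a unique eigenvalue close to that number, depending continuously on \<open>z\<close>. If the element
  lay in a finite-dimensional subalgebra, all these eigenvalues would be roots of a single polynomial, so that
  the eigenvalue would be constant, which is absurd.
\<close>

text \<open>The talented monoid is a quotient, so an equality of classes has to be read back on
  representatives. Expansion to one high common level (\<open>flow\<close>) is an invariant of the
  congruence; it replaces a confluence argument and turns periodicity into a statement about two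
  paths.

  For AF-ness a single representation would not do: an element of a finite-dimensional algebra may
  well have an eigenvalue near a prescribed number of modulus 1. The parameter z provides the
  contradiction: a linear dependence among the powers of the approximating element has coefficients
  independent of z, while its eigenvalue stays within 1/5 of a power of z that takes antipodal
  values, at distance 2. The twist uses one coordinate in which the degrees of \<alpha> and \<beta>
  differ, so that this power is nontrivial.

  No spectral theory and no Hilbert space completion enter. Only the functionals x -> <\<pi>(x)e, e>
  are used, with e the basis vector at the infinite path. The universal seminorm dominates every
  C*-seminorm that respects the relations, so operators on finitely supported functions suffice. An
  approximation within 1/10 makes the differences in the power iteration halve.\<close>

section \<open>Paths and their initial segments\<close>

context k_graph
begin

abbreviation int_deg :: "('k \<Rightarrow> nat) \<Rightarrow> 'k \<Rightarrow> int" where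
  "int_deg n \<equiv> (\<lambda>i. int (n i))"

lemma paths_from_deg_iff:
  "\<kappa> \<in> paths_from_deg \<Lambda> v n \<longleftrightarrow> \<kappa> \<in> Mor \<Lambda> \<and> rng \<Lambda> \<kappa> = v \<and> deg \<Lambda> \<kappa> = n"
  by (auto simp: paths_from_deg_def paths_from_def)

text \<open>The axiom \<open>factorization\<close> prescribes both degrees; the degree of the second
  factor is recovered by cancellation in the degrees.\<close>

lemma factor_unique:
  assumes "\<alpha> \<in> Mor \<Lambda>" "\<beta> \<in> Mor \<Lambda>" "src \<Lambda> \<alpha> = rng \<Lambda> \<beta>"
    and "\<alpha>' \<in> Mor \<Lambda>" "\<beta>' \<in> Mor \<Lambda>" "src \<Lambda> \<alpha>' = rng \<Lambda> \<beta>'"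
    and "pcomp \<Lambda> \<alpha> \<beta> = pcomp \<Lambda> \<alpha>' \<beta>'" "deg \<Lambda> \<alpha> = deg \<Lambda> \<alpha>'"
  shows "\<alpha> = \<alpha>'" "\<beta> = \<beta>'"
proof -
  have d: "deg \<Lambda> (pcomp \<Lambda> \<alpha> \<beta>) = deg \<Lambda> \<alpha> + deg \<Lambda> \<beta>"
    by (rule deg_pcomp[OF assms(1-3)])
  have "deg \<Lambda> \<alpha> + deg \<Lambda> \<beta> = deg \<Lambda> \<alpha> + deg \<Lambda> \<beta>'"
    using deg_pcomp[OF assms(4-6)] d unfolding assms(7,8) by simp
  then have d': "deg \<Lambda> \<beta>' = deg \<Lambda> \<beta>" by (simp add: fun_eq_iff)
  have "(\<alpha>, \<beta>) = (\<alpha>', \<beta>')"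
    by (rule ex1E[OF factorization[OF pcomp_closed d]]) (use assms d' in \<open>auto simp: split_paired_all\<close>)
  then show "\<alpha> = \<alpha>'" "\<beta> = \<beta>'" by auto
qed

lemma factor_exists:
  assumes "\<kappa> \<in> Mor \<Lambda>" "n \<le> deg \<Lambda> \<kappa>"
  obtains \<alpha> \<beta> where "\<alpha> \<in> Mor \<Lambda>" "\<beta> \<in> Mor \<Lambda>" "deg \<Lambda> \<alpha> = n" "deg \<Lambda> \<beta> = deg \<Lambda> \<kappa> - n"
    "src \<Lambda> \<alpha> = rng \<Lambda> \<beta>" "\<kappa> = pcomp \<Lambda> \<alpha> \<beta>"
proof -
  have "deg \<Lambda> \<kappa> = n + (deg \<Lambda> \<kappa> - n)" using assms(2) by (auto simp: le_fun_def)
  from factorization[OF assms(1) this] show ?thesis using that by auto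
qed

definition is_prefix :: "'m \<Rightarrow> 'm \<Rightarrow> bool" where
  "is_prefix \<alpha> \<kappa> \<longleftrightarrow> \<alpha> \<in> Mor \<Lambda> \<and> (\<exists>\<beta> \<in> Mor \<Lambda>. src \<Lambda> \<alpha> = rng \<Lambda> \<beta> \<and> \<kappa> = pcomp \<Lambda> \<alpha> \<beta>)"

lemma is_prefixI:
  "\<lbrakk>\<alpha> \<in> Mor \<Lambda>; \<beta> \<in> Mor \<Lambda>; src \<Lambda> \<alpha> = rng \<Lambda> \<beta>\<rbrakk> \<Longrightarrow> is_prefix \<alpha> (pcomp \<Lambda> \<alpha> \<beta>)"
  by (auto simp: is_prefix_def)

lemma is_prefix_refl: "\<kappa> \<in> Mor \<Lambda> \<Longrightarrow> is_prefix \<kappa> \<kappa>"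
  using is_prefixI[of \<kappa> "ident \<Lambda> (src \<Lambda> \<kappa>)"]
  by (simp add: ident_closed src_closed rng_ident pcomp_ident_right)

lemma is_prefix_Mor: "is_prefix \<alpha> \<kappa> \<Longrightarrow> \<alpha> \<in> Mor \<Lambda>" "is_prefix \<alpha> \<kappa> \<Longrightarrow> \<kappa> \<in> Mor \<Lambda>"
  by (auto simp: is_prefix_def pcomp_closed)

lemma is_prefix_rng: "is_prefix \<alpha> \<kappa> \<Longrightarrow> rng \<Lambda> \<alpha> = rng \<Lambda> \<kappa>"
  by (auto simp: is_prefix_def rng_pcomp)

lemma is_prefix_trans: "is_prefix \<alpha> \<beta> \<Longrightarrow> is_prefix \<beta> \<kappa> \<Longrightarrow> is_prefix \<alpha> \<kappa>"
  by (auto simp: is_prefix_def pcomp_assoc src_pcomp rng_pcomp intro!: bexI[OF _ pcomp_closed])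

lemma is_prefix_exists:
  assumes "\<kappa> \<in> Mor \<Lambda>" "n \<le> deg \<Lambda> \<kappa>"
  obtains \<alpha> where "is_prefix \<alpha> \<kappa>" "deg \<Lambda> \<alpha> = n"
  using factor_exists[OF assms] is_prefixI by metis

lemma is_prefix_unique:
  "\<lbrakk>is_prefix \<alpha> \<kappa>; is_prefix \<beta> \<kappa>; deg \<Lambda> \<alpha> = deg \<Lambda> \<beta>\<rbrakk> \<Longrightarrow> \<alpha> = \<beta>"
  unfolding is_prefix_def using factor_unique(1) by metis

lemma is_prefix_pcomp:
  "\<lbrakk>\<kappa> \<in> Mor \<Lambda>; is_prefix \<alpha> \<beta>; src \<Lambda> \<kappa> = rng \<Lambda> \<beta>\<rbrakk> \<Longrightarrow> is_prefix (pcomp \<Lambda> \<kappa> \<alpha>) (pcomp \<Lambda> \<kappa> \<beta>)"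
  by (auto simp: is_prefix_def pcomp_closed src_pcomp rng_pcomp pcomp_assoc)

lemma is_prefix_of_prefixes:
  assumes "is_prefix \<alpha> \<kappa>" "is_prefix \<beta> \<kappa>" "deg \<Lambda> \<alpha> \<le> deg \<Lambda> \<beta>"
  shows "is_prefix \<alpha> \<beta>"
proof -
  obtain \<alpha>' where "is_prefix \<alpha>' \<beta>" "deg \<Lambda> \<alpha>' = deg \<Lambda> \<alpha>"
    using is_prefix_exists assms is_prefix_Mor by metis
  then show ?thesis using is_prefix_unique is_prefix_trans assms by metis
qed

lemma deg_zero_ident:
  assumes "\<kappa> \<in> Mor \<Lambda>" "deg \<Lambda> \<kappa> = 0"
  shows "\<kappa> = ident \<Lambda> (rng \<Lambda> \<kappa>)"
proof (rule is_prefix_unique[of _ \<kappa>])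
  show "is_prefix (ident \<Lambda> (rng \<Lambda> \<kappa>)) \<kappa>"
    using is_prefixI[of "ident \<Lambda> (rng \<Lambda> \<kappa>)" \<kappa>] assms(1)
    by (simp add: ident_closed rng_closed src_ident pcomp_ident_left)
qed (use assms in \<open>simp_all add: is_prefix_refl deg_ident rng_closed\<close>)

text \<open>A segment starting at 0 has a first factor of degree 0, which is an identity. This
  allows \<open>is_prefix\<close> to be used in place of the definite description from here
  on.\<close>

lemma segment_prefix:
  assumes "\<kappa> \<in> Mor \<Lambda>" "is_prefix \<alpha> \<kappa>"
  shows "segment \<Lambda> \<kappa> 0 (deg \<Lambda> \<alpha>) = \<alpha>"
  unfolding segment_def
proof (rule the_equality)
  obtain \<gamma> where \<gamma>: "\<alpha> \<in> Mor \<Lambda>" "\<gamma> \<in> Mor \<Lambda>" "src \<Lambda> \<alpha> = rng \<Lambda> \<gamma>" "\<kappa> = pcomp \<Lambda> \<alpha> \<gamma>"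
    using assms(2) by (auto simp: is_prefix_def)
  then show "\<exists>\<alpha>' \<gamma>. \<alpha>' \<in> Mor \<Lambda> \<and> \<alpha> \<in> Mor \<Lambda> \<and> \<gamma> \<in> Mor \<Lambda> \<and> deg \<Lambda> \<alpha>' = 0 \<and> deg \<Lambda> \<alpha> = deg \<Lambda> \<alpha> - 0 \<and>
      deg \<Lambda> \<gamma> = deg \<Lambda> \<kappa> - deg \<Lambda> \<alpha> \<and> src \<Lambda> \<alpha>' = rng \<Lambda> \<alpha> \<and> src \<Lambda> \<alpha> = rng \<Lambda> \<gamma> \<and> \<kappa> = pcomp \<Lambda> \<alpha>' (pcomp \<Lambda> \<alpha> \<gamma>)"
    using pcomp_ident_left[OF assms(1)]
    by (intro exI[of _ "ident \<Lambda> (rng \<Lambda> \<kappa>)"] exI[of _ \<gamma>])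
       (auto simp: ident_closed rng_closed deg_ident src_ident deg_pcomp rng_pcomp)
next
  fix \<beta> assume "\<exists>\<alpha>' \<gamma>. \<alpha>' \<in> Mor \<Lambda> \<and> \<beta> \<in> Mor \<Lambda> \<and> \<gamma> \<in> Mor \<Lambda> \<and> deg \<Lambda> \<alpha>' = 0 \<and> deg \<Lambda> \<beta> = deg \<Lambda> \<alpha> - 0 \<and>
      deg \<Lambda> \<gamma> = deg \<Lambda> \<kappa> - deg \<Lambda> \<alpha> \<and> src \<Lambda> \<alpha>' = rng \<Lambda> \<beta> \<and> src \<Lambda> \<beta> = rng \<Lambda> \<gamma> \<and> \<kappa> = pcomp \<Lambda> \<alpha>' (pcomp \<Lambda> \<beta> \<gamma>)"
  then obtain \<alpha>' \<gamma> where *: "\<alpha>' \<in> Mor \<Lambda>" "\<beta> \<in> Mor \<Lambda>" "\<gamma> \<in> Mor \<Lambda>" "deg \<Lambda> \<alpha>' = 0" "deg \<Lambda> \<beta> = deg \<Lambda> \<alpha>"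
     "src \<Lambda> \<alpha>' = rng \<Lambda> \<beta>" "src \<Lambda> \<beta> = rng \<Lambda> \<gamma>" "\<kappa> = pcomp \<Lambda> \<alpha>' (pcomp \<Lambda> \<beta> \<gamma>)" by auto
  have "\<alpha>' = ident \<Lambda> (rng \<Lambda> (pcomp \<Lambda> \<beta> \<gamma>))"
    using deg_zero_ident[OF *(1,4)] * by (metis rng_pcomp rng_closed src_ident)
  then have "\<kappa> = pcomp \<Lambda> \<beta> \<gamma>" using * by (simp add: pcomp_ident_left pcomp_closed)
  then have "is_prefix \<beta> \<kappa>" using * is_prefixI by metis
  then show "\<beta> = \<alpha>" using is_prefix_unique assms *(5) by blast
qed

text \<open>The degree of \<tau> dominates both degrees, so the initial segments in question exist
  and the description in \<open>segment\<close> is a genuine one.\<close>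

lemma MCE_iff:
  assumes "\<kappa> \<in> Mor \<Lambda>" "\<mu> \<in> Mor \<Lambda>"
  shows "\<tau> \<in> MCE \<Lambda> \<kappa> \<mu> \<longleftrightarrow> deg \<Lambda> \<tau> = sup (deg \<Lambda> \<kappa>) (deg \<Lambda> \<mu>) \<and> is_prefix \<kappa> \<tau> \<and> is_prefix \<mu> \<tau>"
proof -
  have p: "segment \<Lambda> \<tau> 0 (deg \<Lambda> \<alpha>) = \<alpha> \<longleftrightarrow> is_prefix \<alpha> \<tau>"
    if "\<tau> \<in> Mor \<Lambda>" "deg \<Lambda> \<alpha> \<le> deg \<Lambda> \<tau>" for \<alpha>
    using is_prefix_exists[OF that] segment_prefix[OF that(1)] by metis
  show ?thesis
    unfolding MCE_def using p is_prefix_Mor(2) by auto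
qed

text \<open>Unique factorization in the form in which sums over paths can be reindexed.\<close>

lemma bij_betw_pcomp:
  "bij_betw (\<lambda>(\<alpha>, \<beta>). pcomp \<Lambda> \<alpha> \<beta>)
     (SIGMA \<alpha>:paths_from_deg \<Lambda> v n. paths_from_deg \<Lambda> (src \<Lambda> \<alpha>) m) (paths_from_deg \<Lambda> v (n + m))"
  unfolding bij_betw_def
proof
  show "inj_on (\<lambda>(\<alpha>, \<beta>). pcomp \<Lambda> \<alpha> \<beta>) (SIGMA \<alpha>:paths_from_deg \<Lambda> v n. paths_from_deg \<Lambda> (src \<Lambda> \<alpha>) m)"
    by (rule inj_onI) (clarsimp simp: paths_from_deg_iff, metis factor_unique)
  show "(\<lambda>(\<alpha>, \<beta>). pcomp \<Lambda> \<alpha> \<beta>) ` (SIGMA \<alpha>:paths_from_deg \<Lambda> v n. paths_from_deg \<Lambda> (src \<Lambda> \<alpha>) m)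
      = paths_from_deg \<Lambda> v (n + m)"
  proof (intro equalityI subsetI)
    fix \<kappa> assume "\<kappa> \<in> paths_from_deg \<Lambda> v (n + m)"
    then have \<kappa>: "\<kappa> \<in> Mor \<Lambda>" "rng \<Lambda> \<kappa> = v" "deg \<Lambda> \<kappa> = n + m" by (auto simp: paths_from_deg_iff)
    have le: "n \<le> deg \<Lambda> \<kappa>" "deg \<Lambda> \<kappa> - n = m" using \<kappa>(3) by (auto simp: le_fun_def)
    from factor_exists[OF \<kappa>(1) le(1)] obtain \<alpha> \<beta> where
      "\<alpha> \<in> Mor \<Lambda>" "\<beta> \<in> Mor \<Lambda>" "deg \<Lambda> \<alpha> = n" "deg \<Lambda> \<beta> = m" "src \<Lambda> \<alpha> = rng \<Lambda> \<beta>" "\<kappa> = pcomp \<Lambda> \<alpha> \<beta>"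
      unfolding le(2) by blast
    then show "\<kappa> \<in> (\<lambda>(\<alpha>, \<beta>). pcomp \<Lambda> \<alpha> \<beta>) ` (SIGMA \<alpha>:paths_from_deg \<Lambda> v n. paths_from_deg \<Lambda> (src \<Lambda> \<alpha>) m)"
      using \<kappa> by (intro image_eqI[of _ _ "(\<alpha>, \<beta>)"]) (auto simp: paths_from_deg_iff rng_pcomp)
  qed (auto simp: paths_from_deg_iff pcomp_closed rng_pcomp deg_pcomp)
qed

end

section \<open>Levels in the talented monoid\<close>

lemma image_mset_mset_set: "image_mset f (mset_set A) = (\<Sum>x\<in>A. {#f x#})"
  by (induction A rule: infinite_finite_induct) auto

locale row_finite_k_graph = k_graph \<Lambda> for \<Lambda> :: "('o, 'm, 'k::finite) kgraph" +
  assumes row_finite_no_sources: "row_finite_no_sources \<Lambda>"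
begin

lemma finite_paths_from_deg: "v \<in> Obj \<Lambda> \<Longrightarrow> finite (paths_from_deg \<Lambda> v n)"
  and paths_from_deg_nonempty: "v \<in> Obj \<Lambda> \<Longrightarrow> paths_from_deg \<Lambda> v n \<noteq> {}"
  using row_finite_no_sources by (auto simp: row_finite_no_sources_def)

lemma sum_paths_split:
  fixes f :: "'o \<Rightarrow> 'a::comm_monoid_add"
  assumes "v \<in> Obj \<Lambda>"
  shows "(\<Sum>\<kappa>\<in>paths_from_deg \<Lambda> v (n + m). f (src \<Lambda> \<kappa>)) =
    (\<Sum>\<alpha>\<in>paths_from_deg \<Lambda> v n. \<Sum>\<beta>\<in>paths_from_deg \<Lambda> (src \<Lambda> \<alpha>) m. f (src \<Lambda> \<beta>))"
proof -
  have "(\<Sum>\<alpha>\<in>paths_from_deg \<Lambda> v n. \<Sum>\<beta>\<in>paths_from_deg \<Lambda> (src \<Lambda> \<alpha>) m. f (src \<Lambda> \<beta>)) =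
    (\<Sum>(\<alpha>, \<beta>)\<in>(SIGMA \<alpha>:paths_from_deg \<Lambda> v n. paths_from_deg \<Lambda> (src \<Lambda> \<alpha>) m). f (src \<Lambda> \<beta>))"
    by (rule sum.Sigma) (auto simp: assms finite_paths_from_deg paths_from_deg_iff src_closed)
  also have "\<dots> = (\<Sum>p\<in>(SIGMA \<alpha>:paths_from_deg \<Lambda> v n. paths_from_deg \<Lambda> (src \<Lambda> \<alpha>) m).
      f (src \<Lambda> (case p of (\<alpha>, \<beta>) \<Rightarrow> pcomp \<Lambda> \<alpha> \<beta>)))"
    by (rule sum.cong) (auto simp: paths_from_deg_iff src_pcomp)
  also have "\<dots> = (\<Sum>\<kappa>\<in>paths_from_deg \<Lambda> v (n + m). f (src \<Lambda> \<kappa>))"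
    by (rule sum.reindex_bij_betw[OF bij_betw_pcomp])
  finally show ?thesis ..
qed

lemma paths_from_deg_zero: "v \<in> Obj \<Lambda> \<Longrightarrow> paths_from_deg \<Lambda> v 0 = {ident \<Lambda> v}"
  using deg_zero_ident by (auto simp: paths_from_deg_iff ident_closed rng_ident deg_ident)

lemma talented_cong_sum:
  "finite A \<Longrightarrow> (\<And>a. a \<in> A \<Longrightarrow> (f a, g a) \<in> talented_cong \<Lambda>) \<Longrightarrow> (sum f A, sum g A) \<in> talented_cong \<Lambda>"
  by (induction A rule: finite_induct) (auto intro: talented_add talented_refl simp: talented_free_def)

text \<open>The defining relations climb one unit vector at a time; induction on the coordinate sum
  of \<open>N\<close> combines them, with \<open>sum_paths_split\<close> merging the two
  stages.\<close>

lemma talented_cong_expand: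
  "v \<in> Obj \<Lambda> \<Longrightarrow>
    ({#(v, n)#}, \<Sum>\<alpha>\<in>paths_from_deg \<Lambda> v N. {#(src \<Lambda> \<alpha>, n + int_deg N)#}) \<in> talented_cong \<Lambda>"
proof (induction "sum N UNIV" arbitrary: v n N)
  case 0
  then have "N = 0" "n + int_deg N = n" by (auto simp: fun_eq_iff)
  then have "paths_from_deg \<Lambda> v N = {ident \<Lambda> v}" using paths_from_deg_zero[OF 0(2)] by metis
  with 0(2) \<open>n + int_deg N = n\<close> show ?case
    by (simp add: src_ident talented_free_def talented_refl)
next
  case (Suc s)
  then obtain i where i: "N i > 0" by (metis nat.distinct(1) neq0_conv sum.neutral)
  define N' where "N' = N - unit_deg i"
  have N: "N = unit_deg i + N'" using i by (auto simp: N'_def unit_deg_def fun_eq_iff)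
  have "sum (unit_deg i :: 'k \<Rightarrow> nat) UNIV = 1" by (simp add: unit_deg_def)
  then have s: "s = sum N' UNIV" using Suc.hyps(2) unfolding N by (simp add: sum.distrib)
  have u: "int_deg (unit_deg i) = unit_deg i" by (auto simp: unit_deg_def)
  have "({#(v, n)#}, \<Sum>\<alpha>\<in>paths_from_deg \<Lambda> v (unit_deg i). {#(src \<Lambda> \<alpha>, n + unit_deg i)#}) \<in> talented_cong \<Lambda>"
    using talented_expand[OF Suc.prems] by (simp add: image_mset_mset_set)
  moreover have "(\<Sum>\<alpha>\<in>paths_from_deg \<Lambda> v (unit_deg i). {#(src \<Lambda> \<alpha>, n + unit_deg i)#},
      \<Sum>\<alpha>\<in>paths_from_deg \<Lambda> v (unit_deg i). \<Sum>\<beta>\<in>paths_from_deg \<Lambda> (src \<Lambda> \<alpha>) N'.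
        {#(src \<Lambda> \<beta>, (n + unit_deg i) + int_deg N')#}) \<in> talented_cong \<Lambda>"
    by (intro talented_cong_sum Suc.hyps(1)[OF s] finite_paths_from_deg Suc.prems)
       (auto simp: paths_from_deg_iff src_closed)
  moreover have "(n + unit_deg i) + int_deg N' = n + int_deg N"
    unfolding N u[symmetric] by (simp add: fun_eq_iff)
  ultimately show ?case
    using talented_trans sum_paths_split[OF Suc.prems, of "\<lambda>v. {#(v, n + int_deg N)#}" "unit_deg i" N']
    by (simp add: N[symmetric])
qed

text \<open>Meaningful only if \<open>L\<close> lies above all levels occurring in \<open>M\<close>, as \<^const>\<open>nat\<close> truncates.\<close>

definition flow :: "('k \<Rightarrow> int) \<Rightarrow> ('o \<times> ('k \<Rightarrow> int)) multiset \<Rightarrow> 'o multiset" where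
  "flow L M = (\<Sum>(v, n)\<in>#M. \<Sum>\<alpha>\<in>paths_from_deg \<Lambda> v (\<lambda>i. nat (L i - n i)). {#src \<Lambda> \<alpha>#})"

text \<open>Once \<open>L\<close> lies above \<open>n + unit_deg i\<close>, a path from v up to
  level \<open>L\<close> factors through its initial edge in direction i, so both sides of a
  defining relation flow to the same multiset. Each use of transitivity or addition raises the
  threshold to a supremum.\<close>

lemma flow_cong:
  "(M, N) \<in> talented_cong \<Lambda> \<Longrightarrow> \<exists>L0. \<forall>L\<ge>L0. flow L M = flow L N"
proof (induction rule: talented_cong.induct)
  case (talented_expand v n i)
  have "flow L {#(v, n)#} = flow L (image_mset (\<lambda>\<alpha>. (src \<Lambda> \<alpha>, n + unit_deg i))
      (mset_set (paths_from_deg \<Lambda> v (unit_deg i))))" if L: "L \<ge> n + unit_deg i" for L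
  proof -
    have "nat (L j - n j) = unit_deg i j + nat (L j - (n + unit_deg i) j)" for j
      using le_funD[OF L, of j] by (auto simp: unit_deg_def)
    then have "(\<lambda>j. nat (L j - n j)) = unit_deg i + (\<lambda>j. nat (L j - (n + unit_deg i) j))"
      by (auto simp: fun_eq_iff)
    then show ?thesis
      using sum_paths_split[OF talented_expand, of "\<lambda>v. {#v#}" "unit_deg i" "\<lambda>j. nat (L j - (n + unit_deg i) j)"]
      by (simp add: flow_def multiset.map_comp comp_def sum_unfold_sum_mset[symmetric])
  qed
  then show ?case by blast
next
  case (talented_trans M N P)
  then obtain L1 L2 where "\<forall>L\<ge>L1. flow L M = flow L N" "\<forall>L\<ge>L2. flow L N = flow L P" by blast
  then have "\<forall>L\<ge>sup L1 L2. flow L M = flow L P" by simp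
  then show ?case by blast
next
  case (talented_add M N M' N')
  then obtain L1 L2 where "\<forall>L\<ge>L1. flow L M = flow L N" "\<forall>L\<ge>L2. flow L M' = flow L N'" by blast
  then have "\<forall>L\<ge>sup L1 L2. flow L (M + M') = flow L (N + N')" by (simp add: flow_def)
  then show ?case by blast
qed metis+

text \<open>Without sources no symbol expands to the empty multiset, so the zero class has only one
  representative. Finiteness matters as well: \<open>mset_set\<close> of an infinite set is
  empty.\<close>

lemma talented_cong_empty: "(M, N) \<in> talented_cong \<Lambda> \<Longrightarrow> M = {#} \<longleftrightarrow> N = {#}"
  by (induction rule: talented_cong.induct)
     (auto simp: mset_set_empty_iff finite_paths_from_deg paths_from_deg_nonempty)

section \<open>The talented monoid through representatives\<close>

abbreviation cls :: "('o \<times> ('k \<Rightarrow> int)) multiset \<Rightarrow> ('o \<times> ('k \<Rightarrow> int)) multiset set" where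
  "cls M \<equiv> talented_cong \<Lambda> `` {M}"

lemma cls_eq_iff:
  "M \<in> talented_free \<Lambda> \<Longrightarrow> N \<in> talented_free \<Lambda> \<Longrightarrow> cls M = cls N \<longleftrightarrow> (M, N) \<in> talented_cong \<Lambda>"
  by (rule eq_equiv_class_iff[OF equiv_talented])

lemma cls_carrier: "M \<in> talented_free \<Lambda> \<Longrightarrow> cls M \<in> carrier (talented_monoid \<Lambda>)"
  by (simp add: talented_monoid_def quotientI)

lemma carrier_cls:
  assumes "a \<in> carrier (talented_monoid \<Lambda>)"
  obtains M where "M \<in> talented_free \<Lambda>" "a = cls M"
  using assms by (auto simp: talented_monoid_def elim: quotientE)

lemma cls_one_iff: "M \<in> talented_free \<Lambda> \<Longrightarrow> cls M = \<one>\<^bsub>talented_monoid \<Lambda>\<^esub> \<longleftrightarrow> M = {#}"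
  using cls_eq_iff[of M "{#}"] talented_cong_empty[of M "{#}"] talented_refl[of M \<Lambda>]
  by (auto simp: talented_monoid_def talented_free_def)

lemma cls_expand:
  assumes "v \<in> Obj \<Lambda>"
  shows "cls {#(v, n)#} = cls (\<Sum>\<alpha>\<in>paths_from_deg \<Lambda> v N. {#(src \<Lambda> \<alpha>, n + int_deg N)#})"
  by (rule equiv_class_eq[OF equiv_talented talented_cong_expand[OF assms]])

lemma sum_paths_free:
  "A \<subseteq> Mor \<Lambda> \<Longrightarrow> (\<Sum>\<alpha>\<in>A. {#(src \<Lambda> \<alpha>, n)#}) \<in> talented_free \<Lambda>"
  by (induction A rule: infinite_finite_induct) (auto simp: talented_free_def src_closed)

lemma shift_singleton: "shift q (cls {#(v, n)#}) = cls {#(v, n + q)#}"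
  by (simp add: shift_class)

text \<open>The cycle condition for the trivial path gives a common extension of \<mu> and \<nu>,
  and two initial segments of one path with equal degree coincide. This is what makes the shifts
  obtained below nontrivial.\<close>

lemma generalized_cycle_deg_neq:
  assumes "generalized_cycle \<Lambda> \<mu> \<nu>"
  shows "deg \<Lambda> \<mu> \<noteq> deg \<Lambda> \<nu>"
proof
  assume d: "deg \<Lambda> \<mu> = deg \<Lambda> \<nu>"
  have m: "\<mu> \<in> Mor \<Lambda>" "\<nu> \<in> Mor \<Lambda>" "\<mu> \<noteq> \<nu>"
    and M: "\<And>\<tau>. \<tau> \<in> paths_from \<Lambda> (src \<Lambda> \<mu>) \<Longrightarrow> MCE \<Lambda> (pcomp \<Lambda> \<mu> \<tau>) \<nu> \<noteq> {}"
    using assms by (auto simp: generalized_cycle_def)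
  have "ident \<Lambda> (src \<Lambda> \<mu>) \<in> paths_from \<Lambda> (src \<Lambda> \<mu>)"
    using m by (simp add: paths_from_def ident_closed src_closed rng_ident)
  from M[OF this] obtain \<tau> where "\<tau> \<in> MCE \<Lambda> \<mu> \<nu>" using m by (auto simp: pcomp_ident_right)
  then show False using is_prefix_unique d m by (auto simp: MCE_iff)
qed

text \<open>The expansion of the symbol v(l - n) to level l; \<open>n\<close> is the degree of the
  paths, not a level.\<close>

definition level_sum :: "'o \<Rightarrow> ('k \<Rightarrow> nat) \<Rightarrow> ('k \<Rightarrow> nat) \<Rightarrow> ('o \<times> ('k \<Rightarrow> int)) multiset" where
  "level_sum v n l = (\<Sum>\<alpha>\<in>paths_from_deg \<Lambda> v n. {#(src \<Lambda> \<alpha>, int_deg l)#})"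

lemma level_sum_free: "level_sum v n l \<in> talented_free \<Lambda>"
  unfolding level_sum_def by (rule sum_paths_free) (auto simp: paths_from_deg_iff)

lemma cls_level_sum:
  assumes "v \<in> Obj \<Lambda>" "n \<le> l"
  shows "cls {#(v, int_deg n)#} = cls (level_sum v (l - n) l)"
proof -
  have "int_deg n + int_deg (l - n) = int_deg l" using assms(2) by (auto simp: le_fun_def fun_eq_iff)
  then show ?thesis using cls_expand[OF assms(1), of "int_deg n" "l - n"] by (simp add: level_sum_def)
qed

lemma MCE_commute: "MCE \<Lambda> \<kappa> \<mu> = MCE \<Lambda> \<mu> \<kappa>"
  by (auto simp: MCE_def sup_commute)

text \<open>
  With \<open>l = d(\<mu>) \<or> d(\<nu>)\<close>, the condition on \<open>MCE\<close> says that every \<open>\<mu>\<tau>\<close> of degree \<open>l\<close> is of the form \<open>\<nu>\<sigma>\<close>.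
\<close>

lemma level_sum_subset:
  assumes m: "\<mu> \<in> Mor \<Lambda>" "\<nu> \<in> Mor \<Lambda>" "src \<Lambda> \<mu> = v" "src \<Lambda> \<nu> = v"
    and M: "\<And>\<tau>. \<tau> \<in> paths_from \<Lambda> v \<Longrightarrow> MCE \<Lambda> (pcomp \<Lambda> \<mu> \<tau>) \<nu> \<noteq> {}"
    and l: "l = sup (deg \<Lambda> \<mu>) (deg \<Lambda> \<nu>)"
  shows "level_sum v (l - deg \<Lambda> \<mu>) l \<subseteq># level_sum v (l - deg \<Lambda> \<nu>) l"
proof -
  have v: "v \<in> Obj \<Lambda>" using m by (auto simp: src_closed)
  note [simp] = m(3,4)
  have l: "deg \<Lambda> \<mu> \<le> l" "deg \<Lambda> \<nu> \<le> l" by (simp_all add: l)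
  let ?P = "\<lambda>n. paths_from_deg \<Lambda> v (l - n)"
  have "\<exists>\<sigma>. \<sigma> \<in> ?P (deg \<Lambda> \<nu>) \<and> pcomp \<Lambda> \<mu> \<tau> = pcomp \<Lambda> \<nu> \<sigma>" if \<tau>: "\<tau> \<in> ?P (deg \<Lambda> \<mu>)" for \<tau>
  proof -
    have \<tau>': "\<tau> \<in> Mor \<Lambda>" "src \<Lambda> \<mu> = rng \<Lambda> \<tau>" "deg \<Lambda> \<tau> = l - deg \<Lambda> \<mu>"
      using \<tau> by (auto simp: paths_from_deg_iff)
    have d: "deg \<Lambda> (pcomp \<Lambda> \<mu> \<tau>) = l" using \<tau>' m l by (auto simp: deg_pcomp le_fun_def fun_eq_iff)
    have c: "pcomp \<Lambda> \<mu> \<tau> \<in> Mor \<Lambda>" using \<tau>' m by (simp add: pcomp_closed)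
    obtain \<kappa> where "\<kappa> \<in> MCE \<Lambda> (pcomp \<Lambda> \<mu> \<tau>) \<nu>" using M[of \<tau>] \<tau>' by (auto simp: paths_from_def)
    then have \<kappa>: "deg \<Lambda> \<kappa> = l" "is_prefix (pcomp \<Lambda> \<mu> \<tau>) \<kappa>" "is_prefix \<nu> \<kappa>"
      using MCE_iff[OF c m(2)] d l(2) by (auto simp: sup_absorb1)
    \<comment> \<open>The degree of \<mu>\<tau> is already l, which dominates that of \<nu>, so a
      minimal common extension is \<mu>\<tau> itself.\<close>
    have "pcomp \<Lambda> \<mu> \<tau> = \<kappa>"
      by (rule is_prefix_unique[OF \<kappa>(2) is_prefix_refl]) (use \<kappa> d is_prefix_Mor in auto)
    then obtain \<sigma> where \<sigma>: "\<sigma> \<in> Mor \<Lambda>" "src \<Lambda> \<nu> = rng \<Lambda> \<sigma>" "pcomp \<Lambda> \<mu> \<tau> = pcomp \<Lambda> \<nu> \<sigma>"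
      using \<kappa>(3) by (auto simp: is_prefix_def)
    then have "deg \<Lambda> \<sigma> = l - deg \<Lambda> \<nu>" using d deg_pcomp[OF m(2) \<sigma>(1,2)] by (metis add_diff_cancel_left')
    then show ?thesis using \<sigma> m by (auto simp: paths_from_deg_iff)
  qed
  then obtain f where f: "\<And>\<tau>. \<tau> \<in> ?P (deg \<Lambda> \<mu>) \<Longrightarrow> f \<tau> \<in> ?P (deg \<Lambda> \<nu>)"
    "\<And>\<tau>. \<tau> \<in> ?P (deg \<Lambda> \<mu>) \<Longrightarrow> pcomp \<Lambda> \<mu> \<tau> = pcomp \<Lambda> \<nu> (f \<tau>)" by metis
  \<comment> \<open>Left cancellation by \<mu>.\<close>
  have inj: "inj_on f (?P (deg \<Lambda> \<mu>))"
  proof (rule inj_onI)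
    fix x y assume xy: "x \<in> ?P (deg \<Lambda> \<mu>)" "y \<in> ?P (deg \<Lambda> \<mu>)" "f x = f y"
    then have "pcomp \<Lambda> \<mu> x = pcomp \<Lambda> \<mu> y" using f by simp
    then show "x = y" using factor_unique(2)[of \<mu> x \<mu> y] xy m by (auto simp: paths_from_deg_iff)
  qed
  have s: "src \<Lambda> (f \<tau>) = src \<Lambda> \<tau>" if "\<tau> \<in> ?P (deg \<Lambda> \<mu>)" for \<tau>
    using arg_cong[OF f(2)[OF that], of "src \<Lambda>"] that f(1)[OF that] m
    by (simp add: paths_from_deg_iff src_pcomp)
  have "level_sum v (l - deg \<Lambda> \<mu>) l = (\<Sum>\<tau>\<in>f ` ?P (deg \<Lambda> \<mu>). {#(src \<Lambda> \<tau>, int_deg l)#})"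
    by (simp add: level_sum_def sum.reindex[OF inj] s)
  moreover have "level_sum v (l - deg \<Lambda> \<nu>) l = (\<Sum>\<tau>\<in>?P (deg \<Lambda> \<nu>) - f ` ?P (deg \<Lambda> \<mu>). {#(src \<Lambda> \<tau>, int_deg l)#}) + (\<Sum>\<tau>\<in>f ` ?P (deg \<Lambda> \<mu>). {#(src \<Lambda> \<tau>, int_deg l)#})"
    unfolding level_sum_def by (rule sum.subset_diff) (use f v finite_paths_from_deg in auto)
  ultimately show ?thesis by simp
qed

end

section \<open>Generalized cycles and atoms\<close>

context row_finite_k_graph
begin

text \<open>The witness for the element is v(0), and the summand required by
  \<open>monoid_le\<close> is the class of the multiset difference of the two expansions.\<close>

lemma generalized_cycle_le:
  assumes "generalized_cycle \<Lambda> \<mu> \<nu>"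
  shows "\<exists>a \<in> carrier (talented_monoid \<Lambda>). \<exists>n m. a \<noteq> \<one>\<^bsub>talented_monoid \<Lambda>\<^esub> \<and> n \<noteq> m \<and>
    monoid_le (talented_monoid \<Lambda>) (shift (int_deg n) a) (shift (int_deg m) a)"
proof -
  define v where "v = src \<Lambda> \<mu>"
  define l where "l = sup (deg \<Lambda> \<mu>) (deg \<Lambda> \<nu>)"
  have m: "\<mu> \<in> Mor \<Lambda>" "\<nu> \<in> Mor \<Lambda>" "src \<Lambda> \<mu> = v" "src \<Lambda> \<nu> = v"
    and M: "\<And>\<tau>. \<tau> \<in> paths_from \<Lambda> v \<Longrightarrow> MCE \<Lambda> (pcomp \<Lambda> \<mu> \<tau>) \<nu> \<noteq> {}"
    using assms by (auto simp: generalized_cycle_def v_def)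
  have v: "v \<in> Obj \<Lambda>" using m src_closed by blast
  then have f: "{#(v, n)#} \<in> talented_free \<Lambda>" for n by (simp add: talented_free_def)
  have "deg \<Lambda> \<mu> \<le> l" "deg \<Lambda> \<nu> \<le> l" by (simp_all add: l_def)
  note c = this[THEN cls_level_sum[OF v]]
  let ?A = "level_sum v (l - deg \<Lambda> \<mu>) l" and ?B = "level_sum v (l - deg \<Lambda> \<nu>) l"
  have B: "?B = ?A + (?B - ?A)" using level_sum_subset[OF m M l_def] by simp
  have D: "?B - ?A \<in> talented_free \<Lambda>"
    using level_sum_free[of v "l - deg \<Lambda> \<nu>" l] by (auto simp: talented_free_def dest: in_diffD)
  have "cls ?B = cls ?A \<otimes>\<^bsub>talented_monoid \<Lambda>\<^esub> cls (?B - ?A)"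
    using talented_mult[OF level_sum_free D] B by metis
  then have "monoid_le (talented_monoid \<Lambda>) (shift (int_deg (deg \<Lambda> \<mu>)) (cls {#(v, 0)#}))
      (shift (int_deg (deg \<Lambda> \<nu>)) (cls {#(v, 0)#}))"
    unfolding monoid_le_def shift_singleton add_0 c using cls_carrier[OF D] by blast
  then show ?thesis
    using generalized_cycle_deg_neq[OF assms]
    by (intro bexI[OF _ cls_carrier[OF f[of 0]]] exI conjI) (simp_all add: cls_one_iff[OF f])
qed

text \<open>As \<open>MCE\<close> is symmetric, the absence of an entrance is the cycle condition
  for the pair with \<mu> and \<nu> interchanged, so the inclusion of expansions holds both
  ways.\<close>

lemma free_action_entrance:
  assumes free: "free_action \<Lambda>" and cyc: "generalized_cycle \<Lambda> \<mu> \<nu>"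
  shows "\<exists>\<tau>. entrance \<Lambda> \<mu> \<nu> \<tau>"
proof (rule ccontr)
  assume no: "\<nexists>\<tau>. entrance \<Lambda> \<mu> \<nu> \<tau>"
  define v where "v = src \<Lambda> \<mu>"
  define l where "l = sup (deg \<Lambda> \<mu>) (deg \<Lambda> \<nu>)"
  have l': "l = sup (deg \<Lambda> \<nu>) (deg \<Lambda> \<mu>)" unfolding l_def by (rule sup_commute)
  have m: "\<mu> \<in> Mor \<Lambda>" "\<nu> \<in> Mor \<Lambda>" "src \<Lambda> \<mu> = v" "src \<Lambda> \<nu> = v"
    and M: "\<And>\<tau>. \<tau> \<in> paths_from \<Lambda> v \<Longrightarrow> MCE \<Lambda> (pcomp \<Lambda> \<mu> \<tau>) \<nu> \<noteq> {}"
    using cyc by (auto simp: generalized_cycle_def v_def)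
  have M': "\<And>\<tau>. \<tau> \<in> paths_from \<Lambda> v \<Longrightarrow> MCE \<Lambda> (pcomp \<Lambda> \<nu> \<tau>) \<mu> \<noteq> {}"
    using no m unfolding entrance_def MCE_commute[of \<mu>] by auto
  have v: "v \<in> Obj \<Lambda>" using m src_closed by blast
  then have f: "{#(v, n)#} \<in> talented_free \<Lambda>" for n by (simp add: talented_free_def)
  have "deg \<Lambda> \<mu> \<le> l" "deg \<Lambda> \<nu> \<le> l" by (simp_all add: l_def)
  note c = this[THEN cls_level_sum[OF v]]
  have "level_sum v (l - deg \<Lambda> \<mu>) l = level_sum v (l - deg \<Lambda> \<nu>) l"
    using level_sum_subset[OF m M l_def] level_sum_subset[OF m(2,1,4,3) M' l'] by (rule subset_mset.antisym)
  then have e: "cls {#(v, int_deg (deg \<Lambda> \<mu>))#} = cls {#(v, int_deg (deg \<Lambda> \<nu>))#}" by (simp add: c)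
  let ?a = "cls {#(v, int_deg (deg \<Lambda> \<nu>))#}" and ?p = "int_deg (deg \<Lambda> \<mu>) - int_deg (deg \<Lambda> \<nu>)"
  have "int_deg (deg \<Lambda> \<nu>) + ?p = int_deg (deg \<Lambda> \<mu>)" by simp
  then have "shift ?p ?a = ?a" by (simp only: shift_singleton e)
  moreover have "?p \<noteq> 0" using generalized_cycle_deg_neq[OF cyc] by (auto simp: fun_eq_iff)
  moreover have "?a \<in> carrier (talented_monoid \<Lambda>)" "?a \<noteq> \<one>\<^bsub>talented_monoid \<Lambda>\<^esub>"
    by (simp_all add: cls_carrier[OF f] cls_one_iff[OF f])
  ultimately show False using free unfolding free_action_def by blast
qed

section \<open>From a periodic atom to a vertex with one path of each degree\<close>

lemma monoid_atom_cls:
  assumes "monoid_atom (talented_monoid \<Lambda>) (cls (M + N))" "M + N \<in> talented_free \<Lambda>"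
  shows "M = {#} \<or> N = {#}"
proof -
  have f: "M \<in> talented_free \<Lambda>" "N \<in> talented_free \<Lambda>" using assms(2) by (auto simp: talented_free_def)
  then show ?thesis
    using assms(1) talented_mult[OF f] cls_carrier[of M] cls_carrier[of N] cls_one_iff[of M] cls_one_iff[of N]
    unfolding monoid_atom_def by metis
qed

text \<open>Only the empty multiset represents zero, so splitting one symbol off a representative of
  an atom leaves nothing.\<close>

lemma monoid_atom_vertex:
  assumes "monoid_atom (talented_monoid \<Lambda>) a"
  obtains v n where "v \<in> Obj \<Lambda>" "a = cls {#(v, n)#}"
proof -
  obtain M where M: "M \<in> talented_free \<Lambda>" "a = cls M"
    using assms carrier_cls unfolding monoid_atom_def by metis
  then have "M \<noteq> {#}" using assms cls_one_iff[of "{#}"] by (auto simp: monoid_atom_def talented_free_def)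
  then obtain x M' where x: "M = {#x#} + M'" by (cases M) auto
  then have "M' = {#}" using monoid_atom_cls[of "{#x#}" M'] assms M by auto
  then show ?thesis using that M x by (cases x) (auto simp: talented_free_def)
qed

text \<open>A second path of degree \<open>N\<close> would split the expansion at that level into
  two nonempty multisets, hence into two nonzero summands of the atom.\<close>

lemma atom_unique_path:
  assumes v: "v \<in> Obj \<Lambda>" and atom: "monoid_atom (talented_monoid \<Lambda>) (cls {#(v, n)#})"
    and \<alpha>: "\<alpha> \<in> paths_from_deg \<Lambda> v N" and \<beta>: "\<beta> \<in> paths_from_deg \<Lambda> v N"
  shows "\<alpha> = \<beta>"
proof (rule ccontr)
  assume "\<alpha> \<noteq> \<beta>"
  let ?f = "\<lambda>\<alpha>. {#(src \<Lambda> \<alpha>, n + int_deg N)#}"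
  let ?S = "\<Sum>\<alpha>\<in>paths_from_deg \<Lambda> v N. ?f \<alpha>"
  have s: "?S = ?f \<alpha> + (\<Sum>\<alpha>\<in>paths_from_deg \<Lambda> v N - {\<alpha>}. ?f \<alpha>)"
    by (rule sum.remove[OF finite_paths_from_deg[OF v] \<alpha>])
  have S: "?S \<in> talented_free \<Lambda>" by (rule sum_paths_free) (auto simp: paths_from_deg_iff)
  have "monoid_atom (talented_monoid \<Lambda>) (cls ?S)" using atom cls_expand[OF v] by simp
  then have "(\<Sum>\<alpha>\<in>paths_from_deg \<Lambda> v N - {\<alpha>}. ?f \<alpha>) = {#}"
    using monoid_atom_cls[OF _ S[unfolded s]] unfolding s by auto
  moreover have "\<beta> \<in> paths_from_deg \<Lambda> v N - {\<alpha>}" using \<beta> \<open>\<alpha> \<noteq> \<beta>\<close> by simp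
  then have "(\<Sum>\<alpha>\<in>paths_from_deg \<Lambda> v N - {\<alpha>}. ?f \<alpha>) = ?f \<beta> + (\<Sum>\<alpha>\<in>paths_from_deg \<Lambda> v N - {\<alpha>} - {\<beta>}. ?f \<alpha>)"
    by (intro sum.remove) (simp_all add: finite_paths_from_deg[OF v])
  ultimately show False by simp
qed

lemma periodic_atom_paths:
  assumes atom: "monoid_atom (talented_monoid \<Lambda>) a" and per: "periodic a"
  obtains v \<alpha> \<beta> where "v \<in> Obj \<Lambda>" "\<And>\<kappa> \<mu>. \<lbrakk>\<kappa> \<in> paths_from \<Lambda> v; \<mu> \<in> paths_from \<Lambda> v; deg \<Lambda> \<kappa> = deg \<Lambda> \<mu>\<rbrakk> \<Longrightarrow> \<kappa> = \<mu>"
    "\<alpha> \<in> paths_from \<Lambda> v" "\<beta> \<in> paths_from \<Lambda> v" "src \<Lambda> \<alpha> = src \<Lambda> \<beta>" "deg \<Lambda> \<alpha> \<noteq> deg \<Lambda> \<beta>"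
proof -
  obtain v n where v: "v \<in> Obj \<Lambda>" and a: "a = cls {#(v, n)#}" by (rule monoid_atom_vertex[OF atom])
  have uniq: "\<alpha> = \<beta>" if "\<alpha> \<in> paths_from_deg \<Lambda> v N" "\<beta> \<in> paths_from_deg \<Lambda> v N" for \<alpha> \<beta> N
    using atom_unique_path[OF v] atom a that by blast
  have single: "\<exists>\<alpha>. paths_from_deg \<Lambda> v N = {\<alpha>}" for N
    using uniq paths_from_deg_nonempty[OF v, of N] by blast
  obtain p where p: "p \<noteq> 0" "shift p a = a" using per by (auto simp: periodic_def)
  have "cls {#(v, n + p)#} = cls {#(v, n)#}" using p(2) by (simp add: a shift_singleton)
  then have "({#(v, n + p)#}, {#(v, n)#}) \<in> talented_cong \<Lambda>"
    using cls_eq_iff v by (simp add: talented_free_def)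
  from flow_cong[OF this] obtain L0 where
    L0: "\<And>L. L \<ge> L0 \<Longrightarrow> flow L {#(v, n + p)#} = flow L {#(v, n)#}" by blast
  \<comment> \<open>Above the threshold of \<open>flow_cong\<close> and above both levels, so that
    \<open>nat\<close> does not truncate and each flow consists of the source of a single
    path.\<close>
  define L where "L = sup L0 (sup n (n + p))"
  have L: "L \<ge> L0" "L \<ge> n" "L \<ge> n + p" by (auto simp: L_def le_supI1 le_supI2)
  obtain \<alpha> where \<alpha>: "paths_from_deg \<Lambda> v (\<lambda>i. nat (L i - (n + p) i)) = {\<alpha>}" using single by blast
  obtain \<beta> where \<beta>: "paths_from_deg \<Lambda> v (\<lambda>i. nat (L i - n i)) = {\<beta>}" using single by blast
  have "src \<Lambda> \<alpha> = src \<Lambda> \<beta>" using L0[OF L(1)] \<alpha> \<beta> by (simp add: flow_def)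
  moreover have "\<alpha> \<in> paths_from_deg \<Lambda> v (\<lambda>i. nat (L i - (n + p) i))" "\<beta> \<in> paths_from_deg \<Lambda> v (\<lambda>i. nat (L i - n i))"
    using \<alpha> \<beta> by auto
  then have d: "\<alpha> \<in> paths_from \<Lambda> v" "\<beta> \<in> paths_from \<Lambda> v"
    "deg \<Lambda> \<alpha> = (\<lambda>i. nat (L i - (n + p) i))" "deg \<Lambda> \<beta> = (\<lambda>i. nat (L i - n i))"
    by (auto simp: paths_from_deg_def)
  moreover obtain i where i: "p i \<noteq> 0" using p(1) by (auto simp: fun_eq_iff)
  \<comment> \<open>The two degrees are L - (n + p) and L - n, which differ by p.\<close>
  have "deg \<Lambda> \<alpha> i \<noteq> deg \<Lambda> \<beta> i"
    using i le_funD[OF L(2), of i] le_funD[OF L(3), of i] by (simp add: d)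
  then have "deg \<Lambda> \<alpha> \<noteq> deg \<Lambda> \<beta>" by metis
  moreover have "\<kappa> = \<mu>" if "\<kappa> \<in> paths_from \<Lambda> v" "\<mu> \<in> paths_from \<Lambda> v" "deg \<Lambda> \<kappa> = deg \<Lambda> \<mu>" for \<kappa> \<mu>
    by (rule uniq[of _ "deg \<Lambda> \<mu>"]) (use that in \<open>simp_all add: paths_from_deg_def\<close>)
  ultimately show ?thesis using that[OF v _ d(1,2)] by blast
qed

text \<open>Take any path from v whose degree is the join. Its initial segments of the two given
  degrees also start at v, so by uniqueness they are \<kappa> and \<mu>.\<close>

lemma unique_paths_MCE:
  assumes v: "v \<in> Obj \<Lambda>"
    and uniq: "\<And>\<kappa> \<mu>. \<lbrakk>\<kappa> \<in> paths_from \<Lambda> v; \<mu> \<in> paths_from \<Lambda> v; deg \<Lambda> \<kappa> = deg \<Lambda> \<mu>\<rbrakk> \<Longrightarrow> \<kappa> = \<mu>"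
    and \<kappa>: "\<kappa> \<in> paths_from \<Lambda> v" and \<mu>: "\<mu> \<in> paths_from \<Lambda> v"
  shows "MCE \<Lambda> \<kappa> \<mu> \<noteq> {}"
proof -
  obtain \<tau> where \<tau>: "\<tau> \<in> paths_from_deg \<Lambda> v (sup (deg \<Lambda> \<kappa>) (deg \<Lambda> \<mu>))"
    using paths_from_deg_nonempty[OF v] by blast
  have "is_prefix \<alpha> \<tau>" if \<alpha>: "\<alpha> \<in> paths_from \<Lambda> v" "deg \<Lambda> \<alpha> \<le> deg \<Lambda> \<tau>" for \<alpha>
  proof -
    obtain \<alpha>' where a: "is_prefix \<alpha>' \<tau>" "deg \<Lambda> \<alpha>' = deg \<Lambda> \<alpha>"
      using is_prefix_exists[OF _ \<alpha>(2)] \<tau> by (auto simp: paths_from_deg_iff)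
    then have "\<alpha>' \<in> paths_from \<Lambda> v"
      using \<tau> is_prefix_rng[OF a(1)] is_prefix_Mor[OF a(1)] by (simp add: paths_from_def paths_from_deg_iff)
    then show ?thesis using uniq \<alpha>(1) a by metis
  qed
  then have "\<tau> \<in> MCE \<Lambda> \<kappa> \<mu>"
    using \<kappa> \<mu> \<tau> by (auto simp: MCE_iff paths_from_def paths_from_deg_iff)
  then show ?thesis by blast
qed

lemma unique_paths_cycle:
  assumes v: "v \<in> Obj \<Lambda>"
    and uniq: "\<And>\<kappa> \<mu>. \<lbrakk>\<kappa> \<in> paths_from \<Lambda> v; \<mu> \<in> paths_from \<Lambda> v; deg \<Lambda> \<kappa> = deg \<Lambda> \<mu>\<rbrakk> \<Longrightarrow> \<kappa> = \<mu>"
    and \<alpha>: "\<alpha> \<in> paths_from \<Lambda> v" and \<beta>: "\<beta> \<in> paths_from \<Lambda> v" "src \<Lambda> \<alpha> = src \<Lambda> \<beta>" "\<alpha> \<noteq> \<beta>"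
  shows "generalized_cycle \<Lambda> \<alpha> \<beta>" "\<nexists>\<tau>. entrance \<Lambda> \<alpha> \<beta> \<tau>"
proof -
  have c: "pcomp \<Lambda> \<kappa> \<tau> \<in> paths_from \<Lambda> v" if "\<kappa> \<in> paths_from \<Lambda> v" "\<tau> \<in> paths_from \<Lambda> (src \<Lambda> \<kappa>)" for \<kappa> \<tau>
    using that by (simp add: paths_from_def pcomp_closed rng_pcomp)
  have M: "MCE \<Lambda> \<kappa> \<mu> \<noteq> {}" if "\<kappa> \<in> paths_from \<Lambda> v" "\<mu> \<in> paths_from \<Lambda> v" for \<kappa> \<mu>
    by (rule unique_paths_MCE[OF v uniq that])
  show "generalized_cycle \<Lambda> \<alpha> \<beta>"
    unfolding generalized_cycle_def using M[OF c[OF \<alpha>] \<beta>(1)] \<alpha> \<beta> by (simp add: paths_from_def)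
  show "\<nexists>\<tau>. entrance \<Lambda> \<alpha> \<beta> \<tau>"
    unfolding entrance_def using M[OF \<alpha> c[OF \<beta>(1)]] by blast
qed

end

section \<open>Infinite paths\<close>

context k_graph
begin

lemma is_prefix_cancel:
  assumes "is_prefix (pcomp \<Lambda> \<kappa> \<alpha>) (pcomp \<Lambda> \<kappa> \<beta>)" "\<kappa> \<in> Mor \<Lambda>" "\<alpha> \<in> Mor \<Lambda>" "\<beta> \<in> Mor \<Lambda>"
    "src \<Lambda> \<kappa> = rng \<Lambda> \<alpha>" "src \<Lambda> \<kappa> = rng \<Lambda> \<beta>"
  shows "is_prefix \<alpha> \<beta>"
proof -
  obtain \<gamma> where \<gamma>: "\<gamma> \<in> Mor \<Lambda>" "src \<Lambda> \<alpha> = rng \<Lambda> \<gamma>" "pcomp \<Lambda> \<kappa> \<beta> = pcomp \<Lambda> (pcomp \<Lambda> \<kappa> \<alpha>) \<gamma>"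
    using assms by (auto simp: is_prefix_def src_pcomp)
  then have "pcomp \<Lambda> \<kappa> \<beta> = pcomp \<Lambda> \<kappa> (pcomp \<Lambda> \<alpha> \<gamma>)" using assms by (simp add: pcomp_assoc)
  then have "\<beta> = pcomp \<Lambda> \<alpha> \<gamma>"
    by (rule factor_unique(2)[rotated 6]) (use assms \<gamma> in \<open>simp_all add: pcomp_closed rng_pcomp\<close>)
  then show ?thesis using \<gamma> assms(3) by (auto simp: is_prefix_def)
qed

definition tail :: "'m \<Rightarrow> ('k \<Rightarrow> nat) \<Rightarrow> 'm" where
  "tail \<kappa> n = (THE \<beta>. \<beta> \<in> Mor \<Lambda> \<and> (\<exists>\<alpha> \<in> Mor \<Lambda>. deg \<Lambda> \<alpha> = n \<and> src \<Lambda> \<alpha> = rng \<Lambda> \<beta> \<and> \<kappa> = pcomp \<Lambda> \<alpha> \<beta>))"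

lemma tail_pcomp:
  "\<lbrakk>\<alpha> \<in> Mor \<Lambda>; \<beta> \<in> Mor \<Lambda>; src \<Lambda> \<alpha> = rng \<Lambda> \<beta>\<rbrakk> \<Longrightarrow> tail (pcomp \<Lambda> \<alpha> \<beta>) (deg \<Lambda> \<alpha>) = \<beta>"
  unfolding tail_def by (rule the_equality) (blast, metis factor_unique(2))

definition prefix :: "'m \<Rightarrow> ('k \<Rightarrow> nat) \<Rightarrow> 'm" where
  "prefix \<kappa> n = (THE \<alpha>. is_prefix \<alpha> \<kappa> \<and> deg \<Lambda> \<alpha> = n)"

lemma prefix_eq: "is_prefix \<alpha> \<kappa> \<Longrightarrow> prefix \<kappa> (deg \<Lambda> \<alpha>) = \<alpha>"
  unfolding prefix_def by (rule the_equality) (auto intro: is_prefix_unique)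

lemma prefix_is_prefix:
  assumes "\<kappa> \<in> Mor \<Lambda>" "n \<le> deg \<Lambda> \<kappa>"
  shows "is_prefix (prefix \<kappa> n) \<kappa>" "deg \<Lambda> (prefix \<kappa> n) = n"
  using is_prefix_exists[OF assms] prefix_eq by metis+

text \<open>An infinite path is given by its initial segments \<open>x(0, n)\<close>.\<close>

definition ipaths :: "(('k \<Rightarrow> nat) \<Rightarrow> 'm) set" where
  "ipaths = {y. (\<forall>n. deg \<Lambda> (y n) = n) \<and> (\<forall>n m. n \<le> m \<longrightarrow> is_prefix (y n) (y m))}"

definition irng :: "(('k \<Rightarrow> nat) \<Rightarrow> 'm) \<Rightarrow> 'o" where
  "irng y = rng \<Lambda> (y 0)"

definition ishift :: "('k \<Rightarrow> nat) \<Rightarrow> (('k \<Rightarrow> nat) \<Rightarrow> 'm) \<Rightarrow> ('k \<Rightarrow> nat) \<Rightarrow> 'm" where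
  "ishift n y m = tail (y (n + m)) n"

text \<open>Cutting \<kappa>y(m), which has degree d(\<kappa>) + m, back to degree m avoids
  comparing m with d(\<kappa>); in several coordinates the two need not be comparable.\<close>

definition iprep :: "'m \<Rightarrow> (('k \<Rightarrow> nat) \<Rightarrow> 'm) \<Rightarrow> ('k \<Rightarrow> nat) \<Rightarrow> 'm" where
  "iprep \<kappa> y m = prefix (pcomp \<Lambda> \<kappa> (y m)) m"

definition cylinder :: "'m \<Rightarrow> (('k \<Rightarrow> nat) \<Rightarrow> 'm) set" where
  "cylinder \<kappa> = {y \<in> ipaths. y (deg \<Lambda> \<kappa>) = \<kappa>}"

lemma ipathsD:
  assumes "y \<in> ipaths"
  shows "y n \<in> Mor \<Lambda>" "deg \<Lambda> (y n) = n" "n \<le> m \<Longrightarrow> is_prefix (y n) (y m)" "rng \<Lambda> (y n) = irng y"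
proof -
  show "y n \<in> Mor \<Lambda>" "deg \<Lambda> (y n) = n" "n \<le> m \<Longrightarrow> is_prefix (y n) (y m)"
    using assms is_prefix_Mor(1)[of "y n" "y n"] by (auto simp: ipaths_def)
  have "is_prefix (y 0) (y n)" using assms by (simp add: ipaths_def le_fun_def)
  then show "rng \<Lambda> (y n) = irng y" unfolding irng_def by (rule is_prefix_rng[symmetric])
qed

text \<open>The degrees above \<open>n\<close> are cofinal, and every other initial segment is a
  prefix of one of these.\<close>

lemma ipaths_eqI:
  assumes y: "y \<in> ipaths" "y' \<in> ipaths" and e: "\<And>m. y (n + m) = y' (n + m)"
  shows "y = y'"
proof
  fix m
  have le: "m \<le> n + m" by (simp add: le_fun_def)
  show "y m = y' m"
    using ipathsD(3)[OF y(1) le] ipathsD(3)[OF y(2) le] ipathsD(2)[OF y(1), of m] ipathsD(2)[OF y(2), of m] e[of m]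
    by (intro is_prefix_unique[of "y m" "y (n + m)" "y' m"]) simp_all
qed

lemma ishift_factor:
  assumes y: "y \<in> ipaths"
  shows "y (n + m) = pcomp \<Lambda> (y n) (ishift n y m)" "ishift n y m \<in> Mor \<Lambda>"
    "src \<Lambda> (y n) = rng \<Lambda> (ishift n y m)" "deg \<Lambda> (ishift n y m) = m"
proof -
  have "n \<le> n + m" by (simp add: le_fun_def)
  then obtain \<beta> where \<beta>: "\<beta> \<in> Mor \<Lambda>" "src \<Lambda> (y n) = rng \<Lambda> \<beta>" "y (n + m) = pcomp \<Lambda> (y n) \<beta>"
    using ipathsD(3)[OF y] by (auto simp: is_prefix_def)
  then have "ishift n y m = \<beta>"
    using tail_pcomp[OF ipathsD(1)[OF y] \<beta>(1,2)] by (simp add: ishift_def ipathsD[OF y])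
  then show "y (n + m) = pcomp \<Lambda> (y n) (ishift n y m)" "ishift n y m \<in> Mor \<Lambda>"
    "src \<Lambda> (y n) = rng \<Lambda> (ishift n y m)" using \<beta> by simp_all
  have "n + m = n + deg \<Lambda> (ishift n y m)"
    using \<beta> deg_pcomp[OF ipathsD(1)[OF y] \<beta>(1,2)] ipathsD(2)[OF y] \<open>ishift n y m = \<beta>\<close> by metis
  then show "deg \<Lambda> (ishift n y m) = m" by (simp add: fun_eq_iff)
qed

lemma ishift_ipaths:
  assumes y: "y \<in> ipaths"
  shows "ishift n y \<in> ipaths" "irng (ishift n y) = src \<Lambda> (y n)"
proof -
  have "is_prefix (ishift n y m) (ishift n y m')" if "m \<le> m'" for m m'
  proof (rule is_prefix_cancel)
    have "n + m \<le> n + m'" using that by (simp add: le_fun_def)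
    then show "is_prefix (pcomp \<Lambda> (y n) (ishift n y m)) (pcomp \<Lambda> (y n) (ishift n y m'))"
      using ipathsD(3)[OF y] ishift_factor(1)[OF y] by metis
  qed (use y in \<open>simp_all add: ishift_factor ipathsD\<close>)
  then show "ishift n y \<in> ipaths" using ishift_factor[OF y] by (simp add: ipaths_def)
  show "irng (ishift n y) = src \<Lambda> (y n)" using ishift_factor(3)[OF y, of n 0] by (simp add: irng_def)
qed

lemma ishift_zero:
  assumes y: "y \<in> ipaths"
  shows "ishift 0 y = y"
proof
  fix m
  note f = ishift_factor[OF y, of 0 m] and D = ipathsD[OF y, of 0]
  have i: "y 0 = ident \<Lambda> (irng y)" using deg_zero_ident[OF D(1,2)] D(4) by simp
  have "irng y = rng \<Lambda> (ishift 0 y m)"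
    using f(3) unfolding i using rng_closed[OF D(1)] D(4) by (simp add: src_ident)
  then show "ishift 0 y m = y m" using f(1) pcomp_ident_left[OF f(2)] i by simp
qed

lemma ishift_add:
  assumes y: "y \<in> ipaths"
  shows "ishift (n + m) y = ishift m (ishift n y)"
proof
  fix l
  let ?z = "ishift n y"
  have z: "?z \<in> ipaths" by (rule ishift_ipaths[OF y])
  note f = ishift_factor[OF y] and g = ishift_factor[OF z] and D = ipathsD[OF y]
  have "pcomp \<Lambda> (y (n + m)) (ishift (n + m) y l) = y (n + (m + l))"
    using f(1)[of "n + m" l] by (simp add: add.assoc)
  also have "\<dots> = pcomp \<Lambda> (y n) (pcomp \<Lambda> (?z m) (ishift m ?z l))"
    using f(1)[of n "m + l"] g(1)[of m l] by simp
  also have "\<dots> = pcomp \<Lambda> (pcomp \<Lambda> (y n) (?z m)) (ishift m ?z l)"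
    using f D g by (simp add: pcomp_assoc)
  also have "\<dots> = pcomp \<Lambda> (y (n + m)) (ishift m ?z l)" using f(1)[of n m] by simp
  finally have e: "pcomp \<Lambda> (y (n + m)) (ishift (n + m) y l) = pcomp \<Lambda> (y (n + m)) (ishift m ?z l)" .
  have s: "src \<Lambda> (y (n + m)) = src \<Lambda> (?z m)"
    using f(1)[of n m] src_pcomp[OF D(1) f(2,3)] by simp
  show "ishift (n + m) y l = ishift m ?z l"
    by (rule factor_unique(2)[OF D(1) f(2,3) D(1) g(2) _ e]) (simp_all add: s g(3))
qed

lemma iprep_props:
  assumes y: "y \<in> ipaths" and \<kappa>: "\<kappa> \<in> Mor \<Lambda>" "src \<Lambda> \<kappa> = irng y"
  shows "iprep \<kappa> y \<in> cylinder \<kappa>" "iprep \<kappa> y (deg \<Lambda> \<kappa> + m) = pcomp \<Lambda> \<kappa> (y m)"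
    "irng (iprep \<kappa> y) = rng \<Lambda> \<kappa>" "iprep \<kappa> y \<in> ipaths" "iprep \<kappa> y (deg \<Lambda> \<kappa>) = \<kappa>"
proof -
  define w where "w m = pcomp \<Lambda> \<kappa> (y m)" for m
  note D = ipathsD[OF y]
  have w: "w m \<in> Mor \<Lambda>" "deg \<Lambda> (w m) = deg \<Lambda> \<kappa> + m" "rng \<Lambda> (w m) = rng \<Lambda> \<kappa>" for m
    using \<kappa> D by (simp_all add: w_def pcomp_closed deg_pcomp rng_pcomp)
  have mono: "is_prefix (w m) (w m')" if "m \<le> m'" for m m'
    unfolding w_def by (rule is_prefix_pcomp[OF \<kappa>(1) D(3)[OF that]]) (simp add: \<kappa> D)
  have "m \<le> deg \<Lambda> (w m)" for m using w(2) by (simp add: le_fun_def)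
  from prefix_is_prefix[OF w(1) this]
  have z: "is_prefix (iprep \<kappa> y m) (w m)" "deg \<Lambda> (iprep \<kappa> y m) = m" for m
    unfolding iprep_def w_def by auto
  have "is_prefix (iprep \<kappa> y m) (iprep \<kappa> y m')" if "m \<le> m'" for m m'
    by (rule is_prefix_of_prefixes[OF is_prefix_trans[OF z(1) mono[OF that]] z(1)]) (simp add: z that)
  then show i: "iprep \<kappa> y \<in> ipaths" using z by (simp add: ipaths_def)
  have le: "m \<le> deg \<Lambda> \<kappa> + m" by (simp add: le_fun_def)
  show "iprep \<kappa> y (deg \<Lambda> \<kappa> + m) = pcomp \<Lambda> \<kappa> (y m)"
    unfolding w_def[symmetric] by (rule is_prefix_unique[OF z(1) mono[OF le]]) (simp add: z w)
  show \<kappa>': "iprep \<kappa> y (deg \<Lambda> \<kappa>) = \<kappa>"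
  proof (rule is_prefix_unique[OF z(1)])
    show "is_prefix \<kappa> (w (deg \<Lambda> \<kappa>))"
      unfolding w_def by (rule is_prefixI) (use \<kappa> D in simp_all)
  qed (simp add: z)
  then show "iprep \<kappa> y \<in> cylinder \<kappa>" using i by (simp add: cylinder_def)
  show "irng (iprep \<kappa> y) = rng \<Lambda> \<kappa>" using ipathsD(4)[OF i, of "deg \<Lambda> \<kappa>"] \<kappa>' by simp
qed

lemma ishift_iprep:
  assumes "y \<in> ipaths" "\<kappa> \<in> Mor \<Lambda>" "src \<Lambda> \<kappa> = irng y"
  shows "ishift (deg \<Lambda> \<kappa>) (iprep \<kappa> y) = y"
proof
  fix m
  show "ishift (deg \<Lambda> \<kappa>) (iprep \<kappa> y) m = y m"
    unfolding ishift_def iprep_props(2)[OF assms]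
    using tail_pcomp[OF assms(2) ipathsD(1)[OF assms(1)]] ipathsD(4)[OF assms(1)] assms(3) by simp
qed

lemma iprep_ishift:
  assumes y: "y \<in> ipaths"
  shows "iprep (y n) (ishift n y) = y"
proof (rule ipaths_eqI[where n = n])
  note D = ipathsD[OF y] and z = ishift_ipaths[OF y]
  note p = iprep_props[OF z(1) D(1) z(2)[symmetric]]
  show "iprep (y n) (ishift n y) \<in> ipaths" by (rule p(4))
  show "iprep (y n) (ishift n y) (n + m) = y (n + m)" for m
    using p(2)[where m = m] D(2) ishift_factor(1)[OF y, of n m] by simp
qed (rule y)

lemma iprep_pcomp:
  assumes y: "y \<in> ipaths" and \<mu>: "\<mu> \<in> Mor \<Lambda>" "src \<Lambda> \<mu> = irng y" and \<kappa>: "\<kappa> \<in> Mor \<Lambda>" "src \<Lambda> \<kappa> = rng \<Lambda> \<mu>"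
  shows "iprep (pcomp \<Lambda> \<kappa> \<mu>) y = iprep \<kappa> (iprep \<mu> y)"
proof (rule ipaths_eqI[where n = "deg \<Lambda> \<kappa> + deg \<Lambda> \<mu>"])
  note p = iprep_props[OF y \<mu>] and D = ipathsD[OF y]
  have s: "src \<Lambda> \<kappa> = irng (iprep \<mu> y)" using p \<kappa> by simp
  note q = iprep_props[OF p(4) \<kappa>(1) s]
  have c: "pcomp \<Lambda> \<kappa> \<mu> \<in> Mor \<Lambda>" "src \<Lambda> (pcomp \<Lambda> \<kappa> \<mu>) = irng y" "deg \<Lambda> (pcomp \<Lambda> \<kappa> \<mu>) = deg \<Lambda> \<kappa> + deg \<Lambda> \<mu>"
    using \<kappa> \<mu> by (simp_all add: pcomp_closed src_pcomp deg_pcomp)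
  note r = iprep_props[OF y c(1,2)]
  show "iprep (pcomp \<Lambda> \<kappa> \<mu>) y \<in> ipaths" "iprep \<kappa> (iprep \<mu> y) \<in> ipaths" by (rule r q)+
  fix m
  have "iprep (pcomp \<Lambda> \<kappa> \<mu>) y (deg \<Lambda> \<kappa> + deg \<Lambda> \<mu> + m) = pcomp \<Lambda> (pcomp \<Lambda> \<kappa> \<mu>) (y m)"
    using r(2)[of m] c(3) by simp
  also have "\<dots> = pcomp \<Lambda> \<kappa> (pcomp \<Lambda> \<mu> (y m))" using \<kappa> \<mu> D by (simp add: pcomp_assoc)
  also have "\<dots> = iprep \<kappa> (iprep \<mu> y) (deg \<Lambda> \<kappa> + deg \<Lambda> \<mu> + m)"
    using q(2)[of "deg \<Lambda> \<mu> + m"] p(2)[of m] by (simp add: add.assoc)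
  finally show "iprep (pcomp \<Lambda> \<kappa> \<mu>) y (deg \<Lambda> \<kappa> + deg \<Lambda> \<mu> + m) = iprep \<kappa> (iprep \<mu> y) (deg \<Lambda> \<kappa> + deg \<Lambda> \<mu> + m)" .
qed

text \<open>This is the identity of domains behind the multiplicativity of the path
  operators.\<close>

lemma cylinder_pcomp:
  assumes \<mu>: "\<mu> \<in> Mor \<Lambda>" and \<kappa>: "\<kappa> \<in> Mor \<Lambda>" "src \<Lambda> \<kappa> = rng \<Lambda> \<mu>"
  shows "y \<in> cylinder (pcomp \<Lambda> \<kappa> \<mu>) \<longleftrightarrow> y \<in> cylinder \<kappa> \<and> ishift (deg \<Lambda> \<kappa>) y \<in> cylinder \<mu>"
proof (cases "y \<in> ipaths")
  case y: True
  note f = ishift_factor[OF y] and D = ipathsD[OF y]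
  let ?z = "ishift (deg \<Lambda> \<kappa>) y"
  have "y (deg \<Lambda> \<kappa> + deg \<Lambda> \<mu>) = pcomp \<Lambda> \<kappa> \<mu> \<longleftrightarrow> y (deg \<Lambda> \<kappa>) = \<kappa> \<and> ?z (deg \<Lambda> \<mu>) = \<mu>"
    unfolding f(1) using factor_unique[OF D(1) f(2,3) \<kappa>(1) \<mu> \<kappa>(2)] D(2) by metis
  then show ?thesis
    using y ishift_ipaths[OF y] \<kappa> \<mu> by (simp add: cylinder_def deg_pcomp)
qed (simp add: cylinder_def)

lemma cylinder_rng: "y \<in> cylinder \<kappa> \<Longrightarrow> irng y = rng \<Lambda> \<kappa>"
  using ipathsD(4)[of y "deg \<Lambda> \<kappa>"] by (simp add: cylinder_def)

lemma cylinder_ident: "v \<in> Obj \<Lambda> \<Longrightarrow> y \<in> cylinder (ident \<Lambda> v) \<longleftrightarrow> y \<in> ipaths \<and> irng y = v"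
  using deg_zero_ident[of "y 0"] ipathsD[of y 0]
  by (auto simp: cylinder_def deg_ident irng_def rng_ident)

end

section \<open>Operators on finitely supported functions\<close>

definition fin_supp :: "('x \<Rightarrow> complex) \<Rightarrow> bool" where
  "fin_supp \<xi> \<longleftrightarrow> finite {y. \<xi> y \<noteq> 0}"

definition l2 :: "('x \<Rightarrow> complex) \<Rightarrow> real" where
  "l2 \<xi> = L2_set (\<lambda>y. cmod (\<xi> y)) {y. \<xi> y \<noteq> 0}"

text \<open>The sum runs over the support of the first argument only. Linearity in the second
  argument is then immediate, while linearity in the first is obtained through conjugate symmetry
  and needs finite supports.\<close>

definition ip :: "('x \<Rightarrow> complex) \<Rightarrow> ('x \<Rightarrow> complex) \<Rightarrow> complex" where
  "ip \<xi> \<eta> = (\<Sum>y | \<xi> y \<noteq> 0. \<xi> y * cnj (\<eta> y))"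

lemma l2_superset: "finite A \<Longrightarrow> {y. \<xi> y \<noteq> 0} \<subseteq> A \<Longrightarrow> l2 \<xi> = L2_set (\<lambda>y. cmod (\<xi> y)) A"
  unfolding l2_def L2_set_def by (intro arg_cong[of _ _ sqrt] sum.mono_neutral_left) auto

lemma ip_superset: "finite A \<Longrightarrow> {y. \<xi> y \<noteq> 0} \<subseteq> A \<Longrightarrow> ip \<xi> \<eta> = (\<Sum>y\<in>A. \<xi> y * cnj (\<eta> y))"
  unfolding ip_def by (intro sum.mono_neutral_left) auto

lemma l2_nonneg: "0 \<le> l2 \<xi>"
  by (simp add: l2_def L2_set_nonneg)

lemma fin_supp_add: "fin_supp \<xi> \<Longrightarrow> fin_supp \<eta> \<Longrightarrow> fin_supp (\<lambda>y. \<xi> y + \<eta> y)"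
  unfolding fin_supp_def by (rule finite_subset[of _ "{y. \<xi> y \<noteq> 0} \<union> {y. \<eta> y \<noteq> 0}"]) auto

lemma fin_supp_scale: "fin_supp \<xi> \<Longrightarrow> fin_supp (\<lambda>y. c * \<xi> y)"
  unfolding fin_supp_def by (rule finite_subset[of _ "{y. \<xi> y \<noteq> 0}"]) auto

lemma fin_supp_zero: "fin_supp (\<lambda>y. 0)"
  by (simp add: fin_supp_def)

lemma l2_add:
  assumes "fin_supp \<xi>" "fin_supp \<eta>"
  shows "l2 (\<lambda>y. \<xi> y + \<eta> y) \<le> l2 \<xi> + l2 \<eta>"
proof -
  let ?A = "{y. \<xi> y \<noteq> 0} \<union> {y. \<eta> y \<noteq> 0}"
  have A: "finite ?A" using assms by (simp add: fin_supp_def)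
  have "l2 (\<lambda>y. \<xi> y + \<eta> y) = L2_set (\<lambda>y. cmod (\<xi> y + \<eta> y)) ?A" by (rule l2_superset[OF A]) auto
  also have "\<dots> \<le> L2_set (\<lambda>y. cmod (\<xi> y) + cmod (\<eta> y)) ?A"
    by (rule L2_set_mono) (auto simp: norm_triangle_ineq)
  also have "\<dots> \<le> L2_set (\<lambda>y. cmod (\<xi> y)) ?A + L2_set (\<lambda>y. cmod (\<eta> y)) ?A" by (rule L2_set_triangle_ineq)
  also have "\<dots> = l2 \<xi> + l2 \<eta>" using l2_superset[OF A] by auto
  finally show ?thesis .
qed

lemma l2_scale:
  assumes "fin_supp \<xi>"
  shows "l2 (\<lambda>y. c * \<xi> y) = cmod c * l2 \<xi>"
proof -
  have A: "finite {y. \<xi> y \<noteq> 0}" using assms by (simp add: fin_supp_def)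
  have "l2 (\<lambda>y. c * \<xi> y) = L2_set (\<lambda>y. cmod (c * \<xi> y)) {y. \<xi> y \<noteq> 0}" by (rule l2_superset[OF A]) auto
  also have "\<dots> = cmod c * l2 \<xi>" by (simp add: norm_mult L2_set_right_distrib l2_def)
  finally show ?thesis .
qed

lemma ip_self:
  assumes "fin_supp \<xi>"
  shows "ip \<xi> \<xi> = of_real ((l2 \<xi>)\<^sup>2)"
  by (simp add: ip_def l2_def L2_set_def sum_nonneg complex_norm_square del: of_real_power)

lemma ip_commute:
  assumes "fin_supp \<xi>" "fin_supp \<eta>"
  shows "ip \<eta> \<xi> = cnj (ip \<xi> \<eta>)"
proof -
  let ?A = "{y. \<xi> y \<noteq> 0} \<union> {y. \<eta> y \<noteq> 0}"
  have A: "finite ?A" using assms by (simp add: fin_supp_def)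
  show ?thesis by (subst (1 2) ip_superset[OF A]) (auto simp: mult.commute)
qed

lemma ip_add_right: "ip \<xi> (\<lambda>y. \<eta> y + \<zeta> y) = ip \<xi> \<eta> + ip \<xi> \<zeta>"
  by (simp add: ip_def algebra_simps sum.distrib)

lemma ip_scale_right: "ip \<xi> (\<lambda>y. c * \<eta> y) = cnj c * ip \<xi> \<eta>"
  by (simp add: ip_def sum_distrib_left mult_ac)

lemma ip_Cauchy_Schwarz:
  assumes "fin_supp \<xi>" "fin_supp \<eta>"
  shows "cmod (ip \<xi> \<eta>) \<le> l2 \<xi> * l2 \<eta>"
proof -
  let ?A = "{y. \<xi> y \<noteq> 0} \<union> {y. \<eta> y \<noteq> 0}"
  have A: "finite ?A" using assms by (simp add: fin_supp_def)
  have "cmod (ip \<xi> \<eta>) = cmod (\<Sum>y\<in>?A. \<xi> y * cnj (\<eta> y))" by (subst ip_superset[OF A]) auto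
  also have "\<dots> \<le> (\<Sum>y\<in>?A. \<bar>cmod (\<xi> y)\<bar> * \<bar>cmod (\<eta> y)\<bar>)"
    by (rule order_trans[OF norm_sum]) (simp add: norm_mult)
  also have "\<dots> \<le> L2_set (\<lambda>y. cmod (\<xi> y)) ?A * L2_set (\<lambda>y. cmod (\<eta> y)) ?A" by (rule L2_set_mult_ineq)
  also have "\<dots> = l2 \<xi> * l2 \<eta>" using l2_superset[OF A] by auto
  finally show ?thesis .
qed

section \<open>Bounded operators with a formal adjoint\<close>

definition lin_op :: "(('x \<Rightarrow> complex) \<Rightarrow> 'x \<Rightarrow> complex) \<Rightarrow> bool" where
  "lin_op T \<longleftrightarrow> (\<forall>\<xi> \<eta>. T (\<lambda>y. \<xi> y + \<eta> y) = (\<lambda>y. T \<xi> y + T \<eta> y)) \<and> (\<forall>c \<xi>. T (\<lambda>y. c * \<xi> y) = (\<lambda>y. c * T \<xi> y)) \<and>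
    (\<forall>\<xi>. fin_supp \<xi> \<longrightarrow> fin_supp (T \<xi>))"

definition op_bound :: "(('x \<Rightarrow> complex) \<Rightarrow> 'x \<Rightarrow> complex) \<Rightarrow> real \<Rightarrow> bool" where
  "op_bound T K \<longleftrightarrow> 0 \<le> K \<and> (\<forall>\<xi>. fin_supp \<xi> \<longrightarrow> l2 (T \<xi>) \<le> K * l2 \<xi>)"

definition op_nrm :: "(('x \<Rightarrow> complex) \<Rightarrow> 'x \<Rightarrow> complex) \<Rightarrow> real" where
  "op_nrm T = Inf {K. op_bound T K}"

text \<open>
  Bounded operators on the finitely supported functions, each paired with its formal adjoint. The
  operators act on all functions, so that no quotient or extensionality condition is needed.
\<close>

definition op_pair :: "(('x \<Rightarrow> complex) \<Rightarrow> 'x \<Rightarrow> complex) \<times> (('x \<Rightarrow> complex) \<Rightarrow> 'x \<Rightarrow> complex) \<Rightarrow> bool" where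
  "op_pair a \<longleftrightarrow> lin_op (fst a) \<and> lin_op (snd a) \<and> (\<exists>K. op_bound (fst a) K) \<and>
     (\<forall>\<xi> \<eta>. fin_supp \<xi> \<longrightarrow> fin_supp \<eta> \<longrightarrow> ip (fst a \<xi>) \<eta> = ip \<xi> (snd a \<eta>))"

definition op_alg :: "((('x \<Rightarrow> complex) \<Rightarrow> 'x \<Rightarrow> complex) \<times> (('x \<Rightarrow> complex) \<Rightarrow> 'x \<Rightarrow> complex)) star_alg" where
  "op_alg = \<lparr>carrier = Collect op_pair,
     mult = (\<lambda>a b. (\<lambda>\<xi>. fst a (fst b \<xi>), \<lambda>\<xi>. snd b (snd a \<xi>))),
     one = undefined,
     zero = (\<lambda>\<xi> y. 0, \<lambda>\<xi> y. 0),
     add = (\<lambda>a b. (\<lambda>\<xi> y. fst a \<xi> y + fst b \<xi> y, \<lambda>\<xi> y. snd a \<xi> y + snd b \<xi> y)),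
     smult = (\<lambda>c a. (\<lambda>\<xi> y. c * fst a \<xi> y, \<lambda>\<xi> y. cnj c * snd a \<xi> y)),
     star = (\<lambda>a. (snd a, fst a))\<rparr>"

lemma op_alg_simps:
  "a \<in> carrier op_alg \<longleftrightarrow> op_pair a"
  "a \<otimes>\<^bsub>op_alg\<^esub> b = (\<lambda>\<xi>. fst a (fst b \<xi>), \<lambda>\<xi>. snd b (snd a \<xi>))"
  "\<zero>\<^bsub>op_alg\<^esub> = (\<lambda>\<xi> y. 0, \<lambda>\<xi> y. 0)"
  "a \<oplus>\<^bsub>op_alg\<^esub> b = (\<lambda>\<xi> y. fst a \<xi> y + fst b \<xi> y, \<lambda>\<xi> y. snd a \<xi> y + snd b \<xi> y)"
  "c \<odot>\<^bsub>op_alg\<^esub> a = (\<lambda>\<xi> y. c * fst a \<xi> y, \<lambda>\<xi> y. cnj c * snd a \<xi> y)"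
  "star op_alg a = (snd a, fst a)"
  by (simp_all add: op_alg_def)

lemma lin_opD:
  assumes "lin_op T"
  shows "T (\<lambda>y. \<xi> y + \<eta> y) = (\<lambda>y. T \<xi> y + T \<eta> y)" "T (\<lambda>y. c * \<xi> y) = (\<lambda>y. c * T \<xi> y)"
    "fin_supp \<xi> \<Longrightarrow> fin_supp (T \<xi>)"
  using assms by (auto simp: lin_op_def)

lemma op_bound_op_nrm:
  assumes "op_bound T K"
  shows "op_bound T (op_nrm T)"
  unfolding op_bound_def
proof (intro conjI allI impI)
  have ne: "{K. op_bound T K} \<noteq> {}" using assms by blast
  show "0 \<le> op_nrm T" unfolding op_nrm_def by (rule cInf_greatest[OF ne]) (auto simp: op_bound_def)
  fix \<xi> :: "'a \<Rightarrow> complex" assume \<xi>: "fin_supp \<xi>"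
  show "l2 (T \<xi>) \<le> op_nrm T * l2 \<xi>"
  proof (cases "l2 \<xi> = 0")
    case True
    then show ?thesis using assms \<xi> by (auto simp: op_bound_def)
  next
    case False
    then have p: "l2 \<xi> > 0" using l2_nonneg[of \<xi>] by simp
    have "l2 (T \<xi>) / l2 \<xi> \<le> op_nrm T"
      unfolding op_nrm_def by (rule cInf_greatest[OF ne]) (use \<xi> p in \<open>simp add: op_bound_def field_simps\<close>)
    then show ?thesis using p by (simp add: field_simps)
  qed
qed

lemma op_nrm_le: "op_bound T K \<Longrightarrow> op_nrm T \<le> K"
  unfolding op_nrm_def by (rule cInf_lower) (auto simp: op_bound_def bdd_below_def)

lemma op_pair_nrm: "op_pair a \<Longrightarrow> op_bound (fst a) (op_nrm (fst a))"
  by (auto simp: op_pair_def intro: op_bound_op_nrm)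

lemma op_pairD:
  assumes "op_pair a" "fin_supp \<xi>"
  shows "fin_supp (fst a \<xi>)" "fin_supp (snd a \<xi>)" "l2 (fst a \<xi>) \<le> op_nrm (fst a) * l2 \<xi>" "0 \<le> op_nrm (fst a)"
    "fin_supp \<eta> \<Longrightarrow> ip (fst a \<xi>) \<eta> = ip \<xi> (snd a \<eta>)"
  using assms op_pair_nrm[OF assms(1)] by (auto simp: op_pair_def lin_opD op_bound_def)

text \<open>Write \<parallel>a*\<eta>\<parallel>^2 as <a a*\<eta>, \<eta>>, apply Cauchy-Schwarz and
  the bound for a, and cancel one factor. This is why \<open>op_pair\<close> can state a bound for
  the first component alone.\<close>

lemma op_bound_adjoint:
  assumes a: "op_pair a"
  shows "op_bound (snd a) (op_nrm (fst a))"
  unfolding op_bound_def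
proof (intro conjI allI impI)
  show "0 \<le> op_nrm (fst a)" using op_pair_nrm[OF a] by (simp add: op_bound_def)
  fix \<eta> :: "'a \<Rightarrow> complex" assume \<eta>: "fin_supp \<eta>"
  let ?S = "snd a \<eta>"
  have S: "fin_supp ?S" by (rule op_pairD(2)[OF a \<eta>])
  have "l2 ?S * l2 ?S = cmod (ip ?S ?S)" by (simp add: ip_self[OF S] power2_eq_square del: of_real_power of_real_mult)
  also have "\<dots> = cmod (ip (fst a ?S) \<eta>)" using op_pairD(5)[OF a S \<eta>] by simp
  also have "\<dots> \<le> l2 (fst a ?S) * l2 \<eta>" by (rule ip_Cauchy_Schwarz[OF op_pairD(1)[OF a S] \<eta>])
  also have "\<dots> \<le> op_nrm (fst a) * l2 ?S * l2 \<eta>" by (rule mult_right_mono[OF op_pairD(3)[OF a S] l2_nonneg])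
  finally have *: "l2 ?S * l2 ?S \<le> (op_nrm (fst a) * l2 \<eta>) * l2 ?S" by (simp add: mult_ac)
  show "l2 ?S \<le> op_nrm (fst a) * l2 \<eta>"
  proof (cases "l2 ?S = 0")
    case True
    then show ?thesis using op_pairD(4)[OF a \<eta>] l2_nonneg[of \<eta>] by simp
  next
    case False
    then show ?thesis using * l2_nonneg[of ?S] by (simp add: mult_le_cancel_right)
  qed
qed

lemma op_pair_star:
  assumes a: "op_pair a"
  shows "op_pair (snd a, fst a)"
  using a op_bound_adjoint[OF a] ip_commute op_pairD[OF a] unfolding op_pair_def by (smt (verit) fst_conv snd_conv)

lemma op_bound_compose:
  assumes "op_bound T K" "op_bound S L" "lin_op S"
  shows "op_bound (\<lambda>\<xi>. T (S \<xi>)) (K * L)"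
  unfolding op_bound_def
proof (intro conjI allI impI)
  fix \<xi> :: "'a \<Rightarrow> complex" assume \<xi>: "fin_supp \<xi>"
  have "l2 (T (S \<xi>)) \<le> K * l2 (S \<xi>)" using assms \<xi> by (simp add: op_bound_def lin_opD)
  also have "\<dots> \<le> K * (L * l2 \<xi>)" using assms \<xi> by (simp add: op_bound_def mult_left_mono)
  finally show "l2 (T (S \<xi>)) \<le> K * L * l2 \<xi>" by (simp add: mult.assoc)
qed (use assms in \<open>simp add: op_bound_def\<close>)

lemma op_pair_mult: "op_pair a \<Longrightarrow> op_pair b \<Longrightarrow> op_pair (a \<otimes>\<^bsub>op_alg\<^esub> b)"
  using op_bound_compose[OF op_pair_nrm op_pair_nrm, of a b] op_pairD
  by (auto simp: op_pair_def op_alg_simps lin_op_def)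

lemma op_bound_add:
  assumes "op_bound T K" "op_bound S L" "lin_op T" "lin_op S"
  shows "op_bound (\<lambda>\<xi> y. T \<xi> y + S \<xi> y) (K + L)"
  unfolding op_bound_def
proof (intro conjI allI impI)
  fix \<xi> :: "'a \<Rightarrow> complex" assume \<xi>: "fin_supp \<xi>"
  have "l2 (\<lambda>y. T \<xi> y + S \<xi> y) \<le> l2 (T \<xi>) + l2 (S \<xi>)" using assms \<xi> by (intro l2_add) (simp_all add: lin_opD)
  also have "\<dots> \<le> K * l2 \<xi> + L * l2 \<xi>" using assms \<xi> by (intro add_mono) (simp_all add: op_bound_def)
  finally show "l2 (\<lambda>y. T \<xi> y + S \<xi> y) \<le> (K + L) * l2 \<xi>" by (simp add: algebra_simps)
qed (use assms in \<open>simp add: op_bound_def\<close>)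

lemma ip_add_left: "fin_supp \<xi> \<Longrightarrow> fin_supp \<zeta> \<Longrightarrow> fin_supp \<eta> \<Longrightarrow> ip (\<lambda>y. \<xi> y + \<zeta> y) \<eta> = ip \<xi> \<eta> + ip \<zeta> \<eta>"
  using ip_commute[of \<eta> "\<lambda>y. \<xi> y + \<zeta> y"] ip_commute[of \<eta> \<xi>] ip_commute[of \<eta> \<zeta>]
  by (simp add: fin_supp_add ip_add_right)

lemma ip_scale_left: "fin_supp \<xi> \<Longrightarrow> fin_supp \<eta> \<Longrightarrow> ip (\<lambda>y. c * \<xi> y) \<eta> = c * ip \<xi> \<eta>"
  using ip_commute[of \<eta> "\<lambda>y. c * \<xi> y"] ip_commute[of \<eta> \<xi>]
  by (simp add: fin_supp_scale ip_scale_right)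

lemma op_pair_add:
  assumes a: "op_pair a" and b: "op_pair b"
  shows "op_pair (a \<oplus>\<^bsub>op_alg\<^esub> b)"
proof -
  have l: "lin_op (fst a)" "lin_op (fst b)" "lin_op (snd a)" "lin_op (snd b)" using a b by (auto simp: op_pair_def)
  have "lin_op (\<lambda>\<xi> y. T \<xi> y + S \<xi> y)" if "lin_op T" "lin_op S" for T S :: "('a \<Rightarrow> complex) \<Rightarrow> 'a \<Rightarrow> complex"
    using that by (auto simp: lin_op_def fin_supp_add algebra_simps)
  moreover have "\<exists>K. op_bound (\<lambda>\<xi> y. fst a \<xi> y + fst b \<xi> y) K"
    using op_bound_add[OF op_pair_nrm[OF a] op_pair_nrm[OF b]] l by blast
  ultimately show ?thesis
    using l op_pairD[OF a] op_pairD[OF b] by (simp add: op_pair_def op_alg_simps ip_add_left ip_add_right)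
qed

lemma op_bound_scale:
  assumes "op_bound T K" "lin_op T"
  shows "op_bound (\<lambda>\<xi> y. c * T \<xi> y) (cmod c * K)"
  using assms by (auto simp: op_bound_def l2_scale lin_opD mult.assoc mult_left_mono)

lemma op_pair_scale:
  assumes a: "op_pair a"
  shows "op_pair (c \<odot>\<^bsub>op_alg\<^esub> a)"
proof -
  have l: "lin_op (fst a)" "lin_op (snd a)" using a by (auto simp: op_pair_def)
  have "lin_op (\<lambda>\<xi> y. c * T \<xi> y)" if "lin_op T" for T :: "('a \<Rightarrow> complex) \<Rightarrow> 'a \<Rightarrow> complex" and c
    using that by (auto simp: lin_op_def fin_supp_scale algebra_simps)
  moreover have "\<exists>K. op_bound (\<lambda>\<xi> y. c * fst a \<xi> y) K"
    using op_bound_scale[OF op_pair_nrm[OF a]] l by blast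
  ultimately show ?thesis
    using l op_pairD[OF a] by (simp add: op_pair_def op_alg_simps ip_scale_left ip_scale_right)
qed

lemma op_pair_zero: "op_pair \<zero>\<^bsub>op_alg\<^esub>"
  by (auto simp: op_pair_def op_alg_simps lin_op_def fin_supp_zero op_bound_def ip_def l2_def intro: exI[of _ 0])

lemma abelian_group_op_alg: "abelian_group op_alg"
proof (rule abelian_groupI)
  fix a :: "(('x \<Rightarrow> complex) \<Rightarrow> 'x \<Rightarrow> complex) \<times> (('x \<Rightarrow> complex) \<Rightarrow> 'x \<Rightarrow> complex)" assume "a \<in> carrier op_alg"
  then have "(-1) \<odot>\<^bsub>op_alg\<^esub> a \<in> carrier op_alg" using op_pair_scale by (simp add: op_alg_simps(1))
  then show "\<exists>b\<in>carrier op_alg. b \<oplus>\<^bsub>op_alg\<^esub> a = \<zero>\<^bsub>op_alg\<^esub>"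
    by (rule bexI[rotated]) (simp add: op_alg_simps)
qed (use op_pair_add op_pair_zero in \<open>auto simp: op_alg_simps algebra_simps\<close>)

lemma op_alg_closed:
  "a \<in> carrier op_alg \<Longrightarrow> b \<in> carrier op_alg \<Longrightarrow> a \<otimes>\<^bsub>op_alg\<^esub> b \<in> carrier op_alg"
  "a \<in> carrier op_alg \<Longrightarrow> c \<odot>\<^bsub>op_alg\<^esub> a \<in> carrier op_alg"
  "a \<in> carrier op_alg \<Longrightarrow> star op_alg a \<in> carrier op_alg"
  unfolding op_alg_simps(1,6) mem_Collect_eq by (rule op_pair_mult op_pair_scale op_pair_star; assumption)+

lemma star_algebra_op_alg: "star_algebra op_alg"
proof (intro star_algebra.intro star_algebra_axioms.intro moduleI)
qed (auto simp: cring_complex_ring abelian_group_op_alg op_alg_closed,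
     auto simp: op_alg_simps algebra_simps op_pair_def lin_opD)

text \<open>In general only a seminorm, as the norm tests finitely supported functions while
  elements are operators on all functions. The C*-identity rests on the adjoint carried along in
  each pair.\<close>

lemma cstar_seminorm_op_nrm: "cstar_seminorm op_alg (\<lambda>a. op_nrm (fst a))"
  unfolding cstar_seminorm_def
proof (intro conjI ballI allI)
  fix a :: "(('x \<Rightarrow> complex) \<Rightarrow> 'x \<Rightarrow> complex) \<times> (('x \<Rightarrow> complex) \<Rightarrow> 'x \<Rightarrow> complex)" assume "a \<in> carrier op_alg"
  then have a: "op_pair a" by (simp add: op_alg_simps)
  have la: "lin_op (fst a)" using a by (auto simp: op_pair_def)
  note na = op_pair_nrm[OF a]
  show nn: "0 \<le> op_nrm (fst a)" using na by (simp add: op_bound_def)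
  have le: "op_nrm (fst (c \<odot>\<^bsub>op_alg\<^esub> a)) \<le> cmod c * op_nrm (fst a)"
    if "op_pair a" for c and a :: "(('x \<Rightarrow> complex) \<Rightarrow> 'x \<Rightarrow> complex) \<times> (('x \<Rightarrow> complex) \<Rightarrow> 'x \<Rightarrow> complex)"
    using op_nrm_le[OF op_bound_scale[OF op_pair_nrm[OF that]]] that by (simp add: op_alg_simps op_pair_def)
  show "op_nrm (fst (c \<odot>\<^bsub>op_alg\<^esub> a)) = cmod c * op_nrm (fst a)" for c
  proof (cases "c = 0")
    case True
    have "0 \<le> op_nrm (fst (c \<odot>\<^bsub>op_alg\<^esub> a))"
      using op_pair_nrm[OF op_pair_scale[OF a]] by (simp add: op_bound_def)
    then show ?thesis using le[OF a, of c] True by simp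
  next
    case False
    have "inverse c \<odot>\<^bsub>op_alg\<^esub> (c \<odot>\<^bsub>op_alg\<^esub> a) = a" using False by (cases a) (simp add: op_alg_simps fun_eq_iff)
    then have "op_nrm (fst a) \<le> cmod (inverse c) * op_nrm (fst (c \<odot>\<^bsub>op_alg\<^esub> a))"
      using le[OF op_pair_scale[OF a, of c], of "inverse c"] by simp
    then have "cmod c * op_nrm (fst a) \<le> op_nrm (fst (c \<odot>\<^bsub>op_alg\<^esub> a))"
      using False by (simp add: norm_inverse norm_divide field_simps)
    then show ?thesis using le[OF a, of c] by simp
  qed
  show "op_nrm (fst (star op_alg a \<otimes>\<^bsub>op_alg\<^esub> a)) = (op_nrm (fst a))\<^sup>2"
  proof (rule antisym)
    have n: "op_bound (fst (star op_alg a \<otimes>\<^bsub>op_alg\<^esub> a)) ((op_nrm (fst a))\<^sup>2)"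
      using op_bound_compose[OF op_bound_adjoint[OF a] na la] by (simp add: op_alg_simps power2_eq_square)
    then show "op_nrm (fst (star op_alg a \<otimes>\<^bsub>op_alg\<^esub> a)) \<le> (op_nrm (fst a))\<^sup>2" by (rule op_nrm_le)
    define r where "r = op_nrm (fst (star op_alg a \<otimes>\<^bsub>op_alg\<^esub> a))"
    have r: "op_bound (\<lambda>\<xi>. snd a (fst a \<xi>)) r"
      using op_bound_op_nrm[OF n] by (simp add: r_def op_alg_simps)
    then have r0: "0 \<le> r" by (simp add: op_bound_def)
    \<comment> \<open>The remaining half of the C*-identity: <T\<xi>, T\<xi>> = <\<xi>, T*T\<xi>> is
      at most r times the squared norm of \<xi>.\<close>
    have "op_bound (fst a) (sqrt r)"
      unfolding op_bound_def
    proof (intro conjI allI impI)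
      fix \<xi> :: "'x \<Rightarrow> complex" assume \<xi>: "fin_supp \<xi>"
      let ?T = "fst a \<xi>"
      have T: "fin_supp ?T" "fin_supp (snd a ?T)" using op_pairD[OF a] \<xi> by simp_all
      have "(l2 ?T)\<^sup>2 = cmod (ip ?T ?T)" by (simp add: ip_self[OF T(1)] del: of_real_power)
      also have "\<dots> = cmod (ip \<xi> (snd a ?T))" using op_pairD(5)[OF a \<xi> T(1)] by simp
      also have "\<dots> \<le> l2 \<xi> * l2 (snd a ?T)" by (rule ip_Cauchy_Schwarz[OF \<xi> T(2)])
      also have "\<dots> \<le> l2 \<xi> * (r * l2 \<xi>)" using r \<xi> by (intro mult_left_mono l2_nonneg) (simp add: op_bound_def)
      also have "\<dots> = (sqrt r * l2 \<xi>)\<^sup>2" using r0 by (simp add: power2_eq_square)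
      finally show "l2 ?T \<le> sqrt r * l2 \<xi>" by (rule power2_le_imp_le) (simp add: r0 l2_nonneg)
    qed (simp add: r0)
    then have "op_nrm (fst a) \<le> sqrt r" by (rule op_nrm_le)
    then have "(op_nrm (fst a))\<^sup>2 \<le> (sqrt r)\<^sup>2" using nn by (rule power_mono)
    then show "(op_nrm (fst a))\<^sup>2 \<le> op_nrm (fst (star op_alg a \<otimes>\<^bsub>op_alg\<^esub> a))" using r0 by (simp add: r_def)
  qed
  fix b :: "(('x \<Rightarrow> complex) \<Rightarrow> 'x \<Rightarrow> complex) \<times> (('x \<Rightarrow> complex) \<Rightarrow> 'x \<Rightarrow> complex)" assume "b \<in> carrier op_alg"
  then have b: "op_pair b" by (simp add: op_alg_simps)
  have lb: "lin_op (fst b)" using b by (auto simp: op_pair_def)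
  show "op_nrm (fst (a \<oplus>\<^bsub>op_alg\<^esub> b)) \<le> op_nrm (fst a) + op_nrm (fst b)"
    using op_nrm_le[OF op_bound_add[OF na op_pair_nrm[OF b] la lb]] by (simp add: op_alg_simps)
  show "op_nrm (fst (a \<otimes>\<^bsub>op_alg\<^esub> b)) \<le> op_nrm (fst a) * op_nrm (fst b)"
    using op_nrm_le[OF op_bound_compose[OF na op_pair_nrm[OF b] lb]] by (simp add: op_alg_simps)
qed

lemma op_alg_finsum:
  assumes "finite A" "\<And>\<kappa>. \<kappa> \<in> A \<Longrightarrow> op_pair (f \<kappa>)"
  shows "(\<Oplus>\<^bsub>op_alg\<^esub>\<kappa>\<in>A. f \<kappa>) = (\<lambda>\<xi> y. \<Sum>\<kappa>\<in>A. fst (f \<kappa>) \<xi> y, \<lambda>\<xi> y. \<Sum>\<kappa>\<in>A. snd (f \<kappa>) \<xi> y)"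
proof -
  interpret abelian_group op_alg by (rule abelian_group_op_alg)
  show ?thesis using assms
  proof (induction A rule: finite_induct)
    case (insert x F)
    then have "f \<in> F \<rightarrow> carrier op_alg" "f x \<in> carrier op_alg" by (auto simp: op_alg_simps(1))
    then show ?case using insert by (simp add: finsum_insert op_alg_simps)
  qed (simp add: op_alg_simps)
qed

text \<open>For injective \<open>h\<close> and \<open>c\<close> of modulus 1 this is a partial
  isometry, taking the basis vector at h(y) to c times the one at y for y in
  \<open>D\<close>.\<close>

definition weighted_perm :: "'x set \<Rightarrow> ('x \<Rightarrow> 'x) \<Rightarrow> complex \<Rightarrow> ('x \<Rightarrow> complex) \<Rightarrow> 'x \<Rightarrow> complex" where
  "weighted_perm D h c \<xi> y = (if y \<in> D then c * \<xi> (h y) else 0)"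

lemma weighted_perm_lin_op:
  assumes "inj_on h D"
  shows "lin_op (weighted_perm D h c)"
  unfolding lin_op_def
proof (intro conjI allI impI)
  fix \<xi> :: "'a \<Rightarrow> complex" assume "fin_supp \<xi>"
  then have "finite (h -` {x. \<xi> x \<noteq> 0} \<inter> D)" unfolding fin_supp_def by (rule finite_vimage_IntI[OF _ assms])
  then show "fin_supp (weighted_perm D h c \<xi>)"
    unfolding fin_supp_def by (rule finite_subset[rotated]) (auto simp: weighted_perm_def)
qed (auto simp: weighted_perm_def fun_eq_iff algebra_simps)

text \<open>Reindexing along \<open>h\<close> turns the squared norm of the image into a partial sum
  of that of \<xi>, and one side of the adjoint relation into the other.\<close>

lemma op_pair_weighted_perm:
  assumes h: "bij_betw h D D'" and h': "\<And>y. y \<in> D \<Longrightarrow> h' (h y) = y" and c: "cmod c = 1"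
  shows "op_pair (weighted_perm D h c, weighted_perm D' h' (cnj c))"
proof -
  have inj: "inj_on h D" and D': "D' = h ` D" using h by (auto simp: bij_betw_def)
  have inj': "inj_on h' D'" unfolding D' by (rule inj_onI) (auto simp: h')
  have A: "finite {y \<in> D. \<xi> (h y) \<noteq> 0}" if "fin_supp \<xi>" for \<xi>
  proof -
    have "finite (h -` {x. \<xi> x \<noteq> 0} \<inter> D)" using that unfolding fin_supp_def by (rule finite_vimage_IntI[OF _ inj])
    then show ?thesis by (rule finite_subset[rotated]) auto
  qed
  have "op_bound (weighted_perm D h c) 1"
    unfolding op_bound_def
  proof (intro conjI allI impI)
    fix \<xi> :: "'a \<Rightarrow> complex" assume \<xi>: "fin_supp \<xi>"
    let ?A = "{y \<in> D. \<xi> (h y) \<noteq> 0}"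
    have "l2 (weighted_perm D h c \<xi>) = L2_set (\<lambda>y. cmod (weighted_perm D h c \<xi> y)) ?A"
      by (rule l2_superset[OF A[OF \<xi>]]) (auto simp: weighted_perm_def)
    also have "\<dots> = sqrt (\<Sum>y\<in>?A. (cmod (\<xi> (h y)))\<^sup>2)"
      unfolding L2_set_def by (intro arg_cong[of _ _ sqrt] sum.cong) (auto simp: weighted_perm_def norm_mult c)
    also have "(\<Sum>y\<in>?A. (cmod (\<xi> (h y)))\<^sup>2) = (\<Sum>x\<in>h ` ?A. (cmod (\<xi> x))\<^sup>2)"
      by (subst sum.reindex) (auto intro: inj_on_subset[OF inj])
    also have "\<dots> \<le> (\<Sum>x | \<xi> x \<noteq> 0. (cmod (\<xi> x))\<^sup>2)"
      by (rule sum_mono2) (use \<xi> in \<open>auto simp: fin_supp_def\<close>)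
    finally show "l2 (weighted_perm D h c \<xi>) \<le> 1 * l2 \<xi>" by (simp add: l2_def L2_set_def)
  qed simp
  moreover have "ip (weighted_perm D h c \<xi>) \<eta> = ip \<xi> (weighted_perm D' h' (cnj c) \<eta>)" if \<xi>: "fin_supp \<xi>" for \<xi> \<eta>
  proof -
    let ?A = "{y \<in> D. \<xi> (h y) \<noteq> 0}"
    have "ip (weighted_perm D h c \<xi>) \<eta> = (\<Sum>y\<in>?A. weighted_perm D h c \<xi> y * cnj (\<eta> y))"
      by (rule ip_superset[OF A[OF \<xi>]]) (auto simp: weighted_perm_def)
    also have "\<dots> = (\<Sum>y\<in>?A. \<xi> (h y) * cnj (weighted_perm D' h' (cnj c) \<eta> (h y)))"
      by (rule sum.cong) (auto simp: weighted_perm_def D' h')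
    also have "\<dots> = (\<Sum>x\<in>h ` ?A. \<xi> x * cnj (weighted_perm D' h' (cnj c) \<eta> x))"
      by (subst sum.reindex) (auto intro: inj_on_subset[OF inj])
    also have "\<dots> = ip \<xi> (weighted_perm D' h' (cnj c) \<eta>)"
      unfolding ip_def by (rule sum.mono_neutral_left) (use \<xi> in \<open>auto simp: fin_supp_def weighted_perm_def D'\<close>)
    finally show ?thesis .
  qed
  ultimately show ?thesis
    using weighted_perm_lin_op[OF inj] weighted_perm_lin_op[OF inj'] unfolding op_pair_def by auto
qed

section \<open>The representation on the infinite path space\<close>

text \<open>
  The representation on functions on the infinite path space, twisted by the gauge action through the
  \<open>i\<close>-th coordinate of the degree at the point \<open>z\<close> of the unit circle.
\<close>

context k_graph
begin

text \<open>On basis vectors, \<kappa> sends the one at x to z^(d(\<kappa>)_i) times the one at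
  \<kappa>x if x starts at the source of \<kappa>, and to 0 otherwise. The second component is the
  adjoint, which removes \<kappa>.\<close>

definition path_op :: "'k \<Rightarrow> complex \<Rightarrow> 'm \<Rightarrow>
    (((('k \<Rightarrow> nat) \<Rightarrow> 'm) \<Rightarrow> complex) \<Rightarrow> (('k \<Rightarrow> nat) \<Rightarrow> 'm) \<Rightarrow> complex) \<times>
    (((('k \<Rightarrow> nat) \<Rightarrow> 'm) \<Rightarrow> complex) \<Rightarrow> (('k \<Rightarrow> nat) \<Rightarrow> 'm) \<Rightarrow> complex)" where
  "path_op i z \<kappa> =
    (weighted_perm (cylinder \<kappa>) (ishift (deg \<Lambda> \<kappa>)) (z ^ deg \<Lambda> \<kappa> i),
     weighted_perm {y \<in> ipaths. irng y = src \<Lambda> \<kappa>} (iprep \<kappa>) (cnj (z ^ deg \<Lambda> \<kappa> i)))"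

lemma ishift_cylinder:
  assumes "y \<in> cylinder \<kappa>"
  shows "ishift (deg \<Lambda> \<kappa>) y \<in> ipaths" "irng (ishift (deg \<Lambda> \<kappa>) y) = src \<Lambda> \<kappa>"
    "iprep \<kappa> (ishift (deg \<Lambda> \<kappa>) y) = y"
  using ishift_ipaths[of y "deg \<Lambda> \<kappa>"] iprep_ishift[of y "deg \<Lambda> \<kappa>"] assms
  by (simp_all add: cylinder_def)

lemma op_pair_path_op:
  assumes \<kappa>: "\<kappa> \<in> Mor \<Lambda>" and z: "cmod z = 1"
  shows "op_pair (path_op i z \<kappa>)"
  unfolding path_op_def
proof (rule op_pair_weighted_perm)
  show "bij_betw (ishift (deg \<Lambda> \<kappa>)) (cylinder \<kappa>) {y \<in> ipaths. irng y = src \<Lambda> \<kappa>}"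
    by (rule bij_betw_byWitness[where f' = "iprep \<kappa>"])
       (use \<kappa> in \<open>auto simp: ishift_cylinder ishift_iprep iprep_props\<close>)
qed (use z in \<open>simp_all add: ishift_cylinder norm_power\<close>)

lemma phase_mult:
  assumes "cmod z = 1"
  shows "cnj z ^ n * (z ^ n * w) = w" "z ^ n * (cnj z ^ n * w) = w"
proof -
  have "z * cnj z = 1" using assms by (simp add: complex_norm_square[symmetric])
  then have "z ^ n * cnj z ^ n = 1" by (metis power_mult_distrib power_one)
  then show "cnj z ^ n * (z ^ n * w) = w" "z ^ n * (cnj z ^ n * w) = w"
    by (metis mult.assoc mult.commute mult_1)+
qed

text \<open>Prepending a vertex and shifting by 0 change nothing, so only the restriction to the
  infinite paths from v remains.\<close>

lemma path_op_ident:
  assumes v: "v \<in> Obj \<Lambda>"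
  defines "Q \<equiv> \<lambda>\<xi> y. if y \<in> ipaths \<and> irng y = v then \<xi> y else 0"
  shows "path_op i z (ident \<Lambda> v) = (Q, Q)"
proof -
  have "y 0 = ident \<Lambda> v" if "y \<in> ipaths" "irng y = v" for y
    using deg_zero_ident[of "y 0"] ipathsD[OF that(1), of 0] that(2) by simp
  then have "iprep (ident \<Lambda> v) y = y" if "y \<in> ipaths" "irng y = v" for y
    using iprep_ishift[OF that(1), of 0] ishift_zero[OF that(1)] that by simp
  then show ?thesis
    using v by (auto simp: path_op_def weighted_perm_def Q_def cylinder_ident deg_ident src_ident ishift_zero intro!: ext)
qed

lemma path_op_source:
  assumes \<kappa>: "\<kappa> \<in> Mor \<Lambda>" and z: "cmod z = 1"
  shows "star op_alg (path_op i z \<kappa>) \<otimes>\<^bsub>op_alg\<^esub> path_op i z \<kappa> = path_op i z (ident \<Lambda> (src \<Lambda> \<kappa>))"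
  unfolding path_op_ident[OF src_closed[OF \<kappa>]]
  using \<kappa> by (auto simp: path_op_def op_alg_simps weighted_perm_def fun_eq_iff iprep_props ishift_iprep phase_mult[OF z])

lemma path_op_range:
  assumes \<kappa>: "\<kappa> \<in> Mor \<Lambda>" and z: "cmod z = 1"
  defines "Q \<equiv> \<lambda>\<xi> y. if y \<in> cylinder \<kappa> then \<xi> y else 0"
  shows "path_op i z \<kappa> \<otimes>\<^bsub>op_alg\<^esub> star op_alg (path_op i z \<kappa>) = (Q, Q)"
  using \<kappa> by (auto simp: path_op_def op_alg_simps weighted_perm_def fun_eq_iff ishift_cylinder phase_mult[OF z] Q_def)

lemma path_op_pcomp:
  assumes \<mu>: "\<mu> \<in> Mor \<Lambda>" and \<kappa>: "\<kappa> \<in> Mor \<Lambda>" "src \<Lambda> \<kappa> = rng \<Lambda> \<mu>"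
  shows "path_op i z (pcomp \<Lambda> \<kappa> \<mu>) = path_op i z \<kappa> \<otimes>\<^bsub>op_alg\<^esub> path_op i z \<mu>"
proof -
  have "ishift (deg \<Lambda> \<kappa> + deg \<Lambda> \<mu>) y = ishift (deg \<Lambda> \<mu>) (ishift (deg \<Lambda> \<kappa>) y)" if "y \<in> cylinder \<kappa>" for y
    using ishift_add that by (simp add: cylinder_def)
  then show ?thesis
    using \<mu> \<kappa> by (auto simp: path_op_def op_alg_simps weighted_perm_def cylinder_pcomp deg_pcomp
        src_pcomp iprep_props iprep_pcomp power_add mult.assoc intro!: ext)
qed

end

lemma (in row_finite_k_graph) ck_family_path_op:
  assumes z: "cmod z = 1"
  shows "ck_family \<Lambda> op_alg (path_op i z)"
proof -
  have "x = y" if "(x, y) \<in> ck_relations \<Lambda> op_alg (path_op i z)" for x y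
    using that
  proof cases
    case (ck_partial_isometry \<kappa>)
    then show ?thesis
      unfolding ck_partial_isometry(1,2) path_op_range[OF ck_partial_isometry(3) z]
      by (auto simp: path_op_def op_alg_simps weighted_perm_def fun_eq_iff iprep_props)
  next
    case (ck_composition \<kappa> \<mu>)
    then show ?thesis by (simp add: path_op_pcomp)
  next
    case (ck_source_projection \<kappa>)
    then show ?thesis by (simp add: path_op_source[OF _ z])
  next
    case (ck_range_projections v n)
    let ?P = "paths_from_deg \<Lambda> v n"
    have cyl: "y \<in> cylinder \<kappa> \<longleftrightarrow> y \<in> ipaths \<and> irng y = v \<and> \<kappa> = y n" if "\<kappa> \<in> ?P" for y \<kappa>
      using that cylinder_rng[of y \<kappa>] by (auto simp: cylinder_def paths_from_deg_iff)
    have yn: "y n \<in> ?P" if "y \<in> ipaths" "irng y = v" for y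
      using ipathsD[OF that(1)] that(2) by (simp add: paths_from_deg_iff)
    have fin: "finite ?P" by (rule finite_paths_from_deg[OF ck_range_projections(3)])
    have M: "\<kappa> \<in> Mor \<Lambda>" if "\<kappa> \<in> ?P" for \<kappa> using that by (simp add: paths_from_deg_iff)
    \<comment> \<open>The cylinders of the paths of degree n from v partition the infinite paths
      from v: the only nonzero summand is the one for \<open>y n\<close>.\<close>
    have sum: "(\<Sum>\<kappa>\<in>?P. if y \<in> cylinder \<kappa> then \<xi> y else 0) = (if y \<in> ipaths \<and> irng y = v then \<xi> y else 0)"
      for y and \<xi> :: "(('k \<Rightarrow> nat) \<Rightarrow> 'm) \<Rightarrow> complex"
    proof -
      have "(\<Sum>\<kappa>\<in>?P. if y \<in> cylinder \<kappa> then \<xi> y else 0)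
        = (\<Sum>\<kappa>\<in>?P. if \<kappa> = y n then (if y \<in> ipaths \<and> irng y = v then \<xi> y else 0) else 0)"
        by (rule sum.cong) (auto simp: cyl)
      also have "\<dots> = (if y \<in> ipaths \<and> irng y = v then \<xi> y else 0)"
        using fin yn by (auto simp: sum.delta)
      finally show ?thesis .
    qed
    have "op_pair (path_op i z \<kappa> \<otimes>\<^bsub>op_alg\<^esub> star op_alg (path_op i z \<kappa>))" if "\<kappa> \<in> ?P" for \<kappa>
      using op_alg_closed[of "path_op i z \<kappa>"] op_pair_path_op[OF M[OF that] z] by (simp add: op_alg_simps(1))
    then have "(\<Oplus>\<^bsub>op_alg\<^esub>\<kappa>\<in>?P. path_op i z \<kappa> \<otimes>\<^bsub>op_alg\<^esub> star op_alg (path_op i z \<kappa>)) = path_op i z (ident \<Lambda> v)"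
      unfolding path_op_ident[OF ck_range_projections(3)]
      by (subst op_alg_finsum[OF fin]) (auto simp: path_op_range[OF M z] sum cong: sum.cong)
    then show ?thesis using ck_range_projections by simp
  qed (auto simp: path_op_ident op_alg_simps fun_eq_iff)
  then show ?thesis using op_pair_path_op[OF _ z] by (auto simp: ck_family_def op_alg_simps(1))
qed

section \<open>Perturbations of rank one elements\<close>

text \<open>Gaussian elimination: more unknowns than equations leave a nonzero solution. It will
  supply a linear dependence among powers of an element of a finite-dimensional space.\<close>

lemma homogeneous_system_solution:
  fixes c :: "'j \<Rightarrow> 'b \<Rightarrow> complex"
  assumes "finite B" "finite J" "card B < card J"
  shows "\<exists>d. (\<exists>j\<in>J. d j \<noteq> 0) \<and> (\<forall>b\<in>B. (\<Sum>j\<in>J. d j * c j b) = 0)"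
  using assms
proof (induction B arbitrary: J c rule: finite_induct)
  case empty
  then have "J \<noteq> {}" by auto
  then show ?case by (intro exI[of _ "\<lambda>_. 1"]) auto
next
  case (insert b B)
  show ?case
  proof (cases "\<forall>j\<in>J. c j b = 0")
    case True
    then show ?thesis using insert.IH[of J c] insert.prems insert.hyps by auto
  next
    case False
    then obtain j0 where j0: "j0 \<in> J" "c j0 b \<noteq> 0" by blast
    let ?J = "J - {j0}"
    have "card B < card ?J" using insert.prems insert.hyps j0 by simp
    from insert.IH[OF _ this, of "\<lambda>j b'. c j b' - c j b / c j0 b * c j0 b'"] insert.prems
    obtain d where d: "\<exists>j\<in>?J. d j \<noteq> 0" "\<And>b'. b' \<in> B \<Longrightarrow> (\<Sum>j\<in>?J. d j * (c j b' - c j b / c j0 b * c j0 b')) = 0"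
      by auto
    \<comment> \<open>The eliminated unknown is chosen to solve the equation for \<open>b\<close>;
      in all other equations it has been substituted already.\<close>
    define d' where "d' = d(j0 := - (\<Sum>j\<in>?J. d j * (c j b / c j0 b)))"
    have "(\<Sum>j\<in>J. d' j * c j b') = (\<Sum>j\<in>?J. d j * (c j b' - c j b / c j0 b * c j0 b'))" for b'
    proof -
      have "(\<Sum>j\<in>J. d' j * c j b') = d' j0 * c j0 b' + (\<Sum>j\<in>?J. d' j * c j b')"
        using insert.prems j0 by (simp add: sum.remove)
      also have "(\<Sum>j\<in>?J. d' j * c j b') = (\<Sum>j\<in>?J. d j * c j b')"
        by (rule sum.cong) (auto simp: d'_def)
      finally show ?thesis
        by (simp add: d'_def sum_subtractf right_diff_distrib sum_distrib_right mult.assoc)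
    qed
    then have "\<forall>b'\<in>insert b B. (\<Sum>j\<in>J. d' j * c j b') = 0" using d(2) j0(2) by simp
    moreover have "\<exists>j\<in>J. d' j \<noteq> 0" using d(1) by (auto simp: d'_def)
    ultimately show ?thesis by blast
  qed
qed

text \<open>
  Functionals that behave like \<open>x \<mapsto> \<langle>\<pi>\<^sub>t(x)e, e\<rangle>\<close> for representations \<open>\<pi>\<^sub>t\<close> in which \<open>V\<close> is \<open>\<omega>(t)\<close> times the
  projection onto the line spanned by the unit vector \<open>e\<close>.
\<close>

locale rank_one_functionals = cstar_algebra A for A :: "'c cstar_alg" (structure) +
  fixes V :: 'c and \<theta> :: "real \<Rightarrow> 'c \<Rightarrow> complex" and \<omega> :: "real \<Rightarrow> complex"
  assumes V [simp]: "V \<in> carrier A"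
    and \<theta>_add: "\<lbrakk>x \<in> carrier A; y \<in> carrier A\<rbrakk> \<Longrightarrow> \<theta> t (x \<oplus> y) = \<theta> t x + \<theta> t y"
    and \<theta>_smult: "x \<in> carrier A \<Longrightarrow> \<theta> t (c \<odot> x) = c * \<theta> t x"
    and \<theta>_bound: "x \<in> carrier A \<Longrightarrow> cmod (\<theta> t x) \<le> nrm A x"
    and \<theta>_V: "\<theta> t V = \<omega> t"
    and \<theta>_V_left: "x \<in> carrier A \<Longrightarrow> \<theta> t (V \<otimes> x) = \<omega> t * \<theta> t x"
    and \<theta>_V_right: "x \<in> carrier A \<Longrightarrow> \<theta> t (x \<otimes> V) = \<omega> t * \<theta> t x"
    and \<theta>_V_middle: "\<lbrakk>x \<in> carrier A; y \<in> carrier A\<rbrakk> \<Longrightarrow> \<theta> t (x \<otimes> V \<otimes> y) = \<omega> t * \<theta> t x * \<theta> t y"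
    and \<theta>_continuous: "x \<in> carrier A \<Longrightarrow> continuous_on UNIV (\<lambda>t. \<theta> t x)"
    and \<omega>_norm: "cmod (\<omega> t) = 1"
    and \<omega>_antipodal: "\<exists>s t. \<omega> s = - \<omega> t"
begin

sublocale N: cstar_seminormed A "nrm A"
  by (intro cstar_seminormed.intro cstar_seminormed_axioms.intro star_algebra_axioms cstar_norm)

text \<open>\<open>pw y n\<close> is the power y^(n+1): the algebra need not have a unit, so powers
  start at y itself.\<close>

primrec pw :: "'c \<Rightarrow> nat \<Rightarrow> 'c" where
  "pw y 0 = y"
| "pw y (Suc n) = y \<otimes> pw y n"

lemma pw_closed: "y \<in> carrier A \<Longrightarrow> pw y n \<in> carrier A"
  by (induction n) auto

lemma pw_mult: "y \<in> carrier A \<Longrightarrow> pw y i \<otimes> pw y j = pw y (Suc (i + j))"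
  by (induction i) (simp_all add: mult_assoc pw_closed)

lemma functional_finsum:
  fixes L :: "'c \<Rightarrow> complex"
  assumes "\<And>x y. x \<in> carrier A \<Longrightarrow> y \<in> carrier A \<Longrightarrow> L (x \<oplus> y) = L x + L y"
    and "\<And>c x. x \<in> carrier A \<Longrightarrow> L (c \<odot> x) = c * L x"
    and "finite B" "B \<subseteq> carrier A"
  shows "L (\<Oplus>b\<in>B. c b \<odot> b) = (\<Sum>b\<in>B. c b * L b)"
  using assms(3,4)
proof (induction B rule: finite_induct)
  case empty
  have "L (0 \<odot> \<zero>) = 0 * L \<zero>" by (rule assms(2)) simp
  then have "L \<zero> = 0" using smult_r_null[of 0] by simp
  then show ?case by simp
next
  case (insert b B)
  then have "(\<lambda>b. c b \<odot> b) \<in> B \<rightarrow> carrier A" "c b \<odot> b \<in> carrier A" by auto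
  then show ?case using insert by (simp add: M.finsum_insert M.finsum_closed assms)
qed

end

text \<open>
  If \<open>y\<close> is close to \<open>V\<close>, then each \<open>\<pi>\<^sub>t(y)\<close> has exactly one eigenvalue near \<open>\<omega>(t)\<close>. Power iteration computes
  it as the limit of \<open>\<theta>\<^sub>t(y\<^sup>n\<^sup>+\<^sup>1) / \<theta>\<^sub>t(y\<^sup>n)\<close>, uniformly in \<open>t\<close>, so that it depends continuously on \<open>t\<close>.
\<close>

locale rank_one_perturbation = rank_one_functionals A V \<theta> \<omega>
  for A :: "'c cstar_alg" (structure) and V \<theta> \<omega> +
  fixes y :: 'c
  assumes y [simp]: "y \<in> carrier A" and y_close: "nrm A (y \<ominus> V) \<le> 1/10"
begin

definition \<delta> :: 'c where "\<delta> = y \<ominus> V"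

definition moment :: "real \<Rightarrow> nat \<Rightarrow> complex" where "moment t n = \<theta> t (pw y n)"

text \<open>The vector y^(n+1)e rescaled to have e-coordinate 1, seen through the e-coordinate of b
  applied to it. Power iteration makes these functionals converge.\<close>

definition \<psi> :: "real \<Rightarrow> nat \<Rightarrow> 'c \<Rightarrow> complex" where "\<psi> t n b = \<theta> t (b \<otimes> pw y n) / moment t n"

definition ratio :: "real \<Rightarrow> nat \<Rightarrow> complex" where "ratio t n = moment t (Suc n) / moment t n"

lemma pw_carrier [simp]: "pw y n \<in> carrier A"
  by (simp add: pw_closed)

lemma \<delta> [simp]: "\<delta> \<in> carrier A"
  by (simp add: \<delta>_def)

lemma \<delta>_norm: "nrm A \<delta> \<le> 1/10"
  using y_close by (simp add: \<delta>_def)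

lemma V_plus_\<delta>: "V \<oplus> \<delta> = y"
proof -
  have "V \<oplus> (y \<oplus> \<ominus> V) = y \<oplus> (V \<oplus> \<ominus> V)" by (simp add: M.a_lcomm)
  then show ?thesis by (simp add: \<delta>_def a_minus_def M.r_neg)
qed

lemma \<theta>_y_left:
  assumes "x \<in> carrier A"
  shows "\<theta> t (y \<otimes> x) = \<omega> t * \<theta> t x + \<theta> t (\<delta> \<otimes> x)"
proof -
  have "\<theta> t ((V \<oplus> \<delta>) \<otimes> x) = \<omega> t * \<theta> t x + \<theta> t (\<delta> \<otimes> x)"
    using assms by (simp add: mult_l_distr \<theta>_add \<theta>_V_left)
  then show ?thesis by (simp only: V_plus_\<delta>)
qed

lemma \<theta>_y_right:
  assumes "x \<in> carrier A"
  shows "\<theta> t (x \<otimes> y) = \<omega> t * \<theta> t x + \<theta> t (x \<otimes> \<delta>)"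
proof -
  have "\<theta> t (x \<otimes> (V \<oplus> \<delta>)) = \<omega> t * \<theta> t x + \<theta> t (x \<otimes> \<delta>)"
    using assms by (simp add: mult_r_distr \<theta>_add \<theta>_V_right)
  then show ?thesis by (simp only: V_plus_\<delta>)
qed

lemma \<theta>_y_middle:
  assumes "b \<in> carrier A" "x \<in> carrier A"
  shows "\<theta> t (b \<otimes> (y \<otimes> x)) = \<omega> t * \<theta> t b * \<theta> t x + \<theta> t (b \<otimes> \<delta> \<otimes> x)"
proof -
  have "b \<otimes> ((V \<oplus> \<delta>) \<otimes> x) = b \<otimes> V \<otimes> x \<oplus> b \<otimes> \<delta> \<otimes> x"
    using assms by (simp add: mult_l_distr mult_r_distr mult_assoc)
  then have "\<theta> t (b \<otimes> ((V \<oplus> \<delta>) \<otimes> x)) = \<omega> t * \<theta> t b * \<theta> t x + \<theta> t (b \<otimes> \<delta> \<otimes> x)"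
    using assms by (simp add: \<theta>_add \<theta>_V_middle)
  then show ?thesis by (simp only: V_plus_\<delta>)
qed

lemma nrm_mult_\<delta>: "b \<in> carrier A \<Longrightarrow> nrm A (b \<otimes> \<delta>) \<le> nrm A b / 10"
  using N.sn_mult[of b \<delta>] mult_left_mono[OF \<delta>_norm N.sn_nonneg, of b] by simp

text \<open>In effect y^(n+1)e stays in a cone around e. The two claims need each other: the bound
  for b = \<delta> keeps the e-coordinate from shrinking by more than the factor 4/5, and this lower
  bound restores the constant 2 for the next power.\<close>

lemma moment_bounds:
  "moment t n \<noteq> 0 \<and> (\<forall>b\<in>carrier A. cmod (\<theta> t (b \<otimes> pw y n)) \<le> 2 * cmod (moment t n) * nrm A b)"
proof (induction n)
  case 0
  have "moment t 0 = \<omega> t + \<theta> t \<delta>" unfolding moment_def using \<theta>_add[of V \<delta> t] by (simp add: V_plus_\<delta> \<theta>_V)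
  moreover have "cmod (\<theta> t \<delta>) \<le> 1/10" using \<theta>_bound[of \<delta> t] \<delta>_norm by simp
  ultimately have m: "cmod (moment t 0) \<ge> 9/10"
    using norm_triangle_ineq4[of "\<omega> t + \<theta> t \<delta>" "\<theta> t \<delta>"] \<omega>_norm[of t] by simp
  have "cmod (\<theta> t (b \<otimes> y)) \<le> 2 * cmod (moment t 0) * nrm A b" if b: "b \<in> carrier A" for b
  proof -
    have "cmod (\<theta> t (b \<otimes> y)) \<le> cmod (\<omega> t * \<theta> t b) + cmod (\<theta> t (b \<otimes> \<delta>))"
      using \<theta>_y_right[OF b] norm_triangle_ineq by metis
    also have "\<dots> \<le> nrm A b + nrm A b / 10"
      using \<theta>_bound[OF b, of t] \<theta>_bound[of "b \<otimes> \<delta>" t] nrm_mult_\<delta>[OF b] b \<omega>_norm[of t] by (simp add: norm_mult)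
    also have "\<dots> \<le> (9/5) * nrm A b" using N.sn_nonneg[OF b] by simp
    also have "\<dots> \<le> 2 * cmod (moment t 0) * nrm A b"
      using m by (intro mult_right_mono N.sn_nonneg[OF b]) simp
    finally show ?thesis .
  qed
  then show ?case using m by auto
next
  case (Suc n)
  define m where "m = cmod (moment t n)"
  have m0: "m > 0" and I: "\<And>b. b \<in> carrier A \<Longrightarrow> cmod (\<theta> t (b \<otimes> pw y n)) \<le> 2 * m * nrm A b"
    using Suc by (auto simp: m_def)
  have e: "moment t (Suc n) = \<omega> t * moment t n + \<theta> t (\<delta> \<otimes> pw y n)"
    unfolding moment_def using \<theta>_y_left[of "pw y n" t] by simp
  have "cmod (\<theta> t (\<delta> \<otimes> pw y n)) \<le> 2 * m * (1/10)"
    by (rule order_trans[OF I[OF \<delta>]]) (use \<delta>_norm m0 in simp)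
  then have m1: "cmod (moment t (Suc n)) \<ge> 4/5 * m"
    using norm_triangle_ineq4[of "moment t (Suc n)" "\<theta> t (\<delta> \<otimes> pw y n)"] \<omega>_norm[of t]
    by (simp add: e norm_mult m_def)
  have "cmod (\<theta> t (b \<otimes> pw y (Suc n))) \<le> 2 * cmod (moment t (Suc n)) * nrm A b" if b: "b \<in> carrier A" for b
  proof -
    have "cmod (\<theta> t (b \<otimes> pw y (Suc n))) \<le> cmod (\<omega> t * \<theta> t b * moment t n) + cmod (\<theta> t (b \<otimes> \<delta> \<otimes> pw y n))"
      using \<theta>_y_middle[OF b pw_carrier[of n], of t] norm_triangle_ineq unfolding moment_def by (metis pw.simps(2))
    also have "\<dots> \<le> nrm A b * m + 2 * m * (nrm A b / 10)"
    proof (rule add_mono)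
      show "cmod (\<omega> t * \<theta> t b * moment t n) \<le> nrm A b * m"
        using \<theta>_bound[OF b, of t] \<omega>_norm[of t] m0 by (simp add: norm_mult m_def)
      show "cmod (\<theta> t (b \<otimes> \<delta> \<otimes> pw y n)) \<le> 2 * m * (nrm A b / 10)"
        by (rule order_trans[OF I]) (use nrm_mult_\<delta>[OF b] m0 b in simp_all)
    qed
    \<comment> \<open>The factor is 1 + 2/10 = 6/5, below the 2 * 4/5 = 8/5 that the lower bound for
      the next moment provides.\<close>
    also have "\<dots> = (6/5 * m) * nrm A b" by simp
    also have "\<dots> \<le> 2 * cmod (moment t (Suc n)) * nrm A b"
      using m0 m1 by (intro mult_right_mono N.sn_nonneg[OF b]) simp
    finally show ?thesis .
  qed
  then show ?case using m0 m1 by auto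
qed

lemma moment_nonzero: "moment t n \<noteq> 0"
  using moment_bounds by blast

lemma \<psi>_bound: "b \<in> carrier A \<Longrightarrow> cmod (\<psi> t n b) \<le> 2 * nrm A b"
  using moment_bounds[of t n] by (simp add: \<psi>_def norm_divide field_simps)

lemma ratio_eq: "ratio t n = \<omega> t + \<psi> t n \<delta>"
  using \<theta>_y_left[of "pw y n" t] moment_nonzero[of t n] unfolding ratio_def \<psi>_def moment_def
  by (simp add: field_simps)

lemma ratio_close: "cmod (ratio t n - \<omega> t) \<le> 1/5"
  using \<psi>_bound[of \<delta> t n] \<delta>_norm by (simp add: ratio_eq)

lemma ratio_large: "cmod (ratio t n) \<ge> 4/5"
  using ratio_close[of t n] norm_triangle_ineq4[of "ratio t n" "ratio t n - \<omega> t"] \<omega>_norm[of t] by simp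

text \<open>Splitting the first factor y as V + \<delta> collapses the V-part to the line of e; only
  the \<delta>-part still sees the previous iterate, with a further factor of size 1/10.\<close>

lemma \<psi>_Suc:
  assumes b: "b \<in> carrier A"
  shows "\<psi> t (Suc n) b * ratio t n = \<omega> t * \<theta> t b + \<psi> t n (b \<otimes> \<delta>)"
proof -
  have "\<psi> t (Suc n) b * ratio t n = \<theta> t (b \<otimes> (y \<otimes> pw y n)) / moment t n"
    using moment_nonzero[of t "Suc n"] by (simp add: \<psi>_def ratio_def)
  also have "\<dots> = \<omega> t * \<theta> t b + \<psi> t n (b \<otimes> \<delta>)"
    unfolding \<theta>_y_middle[OF b pw_carrier] using moment_nonzero[of t n]
    by (simp add: \<psi>_def add_divide_distrib moment_def[symmetric])
  finally show ?thesis .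
qed

lemma \<psi>_contraction:
  "b \<in> carrier A \<Longrightarrow> cmod (\<psi> t (Suc n) b - \<psi> t n b) \<le> 4 * (1/2)^n * nrm A b"
proof (induction n arbitrary: b)
  case 0
  then show ?case
    using norm_triangle_ineq4[of "\<psi> t (Suc 0) b" "\<psi> t 0 b"] \<psi>_bound[of b t 0] \<psi>_bound[of b t "Suc 0"] by simp
next
  case (Suc n)
  note b = Suc.prems
  define D :: real where "D = 4 * (1/2)^n"
  have D: "D \<ge> 0" by (simp add: D_def)
  let ?r = "ratio t (Suc n)"
  \<comment> \<open>Subtract the recursions of \<open>\<psi>_Suc\<close> for two consecutive
    indices. The term \<omega>\<theta>(b) cancels, and the change of the ratio is a difference of
    \<psi> at \<delta>.\<close>
  have "(\<psi> t (Suc (Suc n)) b - \<psi> t (Suc n) b) * ?r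
      = (\<psi> t (Suc n) (b \<otimes> \<delta>) - \<psi> t n (b \<otimes> \<delta>)) - \<psi> t (Suc n) b * (\<psi> t (Suc n) \<delta> - \<psi> t n \<delta>)"
    using \<psi>_Suc[OF b, of t "Suc n"] \<psi>_Suc[OF b, of t n] ratio_eq[of t n] ratio_eq[of t "Suc n"]
    by (simp add: algebra_simps)
  then have "cmod (\<psi> t (Suc (Suc n)) b - \<psi> t (Suc n) b) * cmod ?r \<le>
      cmod (\<psi> t (Suc n) (b \<otimes> \<delta>) - \<psi> t n (b \<otimes> \<delta>)) + cmod (\<psi> t (Suc n) b) * cmod (\<psi> t (Suc n) \<delta> - \<psi> t n \<delta>)"
    using norm_triangle_ineq4 by (metis norm_mult)
  also have "\<dots> \<le> D * (nrm A b / 10) + 2 * nrm A b * (D * (1/10))"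
  proof (intro add_mono mult_mono)
    show "cmod (\<psi> t (Suc n) (b \<otimes> \<delta>) - \<psi> t n (b \<otimes> \<delta>)) \<le> D * (nrm A b / 10)"
      by (rule order_trans[OF Suc.IH]) (use b mult_left_mono[OF nrm_mult_\<delta>[OF b] D] in \<open>simp_all add: D_def[symmetric]\<close>)
    show "cmod (\<psi> t (Suc n) \<delta> - \<psi> t n \<delta>) \<le> D * (1/10)"
      by (rule order_trans[OF Suc.IH[OF \<delta>]]) (use mult_left_mono[OF \<delta>_norm D] in \<open>simp add: D_def[symmetric]\<close>)
  qed (use \<psi>_bound[OF b] N.sn_nonneg[OF b] in auto)
  \<comment> \<open>The error 1/10 + 2/10 is written as 3/8 * 4/5 because 4/5 is the lower bound for
    the ratio divided out below; 3/8 < 1/2 gives the halving.\<close>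
  also have "\<dots> = 3/8 * D * nrm A b * (4/5)" by simp
  also have "\<dots> \<le> 1/2 * D * nrm A b * (4/5)"
    using D N.sn_nonneg[OF b] by (intro mult_right_mono) auto
  also have "\<dots> \<le> 1/2 * D * nrm A b * cmod ?r"
    using ratio_large D N.sn_nonneg[OF b] by (intro mult_left_mono) auto
  finally have "cmod (\<psi> t (Suc (Suc n)) b - \<psi> t (Suc n) b) \<le> 1/2 * D * nrm A b"
    by (rule mult_right_le_imp_le) (use ratio_large[of t "Suc n"] in linarith)
  then show ?case by (simp add: D_def)
qed

text \<open>The increments of \<open>ratio\<close> are dominated by a geometric series independent
  of t, so the Weierstrass M-test applies to their sum.\<close>

lemma ratio_uniform_limit: "\<exists>l. uniform_limit UNIV (\<lambda>n t. ratio t n) l sequentially"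
proof -
  define g where "g n t = ratio t (Suc n) - ratio t n" for n t
  have "cmod (g n t) \<le> (1/2)^n" for n t
  proof -
    have "cmod (g n t) = cmod (\<psi> t (Suc n) \<delta> - \<psi> t n \<delta>)" by (simp add: g_def ratio_eq)
    also have "\<dots> \<le> 4 * (1/2)^n * (1/10)"
      by (rule order_trans[OF \<psi>_contraction[OF \<delta>]]) (use \<delta>_norm in simp)
    also have "\<dots> \<le> (1/2)^n" by simp
    finally show ?thesis .
  qed
  then have "uniform_limit UNIV (\<lambda>n t. \<Sum>i<n. g i t) (\<lambda>t. \<Sum>i. g i t) sequentially"
    by (intro Weierstrass_m_test[where M = "\<lambda>n. (1/2)^n"]) (auto intro: summable_geometric)
  moreover have "(\<Sum>i<n. g i t) = ratio t n - ratio t 0" for n t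
    unfolding g_def by (rule sum_lessThan_telescope)
  ultimately have "uniform_limit UNIV (\<lambda>n t. (ratio t n - ratio t 0) + ratio t 0) (\<lambda>t. (\<Sum>i. g i t) + ratio t 0) sequentially"
    by (intro uniform_limit_add uniform_limit_const) simp
  then show ?thesis by auto
qed

text \<open>A linear relation among the powers of y is a recurrence for the moments, with the same
  coefficients for every t. Dividing by a moment and passing to the limit makes the eigenvalue
  \<open>l t\<close> a root of one fixed polynomial.\<close>

lemma not_algebraic:
  assumes W: "finite_dimensional A W" "W \<subseteq> carrier A" and pw: "\<And>n. pw y n \<in> W"
  shows False
proof -
  obtain l where l: "uniform_limit UNIV (\<lambda>n t. ratio t n) l sequentially" using ratio_uniform_limit by blast
  have "continuous_on UNIV (\<lambda>t. ratio t n)" for n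
    unfolding ratio_def moment_def
    using moment_nonzero by (intro continuous_on_divide \<theta>_continuous) (auto simp: moment_def pw_closed)
  then have cont: "continuous_on UNIV l"
    by (intro uniform_limit_theorem[OF _ l]) auto
  have lim: "(\<lambda>n. ratio t n) \<longlonglongrightarrow> l t" for t
    by (rule tendsto_uniform_limitI[OF l]) simp
  have close: "cmod (l t - \<omega> t) \<le> 1/5" for t
    by (rule LIMSEQ_le_const2[OF tendsto_norm[OF tendsto_diff[OF lim tendsto_const]]])
       (use ratio_close in auto)
  have powers: "(\<lambda>n. moment t (n + j) / moment t n) \<longlonglongrightarrow> l t ^ j" for t j
  proof (induction j)
    case 0
    then show ?case using moment_nonzero by simp
  next
    case (Suc j)
    have "(\<lambda>n. moment t (n + Suc j) / moment t n) = (\<lambda>n. ratio t (n + j) * (moment t (n + j) / moment t n))"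
      using moment_nonzero by (simp add: ratio_def)
    then show ?case
      unfolding power_Suc by (simp only:) (intro tendsto_mult LIMSEQ_ignore_initial_segment[OF lim] Suc)
  qed
  obtain B where B: "finite B" "B \<subseteq> W" "\<And>x. x \<in> W \<Longrightarrow> \<exists>c. x = (\<Oplus>b\<in>B. c b \<odot> b)"
    using W(1) by (auto simp: finite_dimensional_def)
  obtain c where c: "\<And>j. pw y j = (\<Oplus>b\<in>B. c j b \<odot> b)" using B(3)[OF pw] by metis
  \<comment> \<open>The card B + 1 powers \<open>pw y 0\<close>, ..., \<open>pw y (card B)\<close>
    lie in the span of \<open>B\<close>, so their coordinate vectors are dependent.\<close>
  obtain d where d: "\<exists>j\<le>card B. d j \<noteq> 0" "\<And>b. b \<in> B \<Longrightarrow> (\<Sum>j\<le>card B. d j * c j b) = 0"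
    using homogeneous_system_solution[OF B(1), of "{..card B}" c] by auto
  \<comment> \<open>The index \<open>Suc n + j\<close> comes from the product of y^(j+1) and
    y^(n+1), which is \<open>pw y (Suc (j + n))\<close>.\<close>
  have recurrence: "(\<Sum>j\<le>card B. d j * moment t (Suc n + j)) = 0" for t n
  proof -
    have "moment t (Suc n + j) = (\<Sum>b\<in>B. c j b * \<theta> t (b \<otimes> pw y n))" for j
    proof -
      have "moment t (Suc n + j) = \<theta> t (pw y j \<otimes> pw y n)"
        by (simp add: moment_def pw_mult add.commute)
      also have "\<dots> = (\<Sum>b\<in>B. c j b * \<theta> t (b \<otimes> pw y n))"
        unfolding c[of j]
        by (rule functional_finsum) (use B W in \<open>auto simp: mult_l_distr mult_smult_left \<theta>_add \<theta>_smult\<close>)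
      finally show ?thesis .
    qed
    then have "(\<Sum>j\<le>card B. d j * moment t (Suc n + j)) = (\<Sum>j\<le>card B. \<Sum>b\<in>B. d j * c j b * \<theta> t (b \<otimes> pw y n))"
      by (simp add: sum_distrib_left mult.assoc)
    also have "\<dots> = (\<Sum>b\<in>B. (\<Sum>j\<le>card B. d j * c j b) * \<theta> t (b \<otimes> pw y n))"
      by (subst sum.swap) (simp add: sum_distrib_right)
    finally show ?thesis by (simp add: d(2))
  qed
  have root: "(\<Sum>j\<le>card B. d j * l t ^ j) = 0" for t
  proof -
    have "(\<lambda>n. \<Sum>j\<le>card B. d j * (moment t (Suc n + j) / moment t (Suc n))) \<longlonglongrightarrow> (\<Sum>j\<le>card B. d j * l t ^ j)"
      by (intro tendsto_sum tendsto_mult_left LIMSEQ_Suc[OF powers])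
    moreover have "(\<Sum>j\<le>card B. d j * (moment t (Suc n + j) / moment t (Suc n))) = 0" for n
      using recurrence[of t n] by (simp add: sum_divide_distrib[symmetric])
    ultimately show ?thesis by (simp add: LIMSEQ_const_iff)
  qed
  have "finite {x. (\<Sum>j\<le>card B. d j * x ^ j) = 0}" using d(1) polyfun_finite_roots by blast
  then have "finite (l ` UNIV)" by (rule finite_subset[rotated]) (use root in auto)
  \<comment> \<open>A continuous function on the connected real line with finitely many values is
    constant.\<close>
  then have "l constant_on UNIV"
    using continuous_finite_range_constant[OF _ cont] by (simp add: connected_UNIV)
  then obtain k where k: "\<And>t. l t = k" by (auto simp: constant_on_def)
  obtain s t where st: "\<omega> s = - \<omega> t" using \<omega>_antipodal by blast
  \<comment> \<open>One constant cannot lie within 1/5 of two numbers of modulus 1 that are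
    antipodal.\<close>
  have "cmod ((k - \<omega> s) - (k - \<omega> t)) \<le> 2/5"
    using norm_triangle_ineq4[of "k - \<omega> s" "k - \<omega> t"] close[of s] close[of t] by (simp add: k)
  moreover have "(k - \<omega> s) - (k - \<omega> t) = 2 * \<omega> t" by (simp add: st)
  ultimately show False using \<omega>_norm[of t] by (simp add: norm_mult)
qed

end

text \<open>One member of the sequence already contains an element within 1/10 of V and, being a
  subalgebra, all its powers.\<close>

lemma (in rank_one_functionals) not_AF: "\<not> AF_algebra A"
proof
  assume "AF_algebra A"
  then obtain F :: "nat \<Rightarrow> 'c set" where F: "\<And>n. cstar_subalgebra A (F n)" "\<And>n. finite_dimensional A (F n)"
    "\<And>x e. x \<in> carrier A \<Longrightarrow> e > 0 \<Longrightarrow> \<exists>n. \<exists>y\<in>F n. nrm A (x \<ominus> y) < e"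
    unfolding AF_algebra_def by blast
  obtain n y where yF: "y \<in> F n" "nrm A (V \<ominus> y) < 1/10" using F(3)[OF V, of "1/10"] by auto
  have sub: "F n \<subseteq> carrier A" and mult: "\<And>x z. x \<in> F n \<Longrightarrow> z \<in> F n \<Longrightarrow> x \<otimes> z \<in> F n"
    using F(1)[of n] by (auto simp: cstar_subalgebra_def)
  have "y \<in> carrier A" using yF(1) sub by blast
  moreover from this have "nrm A (y \<ominus> V) \<le> 1/10" using yF(2) N.sn_minus_comm[of y V] by simp
  ultimately interpret rank_one_perturbation A V \<theta> \<omega> y by unfold_locales
  have "pw y m \<in> F n" for m by (induction m) (simp_all add: yF(1) mult)
  then show False using not_algebraic[OF F(2) sub] by blast
qed

section \<open>Extending functionals to the completion\<close>

locale bounded_functional = cstar_seminormed A \<rho> for A :: "('c, 'b) star_alg_scheme" (structure) and \<rho> +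
  fixes L :: "'c \<Rightarrow> complex"
  assumes L_add: "\<lbrakk>x \<in> carrier A; y \<in> carrier A\<rbrakk> \<Longrightarrow> L (x \<oplus> y) = L x + L y"
    and L_smult: "x \<in> carrier A \<Longrightarrow> L (c \<odot> x) = c * L x"
    and L_bound: "x \<in> carrier A \<Longrightarrow> cmod (L x) \<le> \<rho> x"
begin

definition ext_functional :: "(nat \<Rightarrow> 'c) set \<Rightarrow> complex" where
  "ext_functional P = (THE l. \<forall>X\<in>CS. cls X = P \<longrightarrow> (\<lambda>n. L (X n)) \<longlonglongrightarrow> l)"

lemma L_diff_bound:
  assumes "x \<in> carrier A" "y \<in> carrier A"
  shows "cmod (L x - L y) \<le> \<rho> (x \<ominus> y)"
proof -
  have "L (x \<ominus> y) = L x - L y" using assms by (simp add: minus_eq2 L_add L_smult)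
  then show ?thesis using L_bound[of "x \<ominus> y"] assms by simp
qed

text \<open>L is 1-Lipschitz for \<rho>, so it maps Cauchy sequences to Cauchy sequences and
  equivalent sequences to the same limit.\<close>

lemma ext_functional_limit:
  assumes X: "X \<in> CS"
  shows "(\<lambda>n. L (X n)) \<longlonglongrightarrow> ext_functional (cls X)"
proof -
  have "Cauchy (\<lambda>n. L (X n))"
  proof (rule CauchyI)
    fix e :: real assume "e > 0"
    from CS_D[OF X this] obtain N where N: "\<And>m n. m \<ge> N \<Longrightarrow> n \<ge> N \<Longrightarrow> \<rho> (X m \<ominus> X n) < e" by blast
    then show "\<exists>M. \<forall>m\<ge>M. \<forall>n\<ge>M. cmod (L (X m) - L (X n)) < e"
      using L_diff_bound CS_carrier[OF X] by (meson le_less_trans)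
  qed
  then obtain l where l: "(\<lambda>n. L (X n)) \<longlonglongrightarrow> l" using Cauchy_convergent convergent_def by blast
  have any: "(\<lambda>n. L (Y n)) \<longlonglongrightarrow> l" if Y: "Y \<in> CS" "cls Y = cls X" for Y
  proof -
    have d: "(\<lambda>n. \<rho> (Y n \<ominus> X n)) \<longlonglongrightarrow> 0" using cls_eq[OF Y(1) X] Y(2) by blast
    have "(\<lambda>n. L (Y n) - L (X n)) \<longlonglongrightarrow> 0"
      by (rule Lim_null_comparison[OF _ d]) (use L_diff_bound CS_carrier[OF X] CS_carrier[OF Y(1)] in simp)
    from tendsto_add[OF this l] show ?thesis by simp
  qed
  have "ext_functional (cls X) = l"
    unfolding ext_functional_def by (rule the_equality) (use any X LIMSEQ_unique l in blast)+
  then show ?thesis using l by simp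
qed

lemma ext_functional_unique:
  "X \<in> CS \<Longrightarrow> (\<lambda>n. L (X n)) \<longlonglongrightarrow> l \<Longrightarrow> ext_functional (cls X) = l"
  using ext_functional_limit LIMSEQ_unique by blast

lemma ext_functional_emb: "x \<in> carrier A \<Longrightarrow> ext_functional (emb x) = L x"
  unfolding emb_def by (rule ext_functional_unique) (simp_all add: CS_const)

lemma ext_functional_add:
  assumes "P \<in> carrier C" "Q \<in> carrier C"
  shows "ext_functional (P \<oplus>\<^bsub>C\<^esub> Q) = ext_functional P + ext_functional Q"
proof -
  obtain X Y where X: "X \<in> CS" "P = cls X" and Y: "Y \<in> CS" "Q = cls Y" using assms C_cases by meson
  show ?thesis
    unfolding X(2) Y(2) C_add[OF X(1) Y(1)]
    by (rule ext_functional_unique[OF CS_add[OF X(1) Y(1)]])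
       (use tendsto_add[OF ext_functional_limit[OF X(1)] ext_functional_limit[OF Y(1)]] in
         \<open>simp add: L_add CS_carrier X Y\<close>)
qed

lemma ext_functional_smult:
  assumes "P \<in> carrier C"
  shows "ext_functional (c \<odot>\<^bsub>C\<^esub> P) = c * ext_functional P"
proof -
  obtain X where X: "X \<in> CS" "P = cls X" using assms C_cases by meson
  show ?thesis
    unfolding X(2) C_smult[OF X(1)]
    by (rule ext_functional_unique[OF CS_smult[OF X(1)]])
       (use tendsto_mult_left[OF ext_functional_limit[OF X(1)], of c] in \<open>simp add: L_smult CS_carrier X\<close>)
qed

lemma ext_functional_bound:
  assumes "P \<in> carrier C"
  shows "cmod (ext_functional P) \<le> nrm C P"
proof -
  obtain X where X: "X \<in> CS" "P = cls X" using assms C_cases by meson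
  show ?thesis
    unfolding X(2)
    by (rule LIMSEQ_le[OF tendsto_norm[OF ext_functional_limit[OF X(1)]] C_nrm[OF X(1)]])
       (use L_bound CS_carrier[OF X(1)] in blast)
qed

text \<open>The error is controlled by \<rho> alone and not by L, which makes the approximation
  uniform over a family of functionals.\<close>

lemma ext_functional_approx:
  assumes X: "X \<in> CS" and N: "\<And>m. m \<ge> n \<Longrightarrow> \<rho> (X n \<ominus> X m) \<le> e"
  shows "cmod (L (X n) - ext_functional (cls X)) \<le> e"
  by (rule LIMSEQ_le_const2[OF tendsto_norm[OF tendsto_diff[OF tendsto_const ext_functional_limit[OF X]]]])
     (use N L_diff_bound CS_carrier[OF X] order_trans in blast)

lemma ext_functional_left:
  assumes e: "e \<in> carrier A" and P: "P \<in> carrier C" and L: "\<And>x. x \<in> carrier A \<Longrightarrow> L (e \<otimes> x) = k * L x"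
  shows "ext_functional (emb e \<otimes>\<^bsub>C\<^esub> P) = k * ext_functional P"
proof -
  obtain X where X: "X \<in> CS" "P = cls X" using P C_cases by meson
  have c: "(\<lambda>n. e) \<in> CS" by (rule CS_const[OF e])
  show ?thesis
    unfolding X(2) emb_def C_mult[OF c X(1)]
    by (rule ext_functional_unique[OF CS_mult[OF c X(1)]])
       (use tendsto_mult_left[OF ext_functional_limit[OF X(1)], of k] in \<open>simp add: L CS_carrier X\<close>)
qed

lemma ext_functional_right:
  assumes e: "e \<in> carrier A" and P: "P \<in> carrier C" and L: "\<And>x. x \<in> carrier A \<Longrightarrow> L (x \<otimes> e) = k * L x"
  shows "ext_functional (P \<otimes>\<^bsub>C\<^esub> emb e) = k * ext_functional P"
proof -
  obtain X where X: "X \<in> CS" "P = cls X" using P C_cases by meson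
  have c: "(\<lambda>n. e) \<in> CS" by (rule CS_const[OF e])
  show ?thesis
    unfolding X(2) emb_def C_mult[OF X(1) c]
    by (rule ext_functional_unique[OF CS_mult[OF X(1) c]])
       (use tendsto_mult_left[OF ext_functional_limit[OF X(1)], of k] in \<open>simp add: L CS_carrier X\<close>)
qed

lemma ext_functional_middle:
  assumes e: "e \<in> carrier A" and P: "P \<in> carrier C" and Q: "Q \<in> carrier C"
    and L: "\<And>x y. x \<in> carrier A \<Longrightarrow> y \<in> carrier A \<Longrightarrow> L (x \<otimes> e \<otimes> y) = k * L x * L y"
  shows "ext_functional (P \<otimes>\<^bsub>C\<^esub> emb e \<otimes>\<^bsub>C\<^esub> Q) = k * ext_functional P * ext_functional Q"
proof -
  obtain X Y where X: "X \<in> CS" "P = cls X" and Y: "Y \<in> CS" "Q = cls Y" using P Q C_cases by meson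
  have c: "(\<lambda>n. e) \<in> CS" by (rule CS_const[OF e])
  note Xc = CS_mult[OF X(1) c]
  show ?thesis
    unfolding X(2) Y(2) emb_def C_mult[OF X(1) c] C_mult[OF Xc Y(1)]
    by (rule ext_functional_unique[OF CS_mult[OF Xc Y(1)]])
       (use tendsto_mult[OF tendsto_mult_left[OF ext_functional_limit[OF X(1)], of k] ext_functional_limit[OF Y(1)]] in
         \<open>simp add: L CS_carrier X Y\<close>)
qed

end

lemma continuous_ext_functional:
  fixes L :: "real \<Rightarrow> 'c \<Rightarrow> complex"
  assumes L: "\<And>t. bounded_functional A \<rho> (L t)"
    and cont: "\<And>x. x \<in> carrier A \<Longrightarrow> continuous_on UNIV (\<lambda>t. L t x)"
    and P: "P \<in> carrier (completion A \<rho>)"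
  shows "continuous_on UNIV (\<lambda>t. bounded_functional.ext_functional A \<rho> (L t) P)"
proof -
  interpret B: bounded_functional A \<rho> "L 0" by (rule L)
  obtain X where X: "X \<in> B.CS" "P = B.cls X" using P B.C_cases by meson
  have "uniform_limit UNIV (\<lambda>n t. L t (X n)) (\<lambda>t. bounded_functional.ext_functional A \<rho> (L t) P) sequentially"
  proof (rule uniform_limitI)
    fix e :: real assume e: "e > 0"
    then obtain N where N: "\<And>m n. m \<ge> N \<Longrightarrow> n \<ge> N \<Longrightarrow> \<rho> (X m \<ominus>\<^bsub>A\<^esub> X n) < e/2"
      using B.CS_D[OF X(1), of "e/2"] by auto
    have "dist (L t (X n)) (bounded_functional.ext_functional A \<rho> (L t) P) < e" if n: "n \<ge> N" for n t
    proof -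
      have "cmod (L t (X n) - bounded_functional.ext_functional A \<rho> (L t) P) \<le> e/2"
        unfolding X(2) by (rule bounded_functional.ext_functional_approx[OF L X(1)])
          (use N[OF n] n in \<open>auto intro: less_imp_le\<close>)
      then show ?thesis using e by (simp add: dist_norm)
    qed
    then show "\<forall>\<^sub>F n in sequentially. \<forall>t\<in>UNIV. dist (L t (X n)) (bounded_functional.ext_functional A \<rho> (L t) P) < e"
      by (auto simp: eventually_sequentially)
  qed
  then show ?thesis
    by (rule uniform_limit_theorem[rotated]) (use cont B.CS_carrier[OF X(1)] in auto)
qed

section \<open>Periodic atoms obstruct approximate finite-dimensionality\<close>

text \<open>The target is a *-algebra with a C*-seminorm and no completeness is asked for, so that
  \<open>op_alg\<close> qualifies. Representations there are thereby bounded by the universal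
  seminorm.\<close>

lemma ck_seminorm_pullback:
  assumes k: "k_graph \<Lambda>" and B: "star_algebra B" and \<sigma>: "cstar_seminorm B \<sigma>" and T: "ck_family \<Lambda> B T"
  shows "ck_seminorm \<Lambda> (\<lambda>x. \<sigma> (free_eval.ev B T x))"
proof -
  interpret B: cstar_seminormed B \<sigma> by (intro cstar_seminormed.intro cstar_seminormed_axioms.intro B \<sigma>)
  interpret E: free_eval B "Mor \<Lambda>" T
    by (intro free_eval.intro free_eval_axioms.intro B) (use T in \<open>auto simp: ck_family_def\<close>)
  interpret EP: star_hom_pair "path_alg \<Lambda>" B E.ev
    by (intro star_hom_pair.intro star_hom_pair_axioms.intro star_algebra_free B E.ev_hom)
  have "\<sigma> (E.ev (x \<ominus>\<^bsub>path_alg \<Lambda>\<^esub> y)) = 0" if r: "(x, y) \<in> ck_relations \<Lambda> (path_alg \<Lambda>) free_gen" for x y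
  proof -
    have "(E.ev x, E.ev y) \<in> ck_relations \<Lambda> B T"
      by (rule EP.ck_rel_image[OF k free_gen_carrier E.ev_gen r])
    then have "E.ev x = E.ev y" using T by (auto simp: ck_family_def)
    then show ?thesis using ck_rel_closed_free[OF k r] EP.hom_minus B.sn_minus_self E.ev_closed by simp
  qed
  moreover have "cstar_seminorm (path_alg \<Lambda>) (\<lambda>x. \<sigma> (E.ev x))"
    by (simp add: cstar_seminorm_def E.ev_closed E.ev_add E.ev_smult E.ev_mult E.ev_star
        free_star_closed
        B.sn_nonneg B.sn_tri B.sn_scale B.sn_mult B.sn_cstar)
  ultimately show ?thesis unfolding ck_seminorm_def by auto
qed

text \<open>The coordinate \<open>i\<close> is the one through which the gauge action twists the
  representation; \<open>deg_neq\<close> makes the twist visible on the pair \<alpha>,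
  \<beta>.\<close>

locale unique_infinite_path = row_finite_k_graph \<Lambda> for \<Lambda> :: "('o, 'm, 'k::finite) kgraph" +
  fixes v :: 'o and \<alpha> \<beta> :: 'm and i :: 'k
  assumes v: "v \<in> Obj \<Lambda>"
    and uniq: "\<lbrakk>\<kappa> \<in> paths_from \<Lambda> v; \<mu> \<in> paths_from \<Lambda> v; deg \<Lambda> \<kappa> = deg \<Lambda> \<mu>\<rbrakk> \<Longrightarrow> \<kappa> = \<mu>"
    and \<alpha>: "\<alpha> \<in> paths_from \<Lambda> v" and \<beta>: "\<beta> \<in> paths_from \<Lambda> v"
    and src_eq: "src \<Lambda> \<alpha> = src \<Lambda> \<beta>" and deg_neq: "deg \<Lambda> \<alpha> i \<noteq> deg \<Lambda> \<beta> i"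
begin

section \<open>The rank one element at a vertex with one infinite path\<close>

definition the_path :: "('k \<Rightarrow> nat) \<Rightarrow> 'm" where
  "the_path n = (SOME \<kappa>. \<kappa> \<in> paths_from_deg \<Lambda> v n)"

lemma the_path_in: "the_path n \<in> paths_from_deg \<Lambda> v n"
  unfolding the_path_def using paths_from_deg_nonempty[OF v] some_in_eq by blast

lemma the_path_ipaths: "the_path \<in> ipaths" and irng_the_path: "irng the_path = v"
proof -
  have "is_prefix (the_path n) (the_path m)" if "n \<le> m" for n m
  proof -
    have "the_path m \<in> Mor \<Lambda>" "n \<le> deg \<Lambda> (the_path m)" using the_path_in[of m] that by (auto simp: paths_from_deg_iff)
    then obtain \<kappa> where \<kappa>: "is_prefix \<kappa> (the_path m)" "deg \<Lambda> \<kappa> = n" by (rule is_prefix_exists)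
    then have "\<kappa> = the_path n"
      using the_path_in[of m] the_path_in[of n] is_prefix_Mor[OF \<kappa>(1)] is_prefix_rng[OF \<kappa>(1)]
      by (intro uniq) (simp_all add: paths_from_deg_iff paths_from_def)
    then show ?thesis using \<kappa>(1) by simp
  qed
  then show "the_path \<in> ipaths" using the_path_in by (simp add: ipaths_def paths_from_deg_iff)
  show "irng the_path = v" using the_path_in[of 0] by (simp add: irng_def paths_from_deg_iff)
qed

lemma ipath_eq_the_path: "y \<in> ipaths \<Longrightarrow> irng y = v \<Longrightarrow> y = the_path"
  by (rule ext, rule uniq)
     (use the_path_ipaths irng_the_path in \<open>simp_all add: ipathsD paths_from_def\<close>)

text \<open>Every path from v is an initial segment of the only infinite path from v. Hence the
  range projections of \<alpha> and \<beta> have rank one, with the same range.\<close>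

lemma cylinder_the_path: "\<kappa> \<in> paths_from \<Lambda> v \<Longrightarrow> cylinder \<kappa> = {the_path}"
proof (intro equalityI subsetI)
  fix y assume \<kappa>: "\<kappa> \<in> paths_from \<Lambda> v" and "y \<in> cylinder \<kappa>"
  then show "y \<in> {the_path}" using ipath_eq_the_path[of y] cylinder_rng[of y \<kappa>] by (simp add: cylinder_def paths_from_def)
next
  fix y assume \<kappa>: "\<kappa> \<in> paths_from \<Lambda> v" and "y \<in> {the_path}"
  moreover have "the_path (deg \<Lambda> \<kappa>) = \<kappa>"
    using the_path_in[of "deg \<Lambda> \<kappa>"] \<kappa> by (intro uniq) (simp_all add: paths_from_deg_def)
  ultimately show "y \<in> cylinder \<kappa>" using the_path_ipaths by (simp add: cylinder_def)
qed

definition basis_vector :: "(('k \<Rightarrow> nat) \<Rightarrow> 'm) \<Rightarrow> complex" where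
  "basis_vector y = (if y = the_path then 1 else 0)"

definition rep :: "real \<Rightarrow> (('m \<times> bool) list \<Rightarrow> complex) \<Rightarrow>
    (((('k \<Rightarrow> nat) \<Rightarrow> 'm) \<Rightarrow> complex) \<Rightarrow> (('k \<Rightarrow> nat) \<Rightarrow> 'm) \<Rightarrow> complex) \<times>
    (((('k \<Rightarrow> nat) \<Rightarrow> 'm) \<Rightarrow> complex) \<Rightarrow> (('k \<Rightarrow> nat) \<Rightarrow> 'm) \<Rightarrow> complex)" where
  "rep t = free_eval.ev op_alg (path_op i (cis t))"

definition vector_state :: "real \<Rightarrow> (('m \<times> bool) list \<Rightarrow> complex) \<Rightarrow> complex" where
  "vector_state t f = fst (rep t f) basis_vector the_path"

definition phase :: "real \<Rightarrow> complex" where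
  "phase t = cis t ^ deg \<Lambda> \<alpha> i * cnj (cis t) ^ deg \<Lambda> \<beta> i"

definition cycle_elem :: "('m \<times> bool) list \<Rightarrow> complex" where
  "cycle_elem = free_gen \<alpha> \<otimes>\<^bsub>path_alg \<Lambda>\<^esub> star (path_alg \<Lambda>) (free_gen \<beta>)"

lemma free_eval_rep: "free_eval op_alg (Mor \<Lambda>) (path_op i (cis t))"
  by (intro free_eval.intro free_eval_axioms.intro star_algebra_op_alg)
     (simp add: op_alg_simps(1) op_pair_path_op)

lemma rep_hom: "star_hom (path_alg \<Lambda>) op_alg (rep t)"
  unfolding rep_def by (rule free_eval.ev_hom[OF free_eval_rep])

lemma rep_gen: "\<kappa> \<in> Mor \<Lambda> \<Longrightarrow> rep t (free_gen \<kappa>) = path_op i (cis t) \<kappa>"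
  unfolding rep_def by (rule free_eval.ev_gen[OF free_eval_rep])

lemma rep_op_pair: "f \<in> carrier (path_alg \<Lambda>) \<Longrightarrow> op_pair (rep t f)"
  using star_homD(1)[OF rep_hom] by (simp add: op_alg_simps(1))

lemma Mor_\<alpha>\<beta>: "\<alpha> \<in> Mor \<Lambda>" "\<beta> \<in> Mor \<Lambda>"
  using \<alpha> \<beta> by (auto simp: paths_from_def)

lemma cycle_elem_carrier: "cycle_elem \<in> carrier (path_alg \<Lambda>)"
  unfolding cycle_elem_def by (intro free_mult_closed free_star_closed free_gen_carrier Mor_\<alpha>\<beta>)

text \<open>Removing \<alpha> from the infinite path and prepending \<beta> yields an infinite path
  from v again, which must be the same one; \<open>src_eq\<close> is what allows the
  exchange.\<close>

lemma rep_cycle_elem: "fst (rep t cycle_elem) \<xi> = (\<lambda>y. (phase t * \<xi> the_path) * basis_vector y)"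
proof
  fix y
  have "iprep \<beta> (ishift (deg \<Lambda> \<alpha>) the_path) = the_path" "ishift (deg \<Lambda> \<alpha>) the_path \<in> ipaths" "irng (ishift (deg \<Lambda> \<alpha>) the_path) = src \<Lambda> \<beta>"
  proof -
    have "the_path \<in> cylinder \<alpha>" using cylinder_the_path[OF \<alpha>] by simp
    from ishift_cylinder[OF this] show s: "ishift (deg \<Lambda> \<alpha>) the_path \<in> ipaths" "irng (ishift (deg \<Lambda> \<alpha>) the_path) = src \<Lambda> \<beta>"
      by (simp_all add: src_eq)
    show "iprep \<beta> (ishift (deg \<Lambda> \<alpha>) the_path) = the_path"
      using iprep_props(1)[OF s(1) Mor_\<alpha>\<beta>(2)] s(2) cylinder_the_path[OF \<beta>] by simp
  qed
  moreover have "rep t cycle_elem = path_op i (cis t) \<alpha> \<otimes>\<^bsub>op_alg\<^esub> star op_alg (path_op i (cis t) \<beta>)"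
    unfolding cycle_elem_def
    by (simp add: star_homD[OF rep_hom] free_gen_carrier free_star_closed Mor_\<alpha>\<beta> rep_gen)
  ultimately show "fst (rep t cycle_elem) \<xi> y = (phase t * \<xi> the_path) * basis_vector y"
    by (simp add: op_alg_simps path_op_def weighted_perm_def cylinder_the_path[OF \<alpha>] phase_def basis_vector_def)
qed

text \<open>The cycle element sends any vector to the phase times its coordinate at the infinite
  path times e; linearity pulls this scalar through whatever is applied afterwards.\<close>

lemma vector_state_cycle_elem:
  assumes f: "f \<in> carrier (path_alg \<Lambda>)"
  shows "vector_state t (cycle_elem \<otimes>\<^bsub>path_alg \<Lambda>\<^esub> f) = phase t * vector_state t f"
    and "vector_state t (f \<otimes>\<^bsub>path_alg \<Lambda>\<^esub> cycle_elem) = phase t * vector_state t f"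
    and "g \<in> carrier (path_alg \<Lambda>) \<Longrightarrow>
      vector_state t (f \<otimes>\<^bsub>path_alg \<Lambda>\<^esub> cycle_elem \<otimes>\<^bsub>path_alg \<Lambda>\<^esub> g) = phase t * vector_state t f * vector_state t g"
  using rep_op_pair[OF f, of t]
  by (simp_all add: vector_state_def star_homD[OF rep_hom] f cycle_elem_carrier free_mult_closed op_alg_simps
      rep_cycle_elem op_pair_def lin_opD basis_vector_def[of the_path])

text \<open>A coordinate is at most the norm of the vector, e is a unit vector, and the operator
  norm pulls back to a seminorm below the universal one.\<close>

lemma vector_state_bound:
  assumes f: "f \<in> carrier (path_alg \<Lambda>)"
  shows "cmod (vector_state t f) \<le> universal_seminorm \<Lambda> f"
proof -
  have b: "fin_supp basis_vector" by (simp add: fin_supp_def basis_vector_def)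
  have "{y. basis_vector y \<noteq> 0} = {the_path}" by (auto simp: basis_vector_def)
  then have l: "l2 basis_vector = 1" by (simp add: l2_def basis_vector_def)
  let ?\<xi> = "fst (rep t f) basis_vector"
  note p = op_pairD[OF rep_op_pair[OF f] b]
  have "cmod (vector_state t f) \<le> l2 ?\<xi>"
  proof (cases "?\<xi> the_path = 0")
    case False
    then show ?thesis
      unfolding vector_state_def l2_def using p(1)[of t]
      by (intro member_le_L2_set) (auto simp: fin_supp_def)
  qed (simp add: vector_state_def l2_nonneg)
  also have "\<dots> \<le> op_nrm (fst (rep t f))" using p(3)[of t] l by simp
  also have "\<dots> \<le> universal_seminorm \<Lambda> f"
    unfolding rep_def
    by (rule universal_upper[OF k_graph_axioms f ck_seminorm_pullback[OF k_graph_axioms star_algebra_op_alg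
          cstar_seminorm_op_nrm ck_family_path_op]]) simp
  finally show ?thesis .
qed

text \<open>The induction must allow vectors that vary with t, since a product feeds such a vector
  to its outer factor, and both components at once, since the adjoint exchanges them.\<close>

lemma rep_continuous:
  assumes "f \<in> carrier (path_alg \<Lambda>)"
  shows "\<forall>\<xi> y. (\<forall>y. continuous_on UNIV (\<lambda>t. \<xi> t y)) \<longrightarrow>
    continuous_on UNIV (\<lambda>t. fst (rep t f) (\<xi> t) y) \<and> continuous_on UNIV (\<lambda>t. snd (rep t f) (\<xi> t) y)"
  using assms
proof (induction rule: free_induct)
  case 1
  have "star_hom_pair (path_alg \<Lambda>) op_alg (rep t)" for t
    by (intro star_hom_pair.intro star_hom_pair_axioms.intro star_algebra_free star_algebra_op_alg rep_hom)
  from star_hom_pair.hom_zero[OF this]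
  have "rep t \<zero>\<^bsub>path_alg \<Lambda>\<^esub> = \<zero>\<^bsub>op_alg\<^esub>" for t .
  then show ?case by (simp add: op_alg_simps)
next
  case (2 \<kappa>)
  have cis: "continuous_on UNIV (\<lambda>t. cis t)" by (simp add: cis_conv_exp) (intro continuous_intros)
  \<comment> \<open>The domains of the weighted permutations do not depend on t, so the case
    distinction is constant in t.\<close>
  have *: "continuous_on UNIV (\<lambda>t. if b then f t else 0)" if "continuous_on UNIV f" for b and f :: "real \<Rightarrow> complex"
    using that by (cases b) auto
  show ?case
    unfolding rep_gen[OF 2] path_op_def weighted_perm_def fst_conv snd_conv
    by (intro allI impI conjI * continuous_intros cis) simp_all
next
  case (3 f g)
  then show ?case by (auto simp: star_homD[OF rep_hom] op_alg_simps intro!: continuous_intros)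
next
  case (4 c f)
  then show ?case by (auto simp: star_homD[OF rep_hom] op_alg_simps intro!: continuous_intros)
next
  case (5 f g)
  then show ?case by (simp add: star_homD[OF rep_hom] op_alg_simps)
next
  case (6 f)
  then show ?case by (simp add: star_homD[OF rep_hom] op_alg_simps)
qed

lemma phase_eq: "phase t = cis (t * (real (deg \<Lambda> \<alpha> i) - real (deg \<Lambda> \<beta> i)))"
proof -
  have "phase t = cis (real (deg \<Lambda> \<alpha> i) * t) * cis (real (deg \<Lambda> \<beta> i) * (- t))"
    by (simp add: phase_def DeMoivre cis_cnj)
  then show ?thesis by (simp add: cis_mult algebra_simps)
qed

lemma kgraph_cstar_not_AF: "\<not> AF_algebra (kgraph_cstar \<Lambda>)"
proof -
  interpret U: cstar_seminormed "path_alg \<Lambda>" "universal_seminorm \<Lambda>" by (rule universal_seminormed[OF k_graph_axioms])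
  have bf: "bounded_functional (path_alg \<Lambda>) (universal_seminorm \<Lambda>) (vector_state t)" for t
    by (intro bounded_functional.intro bounded_functional_axioms.intro U.cstar_seminormed_axioms vector_state_bound)
       (simp_all add: vector_state_def star_homD[OF rep_hom] op_alg_simps)
  define \<theta> where "\<theta> t = bounded_functional.ext_functional (path_alg \<Lambda>) (universal_seminorm \<Lambda>) (vector_state t)" for t
  note e = cycle_elem_carrier
  have "rank_one_functionals U.C (U.emb cycle_elem) \<theta> phase"
  proof (intro rank_one_functionals.intro rank_one_functionals_axioms.intro)
    show "cstar_algebra U.C" by (rule U.cstar_algebra_C)
    show "U.emb cycle_elem \<in> carrier U.C" using star_homD(1)[OF U.emb_hom e] .
    show "cmod (phase t) = 1" for t by (simp add: phase_eq)
    \<comment> \<open>The first parameter turns the phase into cis pi = -1; at 0 the phase is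
      1.\<close>
    show "\<exists>s t. phase s = - phase t"
      by (rule exI[of _ "pi / (real (deg \<Lambda> \<alpha> i) - real (deg \<Lambda> \<beta> i))"], rule exI[of _ 0])
         (use deg_neq in \<open>simp add: phase_eq\<close>)
    show "\<theta> t (U.emb cycle_elem) = phase t" for t
      unfolding \<theta>_def bounded_functional.ext_functional_emb[OF bf e]
      by (simp add: vector_state_def rep_cycle_elem basis_vector_def)
  next
    fix P t assume P: "P \<in> carrier U.C"
    have "continuous_on UNIV (\<lambda>t. vector_state t f)" if "f \<in> carrier (path_alg \<Lambda>)" for f
      using rep_continuous[OF that] unfolding vector_state_def by auto
    then show "continuous_on UNIV (\<lambda>t. \<theta> t P)"
      unfolding \<theta>_def by (rule continuous_ext_functional[OF bf _ P])
    show "\<theta> t (c \<odot>\<^bsub>U.C\<^esub> P) = c * \<theta> t P" for c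
      unfolding \<theta>_def by (rule bounded_functional.ext_functional_smult[OF bf P])
    show "cmod (\<theta> t P) \<le> nrm U.C P"
      unfolding \<theta>_def by (rule bounded_functional.ext_functional_bound[OF bf P])
    show "\<theta> t (U.emb cycle_elem \<otimes>\<^bsub>U.C\<^esub> P) = phase t * \<theta> t P"
      unfolding \<theta>_def by (rule bounded_functional.ext_functional_left[OF bf e P]) (rule vector_state_cycle_elem(1))
    show "\<theta> t (P \<otimes>\<^bsub>U.C\<^esub> U.emb cycle_elem) = phase t * \<theta> t P"
      unfolding \<theta>_def by (rule bounded_functional.ext_functional_right[OF bf e P]) (rule vector_state_cycle_elem(2))
    fix Q assume Q: "Q \<in> carrier U.C"
    show "\<theta> t (P \<oplus>\<^bsub>U.C\<^esub> Q) = \<theta> t P + \<theta> t Q"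
      unfolding \<theta>_def by (rule bounded_functional.ext_functional_add[OF bf P Q])
    show "\<theta> t (P \<otimes>\<^bsub>U.C\<^esub> U.emb cycle_elem \<otimes>\<^bsub>U.C\<^esub> Q) = phase t * \<theta> t P * \<theta> t Q"
      unfolding \<theta>_def by (rule bounded_functional.ext_functional_middle[OF bf e P Q]) (rule vector_state_cycle_elem(3))
  qed
  then show ?thesis unfolding kgraph_cstar_def by (rule rank_one_functionals.not_AF)
qed

end

theorem theorem4p2p6:
  fixes \<Lambda> :: "('o, 'm, 'k::finite) kgraph"
  assumes "k_graph \<Lambda>" and "row_finite_no_sources \<Lambda>"
  shows
    "((\<exists>\<mu> \<nu>. generalized_cycle \<Lambda> \<mu> \<nu>) \<longrightarrow>
       (\<exists>a \<in> carrier (talented_monoid \<Lambda>). \<exists>n m :: 'k \<Rightarrow> nat.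
          a \<noteq> \<one>\<^bsub>talented_monoid \<Lambda>\<^esub> \<and> n \<noteq> m \<and>
          monoid_le (talented_monoid \<Lambda>) (shift (\<lambda>i. int (n i)) a) (shift (\<lambda>i. int (m i)) a)))
     \<and> (free_action \<Lambda> \<longrightarrow>
       (\<forall>\<mu> \<nu>. generalized_cycle \<Lambda> \<mu> \<nu> \<longrightarrow> (\<exists>\<tau>. entrance \<Lambda> \<mu> \<nu> \<tau>)))
     \<and> ((\<exists>a. monoid_atom (talented_monoid \<Lambda>) a \<and> periodic a) \<longrightarrow>
       (\<exists>\<mu> \<nu>. generalized_cycle \<Lambda> \<mu> \<nu> \<and> \<not> (\<exists>\<tau>. entrance \<Lambda> \<mu> \<nu> \<tau>))
       \<and> \<not> AF_algebra (kgraph_cstar \<Lambda>))"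
proof -
  interpret row_finite_k_graph \<Lambda>
    by (intro row_finite_k_graph.intro row_finite_k_graph_axioms.intro assms)
  have "(\<exists>\<mu> \<nu>. generalized_cycle \<Lambda> \<mu> \<nu> \<and> \<not> (\<exists>\<tau>. entrance \<Lambda> \<mu> \<nu> \<tau>)) \<and> \<not> AF_algebra (kgraph_cstar \<Lambda>)"
    if "monoid_atom (talented_monoid \<Lambda>) a" "periodic a" for a
  proof -
    obtain v \<alpha> \<beta> where v: "v \<in> Obj \<Lambda>"
      and uniq: "\<And>\<kappa> \<mu>. \<lbrakk>\<kappa> \<in> paths_from \<Lambda> v; \<mu> \<in> paths_from \<Lambda> v; deg \<Lambda> \<kappa> = deg \<Lambda> \<mu>\<rbrakk> \<Longrightarrow> \<kappa> = \<mu>"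
      and p: "\<alpha> \<in> paths_from \<Lambda> v" "\<beta> \<in> paths_from \<Lambda> v" "src \<Lambda> \<alpha> = src \<Lambda> \<beta>" "deg \<Lambda> \<alpha> \<noteq> deg \<Lambda> \<beta>"
      using periodic_atom_paths[OF \<open>monoid_atom _ a\<close> \<open>periodic a\<close>] by metis
    \<comment> \<open>Distinct degrees differ in some coordinate; this one carries the gauge
      twist.\<close>
    obtain i where i: "deg \<Lambda> \<alpha> i \<noteq> deg \<Lambda> \<beta> i" using p(4) by blast
    have "\<alpha> \<noteq> \<beta>" using p(4) by auto
    have "unique_infinite_path \<Lambda> v \<alpha> \<beta> i"
      by (intro unique_infinite_path.intro unique_infinite_path_axioms.intro row_finite_k_graph_axioms v p i) (rule uniq)
    from unique_infinite_path.kgraph_cstar_not_AF[OF this] unique_paths_cycle[OF v uniq p(1-3) \<open>\<alpha> \<noteq> \<beta>\<close>]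
    show ?thesis by blast
  qed
  note atom = this
  show ?thesis
    by (intro conjI[OF impI conjI[OF impI impI]] allI impI; (elim exE conjE)?)
       (rule generalized_cycle_le free_action_entrance atom; assumption)+
qed

end
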